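(* Let $R$ be a commutative unital ring, let $P$ and $Q$ be precubical sets, and let $f\colon |P|\to|Q|$ be a weak morphism of precubical sets that is a homeomorphism. Write $H(-)$ for singular homology with coefficients in $R$ and $f_*\colon H(|P|)\to H(|Q|)$ for the induced map. Then for all homology classes $\alpha,\beta\in H(|P|)$, $\alpha\nearrow\beta$ (in $P$) if and only if $f_*(\alpha)\nearrow f_*(\beta)$ (in $Q$).
   Context: Precubical sets. A precubical set is a graded set $P=(P_n)_{n\ge 0}$ with boundary operators $d_i^k\colon P_n\to P_{n-1}$ ($n>0$, $k\in\{0,1\}$, $1\le i\le n$) satisfying $d_i^k\circ d_j^l=d_{j-1}^l\circ d_i^k$ for $i<j$, $k,l\in\{0,1\}$. Elements of $P_n$ are $n$-cubes (of degree $n$); elements of $P_0$ are vertices. A morphism is a degree-preserving map commuting with the boundary operators. A precubical subset is a graded subset (possibly empty) stable under the boundary operators. For integers $k\le l$, the precubical interval $[\![k,l]\!]$ has vertices $k,\dots,l$ and $1$-cubes $[j-1,j]$ ($k<j\le l$) with $d_1^0[j-1,j]=j-1$, $d_1^1[j-1,j]=j$. The tensor product is $(P\otimes Q)_n=\coprod_{p+q=n}P_p\times Q_q$, with $d_i^k(x,y)=(d_i^kx,y)$ for $1\le i\le\deg(x)$ and $d_i^k(x,y)=(x,d^k_{i-\deg(x)}y)$ for $\deg(x)<i\le\deg(x)+\deg(y)$. Geometric realisation. $|P|=(\coprod_{n\ge0}P_n\times[0,1]^n)/\sim$ ($P_n$ discrete), where $(d_i^kx,u)\sim(x,\delta_i^k(u))$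 and $\delta_i^k(u_1,\dots,u_n)=(u_1,\dots,u_{i-1},k,u_i,\dots,u_n)$; the class of $(x,u)$ is $[x,u]$, and $()$ is the unique point of $[0,1]^0$. For a morphism $g$, $|g|([x,u])=[g(x),u]$. For a precubical subset $X\subseteq P$, $|X|$ is regarded as a subspace of $|P|$. For $k_i\ge1$, $|[\![0,k_1]\!]\otimes\cdots\otimes[\![0,k_n]\!]|$ is identified with $[0,k_1]\times\cdots\times[0,k_n]$ via $[([i_1,i_1+1],\dots,[i_n,i_n+1]),(u_1,\dots,u_n)]\mapsto(i_1+u_1,\dots,i_n+u_n)$. Weak morphisms. A weak morphism from $P$ to $Q$ is a continuous map $f\colon|P|\to|Q|$ such that (1) for every $v\in P_0$ there is a (unique) $f_0(v)\in Q_0$ with $f([v,()])=[f_0(v),()]$; (2) for all integers $n,k_1,\dots,k_n\ge1$ and every morphism $\xi\colon[\![0,k_1]\!]\otimes\cdots\otimes[\![0,k_n]\!]\to P$ there exist integers $l_1,\dots,l_n\ge1$, a morphism $\chi\colon[\![0,l_1]\!]\otimes\cdots\otimes[\![0,l_n]\!]\to Q$ and a homeomorphism $\phi\colon[0,k_1]\times\cdots\times[0,k_n]\to[0,l_1]\times\cdots\times[0,l_n]$ such that $f\circ|\xi|=|\chi|\circ\phi$ and both $\phi$ and $\phi^{-1}$ preserve the componentwise partial order of $\mathbb{R}^n$. Paths and pointing. A path in $P$ from $x$ to $y$ is a morphism $\omega\colon[\![0,k]\!]\to P$ ($k\ge0$) with $\omega(0)=x$, $\omega(k)=y$. A homology class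 is an element of some $H_p(|P|)$, $p\ge0$. For homology classes $\alpha,\beta\in H(|P|)$ (of possibly different degrees), $\alpha\nearrow\beta$ means that there exist precubical subsets $X,Y\subseteq P$ such that $\alpha\in\operatorname{im}H(|X|\hookrightarrow|P|)$, $\beta\in\operatorname{im}H(|Y|\hookrightarrow|P|)$ and for all $x\in X_0$ and $y\in Y_0$ there is a path in $P$ from $x$ to $y$. (The homology graph of $P$ is the directed graph whose vertices are the homology classes of $|P|$ and whose edges are given by $\nearrow$.) *)

theory Defs
  imports "HOL-Analysis.Analysis" "HOL-Homology.Homology"
begin

section \<open>Precubical sets\<close>

text \<open>
  A graded set is given by a set of cubes together with a degree function, so that the set
  of \<open>n\<close>-cubes is \<open>{x \<in> cubes P. deg P x = n}\<close>. In \<open>bd P k i x\<close> the exponent \<open>k\<close> ranges over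
  the booleans, with \<open>False\<close> for \<open>0\<close> and \<open>True\<close> for \<open>1\<close>, and the index \<open>i\<close> starts at \<open>1\<close>.
  The values of \<open>deg\<close> and \<open>bd\<close> outside of their mathematical domains are irrelevant.
\<close>

record 'a precubical =
  cubes :: "'a set"
  deg :: "'a \<Rightarrow> nat"
  bd :: "bool \<Rightarrow> nat \<Rightarrow> 'a \<Rightarrow> 'a"

definition precubical_set :: "'a precubical \<Rightarrow> bool" where
  "precubical_set P \<longleftrightarrow>
     (\<forall>x\<in>cubes P. \<forall>k. \<forall>i\<in>{1..deg P x}.
        bd P k i x \<in> cubes P \<and> deg P (bd P k i x) = deg P x - 1) \<and>
     (\<forall>x\<in>cubes P. \<forall>k l. \<forall>i j. 1 \<le> i \<and> i < j \<and> j \<le> deg P x \<longrightarrow>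
        bd P k i (bd P l j x) = bd P l (j - 1) (bd P k i x))"

definition precubical_morphism :: "'a precubical \<Rightarrow> 'b precubical \<Rightarrow> ('a \<Rightarrow> 'b) \<Rightarrow> bool" where
  "precubical_morphism P Q g \<longleftrightarrow>
     (\<forall>x\<in>cubes P. g x \<in> cubes Q \<and> deg Q (g x) = deg P x) \<and>
     (\<forall>x\<in>cubes P. \<forall>k. \<forall>i\<in>{1..deg P x}. g (bd P k i x) = bd Q k i (g x))"

definition precubical_subset :: "'a precubical \<Rightarrow> 'a set \<Rightarrow> bool" where
  "precubical_subset P X \<longleftrightarrow>
     X \<subseteq> cubes P \<and> (\<forall>x\<in>X. \<forall>k. \<forall>i\<in>{1..deg P x}. bd P k i x \<in> X)"

text \<open>The constructor \<open>Edge j\<close> stands for the \<open>1\<close>-cube \<open>[j - 1, j]\<close>.\<close>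

datatype icube = Vertex int | Edge int

fun icube_deg :: "icube \<Rightarrow> nat" where
  "icube_deg (Vertex j) = 0"
| "icube_deg (Edge j) = 1"

fun icube_bd :: "bool \<Rightarrow> nat \<Rightarrow> icube \<Rightarrow> icube" where
  "icube_bd k i (Vertex j) = Vertex j"
| "icube_bd k i (Edge j) = Vertex (if k then j else j - 1)"

definition pinterval :: "int \<Rightarrow> int \<Rightarrow> icube precubical" where
  "pinterval k l = \<lparr>cubes = Vertex ` {k..l} \<union> Edge ` {k<..l}, deg = icube_deg, bd = icube_bd\<rparr>"

text \<open>
  Since the number of factors of a tensor product varies, a cube \<open>(x\<^sub>1, \<dots>, x\<^sub>n)\<close> of an
  \<open>n\<close>-fold tensor product is represented by a list. Thus \<open>tensor_Cons P Q\<close> is the binary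
  tensor product of \<open>P\<close> and \<open>Q\<close> in which the pair \<open>(x, ys)\<close> is written \<open>x # ys\<close>, and the empty
  tensor product, the unit, has a single cube, of degree \<open>0\<close>.
\<close>

definition tensor_Cons :: "'a precubical \<Rightarrow> 'a list precubical \<Rightarrow> 'a list precubical" where
  "tensor_Cons P Q =
     \<lparr>cubes = {x # ys |x ys. x \<in> cubes P \<and> ys \<in> cubes Q},
      deg = (\<lambda>z. deg P (hd z) + deg Q (tl z)),
      bd = (\<lambda>k i z. if i \<le> deg P (hd z) then bd P k i (hd z) # tl z
                    else hd z # bd Q k (i - deg P (hd z)) (tl z))\<rparr>"

primrec tensor_list :: "'a precubical list \<Rightarrow> 'a list precubical" where
  "tensor_list [] = \<lparr>cubes = {[]}, deg = (\<lambda>_. 0), bd = (\<lambda>_ _ z. z)\<rparr>"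
| "tensor_list (P # Ps) = tensor_Cons P (tensor_list Ps)"

definition pgrid :: "nat \<Rightarrow> (nat \<Rightarrow> int) \<Rightarrow> icube list precubical" where
  "pgrid n k = tensor_list (map (\<lambda>j. pinterval 0 (k j)) [1..<n + 1])"

definition precubical_path :: "'a precubical \<Rightarrow> 'a \<Rightarrow> 'a \<Rightarrow> int \<Rightarrow> (icube \<Rightarrow> 'a) \<Rightarrow> bool" where
  "precubical_path P x y k \<omega> \<longleftrightarrow>
     0 \<le> k \<and> precubical_morphism (pinterval 0 k) P \<omega> \<and> \<omega> (Vertex 0) = x \<and> \<omega> (Vertex k) = y"


section \<open>Geometric realisation\<close>

definition quotient_topology :: "'a topology \<Rightarrow> ('a \<Rightarrow> 'b) \<Rightarrow> 'b topology" where
  "quotient_topology X q =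
     topology (\<lambda>U. U \<subseteq> q ` topspace X \<and> openin X {x \<in> topspace X. q x \<in> U})"

text \<open>Points of \<open>\<real>\<^sup>n\<close> are extensional functions on \<open>{1..n}\<close>; in particular the unique point of
  \<open>[0,1]\<^sup>0\<close> is \<open>\<lambda>_. undefined\<close>.\<close>

definition unit_cube :: "nat \<Rightarrow> (nat \<Rightarrow> real) topology" where
  "unit_cube n = product_topology (\<lambda>_. top_of_set {0..1}) {1..n}"

definition cube_face :: "nat \<Rightarrow> bool \<Rightarrow> nat \<Rightarrow> (nat \<Rightarrow> real) \<Rightarrow> nat \<Rightarrow> real" where
  "cube_face n k i u =
     (\<lambda>j\<in>{1..n}. if j < i then u j else if j = i then of_bool k else u (j - 1))"

inductive face_rel :: "'a precubical \<Rightarrow> 'a \<times> (nat \<Rightarrow> real) \<Rightarrow> 'a \<times> (nat \<Rightarrow> real) \<Rightarrow> bool"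
  for P where
  "\<lbrakk>x \<in> cubes P; i \<in> {1..deg P x}; u \<in> topspace (unit_cube (deg P x - 1))\<rbrakk>
    \<Longrightarrow> face_rel P (bd P k i x, u) (x, cube_face (deg P x) k i u)"

type_synonym 'a point = "('a \<times> (nat \<Rightarrow> real)) set"

definition rpoint :: "'a precubical \<Rightarrow> 'a \<times> (nat \<Rightarrow> real) \<Rightarrow> 'a point" where
  "rpoint P p = {q. equivclp (face_rel P) p q}"

definition realisation :: "'a precubical \<Rightarrow> 'a point topology" where
  "realisation P =
     quotient_topology (sum_topology (\<lambda>x. unit_cube (deg P x)) (cubes P)) (rpoint P)"

definition realisation_map :: "'b precubical \<Rightarrow> ('a \<Rightarrow> 'b) \<Rightarrow> 'a point \<Rightarrow> 'b point" where
  "realisation_map Q g z = (\<Union>(x, u)\<in>z. rpoint Q (g x, u))"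

definition realisation_subset :: "'a precubical \<Rightarrow> 'a set \<Rightarrow> 'a point set" where
  "realisation_subset P X = {rpoint P (x, u) |x u. x \<in> X \<and> u \<in> topspace (unit_cube (deg P x))}"

abbreviation subrealisation :: "'a precubical \<Rightarrow> 'a set \<Rightarrow> 'a point topology" where
  "subrealisation P X \<equiv> subtopology (realisation P) (realisation_subset P X)"

definition vertex_point :: "'a precubical \<Rightarrow> 'a \<Rightarrow> 'a point" where
  "vertex_point P v = rpoint P (v, \<lambda>_. undefined)"


section \<open>Weak morphisms\<close>

definition box :: "nat \<Rightarrow> (nat \<Rightarrow> int) \<Rightarrow> (nat \<Rightarrow> real) topology" where
  "box n k = product_topology (\<lambda>j. top_of_set {0..real_of_int (k j)}) {1..n}"

text \<open>
  \<open>grid_point n k\<close> is the identification of the box \<open>[0,k\<^sub>1] \<times> \<dots> \<times> [0,k\<^sub>n]\<close> with the realisation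
  of \<open>pgrid n k\<close>, for \<open>k\<^sub>j \<ge> 1\<close>. It selects one \<open>n\<close>-cube containing the given point of the box; by
  \<open>grid_point_eq\<close> below, all other choices give the same point of the realisation.
\<close>

definition grid_index :: "(nat \<Rightarrow> int) \<Rightarrow> (nat \<Rightarrow> real) \<Rightarrow> nat \<Rightarrow> int" where
  "grid_index k t j = min \<lfloor>t j\<rfloor> (k j - 1)"

definition grid_cube :: "nat \<Rightarrow> (nat \<Rightarrow> int) \<Rightarrow> icube list" where
  "grid_cube n i = map (\<lambda>j. Edge (i j + 1)) [1..<n + 1]"

definition grid_point :: "nat \<Rightarrow> (nat \<Rightarrow> int) \<Rightarrow> (nat \<Rightarrow> real) \<Rightarrow> icube list point" where
  "grid_point n k t =
     rpoint (pgrid n k)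
       (grid_cube n (grid_index k t), \<lambda>j\<in>{1..n}. t j - of_int (grid_index k t j))"

definition box_mono :: "nat \<Rightarrow> (nat \<Rightarrow> int) \<Rightarrow> ((nat \<Rightarrow> real) \<Rightarrow> nat \<Rightarrow> real) \<Rightarrow> bool" where
  "box_mono n k \<phi> \<longleftrightarrow>
     (\<forall>s\<in>topspace (box n k). \<forall>t\<in>topspace (box n k).
        (\<forall>j\<in>{1..n}. s j \<le> t j) \<longrightarrow> (\<forall>j\<in>{1..n}. \<phi> s j \<le> \<phi> t j))"

definition weak_morphism :: "'a precubical \<Rightarrow> 'b precubical \<Rightarrow> ('a point \<Rightarrow> 'b point) \<Rightarrow> bool" where
  "weak_morphism P Q f \<longleftrightarrow>
     continuous_map (realisation P) (realisation Q) f \<and>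
     (\<forall>v\<in>cubes P. deg P v = 0 \<longrightarrow>
        (\<exists>w\<in>cubes Q. deg Q w = 0 \<and> f (vertex_point P v) = vertex_point Q w)) \<and>
     (\<forall>n\<ge>1. \<forall>k \<xi>. (\<forall>j\<in>{1..n}. k j \<ge> 1) \<and> precubical_morphism (pgrid n k) P \<xi> \<longrightarrow>
        (\<exists>l \<zeta> \<phi> \<psi>. (\<forall>j\<in>{1..n}. l j \<ge> 1) \<and> precubical_morphism (pgrid n l) Q \<zeta> \<and>
           homeomorphic_maps (box n k) (box n l) \<phi> \<psi> \<and> box_mono n k \<phi> \<and> box_mono n l \<psi> \<and>
           (\<forall>t\<in>topspace (box n k).
              f (realisation_map P \<xi> (grid_point n k t)) =
              realisation_map Q \<zeta> (grid_point n l (\<phi> t)))))"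


section \<open>Singular homology with coefficients\<close>

text \<open>
  The homology developed in the library has integer coefficients. Here a commutative unital ring
  is a type of sort \<open>{comm_ring, monoid_mult}\<close>, which, unlike \<open>comm_ring_1\<close>, admits the zero ring.
\<close>

type_synonym ('a, 'r) rchain = "((nat \<Rightarrow> real) \<Rightarrow> 'a) \<Rightarrow>\<^sub>0 'r"

definition rsingular_chain ::
  "nat \<Rightarrow> 'a topology \<Rightarrow> ('a, 'r::{comm_ring,monoid_mult}) rchain \<Rightarrow> bool" where
  "rsingular_chain p X c \<longleftrightarrow> Poly_Mapping.keys c \<subseteq> singular_simplex_set p X"

definition rchain_boundary ::
  "nat \<Rightarrow> ('a, 'r::{comm_ring,monoid_mult}) rchain \<Rightarrow> ('a, 'r) rchain" where
  "rchain_boundary p c =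
     (if p = 0 then 0
      else \<Sum>\<sigma>\<in>Poly_Mapping.keys c. \<Sum>k\<le>p.
             Poly_Mapping.single (singular_face p k \<sigma>) ((-1) ^ k * Poly_Mapping.lookup c \<sigma>))"

definition rsingular_cycle ::
  "nat \<Rightarrow> 'a topology \<Rightarrow> ('a, 'r::{comm_ring,monoid_mult}) rchain \<Rightarrow> bool" where
  "rsingular_cycle p X c \<longleftrightarrow> rsingular_chain p X c \<and> rchain_boundary p c = 0"

definition rhomologous ::
  "nat \<Rightarrow> 'a topology \<Rightarrow> ('a, 'r::{comm_ring,monoid_mult}) rchain \<Rightarrow> ('a, 'r) rchain \<Rightarrow> bool" where
  "rhomologous p X a b \<longleftrightarrow> (\<exists>d. rsingular_chain (Suc p) X d \<and> rchain_boundary (Suc p) d = a - b)"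

text \<open>A homology class is a coset of boundaries, together with its degree.\<close>

type_synonym ('a, 'r) hclass = "nat \<times> ('a, 'r) rchain set"

definition rhomology :: "'a topology \<Rightarrow> ('a, 'r::{comm_ring,monoid_mult}) hclass set" where
  "rhomology X = {(p, {b. rhomologous p X a b}) |p a. rsingular_cycle p X a}"

definition rchain_map ::
  "nat \<Rightarrow> ('a \<Rightarrow> 'b) \<Rightarrow> ('a, 'r::{comm_ring,monoid_mult}) rchain \<Rightarrow> ('b, 'r) rchain" where
  "rchain_map p g c =
     (\<Sum>\<sigma>\<in>Poly_Mapping.keys c.
        Poly_Mapping.single (simplex_map p g \<sigma>) (Poly_Mapping.lookup c \<sigma>))"

text \<open>The map induced in homology by a continuous map \<open>g\<close> with codomain \<open>Y\<close>.\<close>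

definition rhom_induced ::
  "'b topology \<Rightarrow> ('a \<Rightarrow> 'b) \<Rightarrow> ('a, 'r::{comm_ring,monoid_mult}) hclass \<Rightarrow> ('b, 'r) hclass" where
  "rhom_induced Y g \<alpha> =
     (fst \<alpha>, \<Union>a\<in>snd \<alpha>. {b. rhomologous (fst \<alpha>) Y (rchain_map (fst \<alpha>) g a) b})"


section \<open>The edges of the homology graph\<close>

definition homology_edge ::
  "'a precubical \<Rightarrow> ('a point, 'r::{comm_ring,monoid_mult}) hclass \<Rightarrow> ('a point, 'r) hclass \<Rightarrow> bool"
  where
  "homology_edge P \<alpha> \<beta> \<longleftrightarrow>
     (\<exists>X Y. precubical_subset P X \<and> precubical_subset P Y \<and>
        \<alpha> \<in> rhom_induced (realisation P) id ` rhomology (subrealisation P X) \<and>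
        \<beta> \<in> rhom_induced (realisation P) id ` rhomology (subrealisation P Y) \<and>
        (\<forall>x\<in>X. \<forall>y\<in>Y. deg P x = 0 \<and> deg P y = 0 \<longrightarrow> (\<exists>k \<omega>. precubical_path P x y k \<omega>)))"


section \<open>Consistency of the definitions\<close>

lemma istopology_quotient:
  "istopology (\<lambda>U. U \<subseteq> q ` topspace X \<and> openin X {x \<in> topspace X. q x \<in> U})"
proof -
  have 1: "{x \<in> topspace X. q x \<in> S \<inter> T} = {x \<in> topspace X. q x \<in> S} \<inter> {x \<in> topspace X. q x \<in> T}"
    for S T by auto
  have 2: "{x \<in> topspace X. q x \<in> \<Union>\<K>} = (\<Union>K\<in>\<K>. {x \<in> topspace X. q x \<in> K})" for \<K> by auto
  show ?thesis
    unfolding istopology_def 1 2 by blast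
qed

lemma openin_quotient_topology:
  "openin (quotient_topology X q) U \<longleftrightarrow>
     U \<subseteq> q ` topspace X \<and> openin X {x \<in> topspace X. q x \<in> U}"
  by (simp add: quotient_topology_def istopology_quotient)

lemma topspace_quotient_topology [simp]:
  "topspace (quotient_topology X q) = q ` topspace X"
proof -
  have "{x \<in> topspace X. q x \<in> q ` topspace X} = topspace X"
    by auto
  then have "openin (quotient_topology X q) (q ` topspace X)"
    by (simp add: openin_quotient_topology)
  then show ?thesis
    using openin_topspace[of "quotient_topology X q"] openin_subset
    unfolding openin_quotient_topology[of X q "topspace _"] by blast
qed

lemma quotient_map_quotient_topology: "quotient_map X (quotient_topology X q) q"
  by (simp add: quotient_map_def openin_quotient_topology)

lemma topspace_unit_cube: "topspace (unit_cube n) = {1..n} \<rightarrow>\<^sub>E {0..1}"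
  by (simp add: unit_cube_def)

lemma topspace_realisation:
  "topspace (realisation P) = {rpoint P (x, u) |x u. x \<in> cubes P \<and> u \<in> topspace (unit_cube (deg P x))}"
  unfolding realisation_def topspace_quotient_topology topspace_sum_topology
  by (intro subset_antisym subsetI) (clarsimp, blast, clarsimp)

lemma rpoint_eq_iff: "rpoint P p = rpoint P q \<longleftrightarrow> equivclp (face_rel P) p q"
proof -
  have "equivp (equivclp (face_rel P))" by simp
  then have "equivclp (face_rel P) p q \<longleftrightarrow> equivclp (face_rel P) p = equivclp (face_rel P) q"
    unfolding equivp_def by blast
  then show ?thesis by (auto simp: rpoint_def)
qed

lemma rpoint_face:
  "\<lbrakk>x \<in> cubes P; i \<in> {1..deg P x}; u \<in> topspace (unit_cube (deg P x - 1))\<rbrakk>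
    \<Longrightarrow> rpoint P (bd P k i x, u) = rpoint P (x, cube_face (deg P x) k i u)"
  unfolding rpoint_eq_iff by (intro r_into_equivclp face_rel.intros)

lemma realisation_map_rpoint:
  assumes g: "precubical_morphism P Q g"
  shows "realisation_map Q g (rpoint P (x, u)) = rpoint Q (g x, u)"
proof -
  have face: "rpoint Q (g (fst p), snd p) = rpoint Q (g (fst q), snd q)" if "face_rel P p q" for p q
    using that
  proof cases
    case (1 x i u k)
    then have "bd Q k i (g x) = g (bd P k i x)" "g x \<in> cubes Q" "deg Q (g x) = deg P x"
      using g by (auto simp: precubical_morphism_def)
    then show ?thesis
      using 1 rpoint_face[of "g x" Q i u k] by simp
  qed
  have *: "rpoint Q (g (fst q), snd q) = rpoint Q (g (fst p), snd p)"
    if "equivclp (face_rel P) p q" for p q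
    using that
  proof (induction rule: equivclp_induct)
    case base
    show ?case by (rule refl)
  next
    case (step y z)
    then show ?case using face[of y z] face[of z y] by argo
  qed
  have "(x, u) \<in> rpoint P (x, u)"
    by (simp add: rpoint_def)
  moreover have "(case p of (y, v) \<Rightarrow> rpoint Q (g y, v)) = rpoint Q (g x, u)" if "p \<in> rpoint P (x, u)" for p
    using that *[of "(x, u)" p] by (simp add: rpoint_def[of P] case_prod_beta)
  ultimately have "(\<lambda>(y, v). rpoint Q (g y, v)) ` rpoint P (x, u) = {rpoint Q (g x, u)}"
    by blast
  then show ?thesis
    by (simp add: realisation_map_def)
qed

lemma precubical_set_pinterval: "precubical_set (pinterval k l)"
  by (auto simp: precubical_set_def pinterval_def)

lemma precubical_set_tensor_Cons:
  assumes P: "precubical_set P" and Q: "precubical_set Q"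
  shows "precubical_set (tensor_Cons P Q)"
  unfolding precubical_set_def
proof (intro conjI ballI allI impI)
  fix z k i
  assume z: "z \<in> cubes (tensor_Cons P Q)" and i: "i \<in> {1..deg (tensor_Cons P Q) z}"
  obtain x ys where [simp]: "z = x # ys" and xy: "x \<in> cubes P" "ys \<in> cubes Q"
    using z by (auto simp: tensor_Cons_def)
  have "bd Q k (i - deg P x) ys \<in> cubes Q \<and> deg Q (bd Q k (i - deg P x) ys) = deg Q ys - 1"
    if "\<not> i \<le> deg P x"
  proof -
    have "i - deg P x \<in> {1..deg Q ys}"
      using i that by (auto simp: tensor_Cons_def)
    then show ?thesis
      using Q xy unfolding precubical_set_def by blast
  qed
  moreover have "bd P k i x \<in> cubes P \<and> deg P (bd P k i x) = deg P x - 1" if "i \<le> deg P x"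
    using P xy i that by (auto simp: precubical_set_def)
  ultimately show "bd (tensor_Cons P Q) k i z \<in> cubes (tensor_Cons P Q)"
    and "deg (tensor_Cons P Q) (bd (tensor_Cons P Q) k i z) = deg (tensor_Cons P Q) z - 1"
    using xy i by (auto simp: tensor_Cons_def)
next
  fix z k l i j
  assume z: "z \<in> cubes (tensor_Cons P Q)"
    and ij: "1 \<le> i \<and> i < j \<and> j \<le> deg (tensor_Cons P Q) z"
  obtain x ys where [simp]: "z = x # ys" and xy: "x \<in> cubes P" "ys \<in> cubes Q"
    using z by (auto simp: tensor_Cons_def)
  have dP: "deg P (bd P k i x) = deg P x - 1" if "1 \<le> i" "i \<le> deg P x" for k i
    using P xy that by (auto simp: precubical_set_def)
  have PP: "bd P k i (bd P l j x) = bd P l (j - 1) (bd P k i x)" if "j \<le> deg P x"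
    using P xy ij that by (auto simp: precubical_set_def)
  let ?m = "deg P x"
  have QQ: "bd Q k (i - ?m) (bd Q l (j - ?m) ys) = bd Q l (j - 1 - ?m) (bd Q k (i - ?m) ys)"
    if "?m < i"
  proof -
    have "1 \<le> i - ?m \<and> i - ?m < j - ?m \<and> j - ?m \<le> deg Q ys"
      using ij that by (auto simp: tensor_Cons_def)
    then have "bd Q k (i - ?m) (bd Q l (j - ?m) ys) = bd Q l (j - ?m - 1) (bd Q k (i - ?m) ys)"
      using Q xy unfolding precubical_set_def by blast
    then show ?thesis by (simp add: diff_commute)
  qed
  consider "j \<le> ?m" | "i \<le> ?m" "?m < j" | "?m < i" by linarith
  then show "bd (tensor_Cons P Q) k i (bd (tensor_Cons P Q) l j z) =
        bd (tensor_Cons P Q) l (j - 1) (bd (tensor_Cons P Q) k i z)"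
  proof cases
    case 1
    then show ?thesis using ij dP PP by (auto simp: tensor_Cons_def)
  next
    case 2
    have "\<not> j - 1 \<le> ?m - 1" "j - 1 - (?m - 1) = j - ?m"
      using 2 ij by linarith+
    then show ?thesis using 2 ij dP by (simp add: tensor_Cons_def)
  next
    case 3
    then show ?thesis using ij QQ by (auto simp: tensor_Cons_def)
  qed
qed

lemma precubical_set_tensor_list:
  "(\<And>P. P \<in> set Ps \<Longrightarrow> precubical_set P) \<Longrightarrow> precubical_set (tensor_list Ps)"
proof (induction Ps)
  case Nil
  then show ?case by (simp add: precubical_set_def)
next
  case (Cons P Ps)
  then show ?case by (simp add: precubical_set_tensor_Cons)
qed

lemma precubical_set_pgrid: "precubical_set (pgrid n k)"
  unfolding pgrid_def
  by (rule precubical_set_tensor_list) (auto simp: precubical_set_pinterval)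

lemma cubes_tensor_list:
  "cubes (tensor_list Ps) = {xs. list_all2 (\<lambda>x P. x \<in> cubes P) xs Ps}"
  by (induction Ps) (auto simp: tensor_Cons_def list_all2_Cons2)

lemma deg_tensor_list_edges:
  assumes "length es = length Ps" "set es \<subseteq> range Edge"
    "\<forall>P\<in>set Ps. deg P = icube_deg"
  shows "deg (tensor_list Ps) es = length es"
  using assms by (induction es Ps rule: list_induct2) (auto simp: tensor_Cons_def)

lemma bd_tensor_list_edges:
  assumes "length es = length Ps" "set es \<subseteq> range Edge" "i \<in> {1..length es}"
    "\<forall>P\<in>set Ps. deg P = icube_deg \<and> bd P = icube_bd"
  shows "bd (tensor_list Ps) k i es = es[i - 1 := icube_bd k 1 (es ! (i - 1))]"
  using assms
proof (induction es Ps arbitrary: i rule: list_induct2)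
  case Nil
  then show ?case by simp
next
  case (Cons e es P Ps)
  then obtain j where [simp]: "e = Edge j" by auto
  show ?case
  proof (cases "i = 1")
    case True
    then show ?thesis using Cons.prems by (simp add: tensor_Cons_def)
  next
    case False
    then obtain m where [simp]: "i = Suc (Suc m)" and m: "Suc m \<in> {1..length es}"
      using Cons.prems by (metis One_nat_def Suc_le_mono atLeastAtMost_iff length_Cons not0_implies_Suc not_one_le_zero Suc_le_eq zero_less_Suc)
    then show ?thesis using Cons.prems Cons.IH[OF _ m] by (simp add: tensor_Cons_def)
  qed
qed

lemma length_grid_cube: "length (grid_cube n i) = n"
  by (simp add: grid_cube_def)

lemma nth_grid_cube: "m < n \<Longrightarrow> grid_cube n i ! m = Edge (i (Suc m) + 1)"
  by (simp add: grid_cube_def del: upt_Suc)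

lemma set_grid_cube: "set (grid_cube n i) \<subseteq> range Edge"
  by (auto simp: grid_cube_def)

lemma grid_cube_in_pgrid:
  assumes "\<forall>j\<in>{1..n}. 0 \<le> i j \<and> i j < k j"
  shows "grid_cube n i \<in> cubes (pgrid n k)"
proof -
  have "Edge (i (Suc m) + 1) \<in> cubes (pinterval 0 (k (Suc m)))" if "m < n" for m
  proof -
    have "i (Suc m) + 1 \<in> {0<..k (Suc m)}"
      using assms[rule_format, of "Suc m"] that by simp
    then show ?thesis by (simp add: pinterval_def)
  qed
  then show ?thesis
    by (simp add: pgrid_def cubes_tensor_list list_all2_conv_all_nth length_grid_cube nth_grid_cube
        del: upt_Suc)
qed

lemma deg_grid_cube: "deg (pgrid n k) (grid_cube n i) = n"
  unfolding pgrid_def by (subst deg_tensor_list_edges) (use set_grid_cube in \<open>auto simp: length_grid_cube pinterval_def simp del: upt_Suc\<close>)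

lemma bd_grid_cube:
  assumes "m \<in> {1..n}"
  shows "bd (pgrid n k) b m (grid_cube n i) =
    (grid_cube n i)[m - 1 := Vertex (if b then i m + 1 else i m)]"
proof -
  have "grid_cube n i ! (m - 1) = Edge (i m + 1)"
    using assms by (cases m) (auto simp: nth_grid_cube)
  then show ?thesis
    unfolding pgrid_def using assms
    by (subst bd_tensor_list_edges)
      (use set_grid_cube in \<open>auto simp: length_grid_cube pinterval_def simp del: upt_Suc\<close>)
qed

lemma grid_cube_step:
  assumes i: "\<forall>j\<in>{1..n}. 0 \<le> i j \<and> i j < k j" and m: "m \<in> {1..n}" "i m + 1 < k m"
    and u: "u \<in> topspace (unit_cube n)" "u m = 1"
  shows "rpoint (pgrid n k) (grid_cube n i, u) =
    rpoint (pgrid n k) (grid_cube n (i(m := i m + 1)), u(m := 0))"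
proof -
  let ?i = "i(m := i m + 1)"
  define v where "v = (\<lambda>j\<in>{1..n - 1}. if j < m then u j else u (j + 1))"
  have v: "v \<in> topspace (unit_cube (n - 1))"
    using u(1) by (auto simp: topspace_unit_cube v_def PiE_iff)
  have u1: "cube_face n True m v = u" and u0: "cube_face n False m v = u(m := 0)"
    using u m(1) by (auto simp: cube_face_def v_def topspace_unit_cube PiE_iff extensional_def fun_eq_iff)
  have "grid_cube n ?i = (grid_cube n i)[m - 1 := Edge (i m + 2)]"
    using m(1) 
    by (intro nth_equalityI) (auto simp: length_grid_cube nth_grid_cube nth_list_update)
  then have bd: "bd (pgrid n k) True m (grid_cube n i) = bd (pgrid n k) False m (grid_cube n ?i)"
    using bd_grid_cube[OF m(1), of k True i] bd_grid_cube[OF m(1), of k False ?i] by simp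
  have i': "\<forall>j\<in>{1..n}. 0 \<le> ?i j \<and> ?i j < k j"
    using i m by auto
  show ?thesis
    using rpoint_face[OF grid_cube_in_pgrid[OF i], of m v True]
      rpoint_face[OF grid_cube_in_pgrid[OF i'], of m v False] m(1) v u1 u0 bd
    by (simp add: deg_grid_cube del: fun_upd_apply)
qed

theorem grid_point_eq:
  assumes "\<forall>j\<in>{1..n}. 0 \<le> i j \<and> i j < k j" and "u \<in> topspace (unit_cube n)"
  shows "grid_point n k (\<lambda>j\<in>{1..n}. of_int (i j) + u j) = rpoint (pgrid n k) (grid_cube n i, u)"
  using assms
proof (induction "card {j \<in> {1..n}. u j = 1 \<and> i j + 1 < k j}" arbitrary: i u)
  case 0
  let ?t = "\<lambda>j\<in>{1..n}. of_int (i j) + u j"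
  have idx: "grid_index k ?t j = i j" if j: "j \<in> {1..n}" for j
  proof -
    have u: "0 \<le> u j" "u j \<le> 1"
      using 0 j by (auto simp: topspace_unit_cube PiE_iff)
    have k: "i j + 1 < k j \<Longrightarrow> u j \<noteq> 1" "i j < k j"
      using 0 j by auto
    have "\<lfloor>of_int (i j) + u j\<rfloor> = (if u j = 1 then i j + 1 else i j)"
      using u by (auto simp: floor_eq_iff)
    then show ?thesis
      using k j by (cases "u j = 1") (force simp: grid_index_def min_def j)+
  qed
  have "grid_cube n (grid_index k ?t) = grid_cube n i"
    using idx by (auto simp: grid_cube_def simp del: restrict_apply restrict_apply')
  moreover have "(\<lambda>j\<in>{1..n}. ?t j - of_int (grid_index k ?t j)) = u"
    using 0 idx by (auto simp: topspace_unit_cube PiE_iff extensional_def fun_eq_iff)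
  ultimately show ?case
    by (simp only: grid_point_def)
next
  case (Suc c)
  let ?J = "\<lambda>i u. {j \<in> {1..n}. u j = 1 \<and> i j + 1 < k j}"
  obtain m where m: "m \<in> ?J i u"
    using Suc.hyps(2) by (metis card.empty ex_in_conv nat.distinct(1))
  let ?i = "i(m := i m + 1)" and ?u = "u(m := 0)"
  have "?J ?i ?u = ?J i u - {m}" by auto
  then have "c = card (?J ?i ?u)"
    using Suc.hyps(2) m by simp
  moreover have "\<forall>j\<in>{1..n}. 0 \<le> ?i j \<and> ?i j < k j" "?u \<in> topspace (unit_cube n)"
    using Suc.prems m by (auto simp: topspace_unit_cube PiE_iff extensional_def)
  ultimately have "grid_point n k (\<lambda>j\<in>{1..n}. of_int (?i j) + ?u j) =
      rpoint (pgrid n k) (grid_cube n ?i, ?u)"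
    by (rule Suc.hyps(1))
  moreover have "(\<lambda>j\<in>{1..n}. of_int (?i j) + ?u j) = (\<lambda>j\<in>{1..n}. of_int (i j) + u j)"
    using m by (auto simp: fun_eq_iff)
  ultimately show ?case
    using grid_cube_step[of n i k m u] Suc.prems m by simp
qed

end

theory Submission
  imports Defs "HOL-Library.Confluence"
begin

text \<open>
  In the definition of a weak morphism applied to a single cube \<open>x\<close> of \<open>P\<close>, the order isomorphism \<open>\<phi>\<close>
  between boxes is a product of increasing bijections up to a permutation of the coordinates, so
  \<open>f\<close> subdivides \<open>x\<close> as a product.

  Forwards, \<open>f\<close> maps \<open>|X|\<close> onto the realisation of a precubical subset, each vertex of
  which lies on a path from \<open>f(v)\<close> to \<open>f(w)\<close> for vertices \<open>v, w\<close> of some cube of \<open>X\<close>.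

  Backwards, the preimage of \<open>|X|\<close> need not be the realisation of a precubical subset. Stretch the
  first piece of every subdivided edge to the whole edge and collapse the other pieces to its end
  point. Being defined by \<open>f\<close> on edges, this is compatible with faces and gives a self-map of
  \<open>|P|\<close> homotopic to the identity. Composed with the inverse of \<open>f\<close>, it maps cells onto cells, and
  edges onto edges or vertices. Hence it carries precubical subsets and paths from \<open>Q\<close> to \<open>P\<close>
  without changing homology classes.
\<close>

section \<open>Singular homology with coefficients\<close>

text \<open>The charts of different cubes come from unrelated choices of grids and order
  isomorphisms, so they cannot be compared directly along a common face. What can be compared
  depends on points of |Q| alone: whether a point is a vertex, its smallest closed cell, and the
  lowest and highest corners of that cell. In a chart these become integrality, floor and ceiling of
  coordinates, and all comparisons pass through this dictionary. The preimage of |X| may consist of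
  small pieces deep inside a cube of P, containing no vertex of P. Under the squash the piece at the
  lowest corner fills the whole cube, and all other pieces are flattened into its faces. Grid points
  therefore go to corners, comparable ones to comparable ones, and comparable corners of a cube are
  joined by a path. A path in Q is moved one edge at a time, because the midpoint of an edge
  determines a cube of P in which both end points are visible.\<close>

lemma poly_mapping_eq_sum_single:
  "c = (\<Sum>\<sigma>\<in>Poly_Mapping.keys c. Poly_Mapping.single \<sigma> (Poly_Mapping.lookup c \<sigma>))"
proof (rule poly_mapping_eqI)
  fix \<tau>
  have "(\<Sum>\<sigma>\<in>Poly_Mapping.keys c. Poly_Mapping.lookup (Poly_Mapping.single \<sigma> (Poly_Mapping.lookup c \<sigma>)) \<tau>) =
      (\<Sum>\<sigma>\<in>Poly_Mapping.keys c. if \<sigma> = \<tau> then Poly_Mapping.lookup c \<tau> else 0)"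
    by (rule sum.cong) (auto simp: lookup_single when_def)
  then show "Poly_Mapping.lookup c \<tau> = Poly_Mapping.lookup
      (\<Sum>\<sigma>\<in>Poly_Mapping.keys c. Poly_Mapping.single \<sigma> (Poly_Mapping.lookup c \<sigma>)) \<tau>"
    by (simp add: lookup_sum in_keys_iff)
qed

text \<open>Coefficients range over the whole group, since additivity alone does not reduce a
  coefficient to \<open>1\<close>. The equality is asked on the support of \<open>c\<close> only,
  where the generators can be known to be singular simplices of a given space.\<close>

lemma additive_eq_on_singles:
  assumes S: "Modules.additive S" and T: "Modules.additive T"
    and eq: "\<And>\<sigma> r. \<sigma> \<in> Poly_Mapping.keys c \<Longrightarrow> S (Poly_Mapping.single \<sigma> r) = T (Poly_Mapping.single \<sigma> r)"
  shows "S c = T c"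
proof -
  have "S c = (\<Sum>\<sigma>\<in>Poly_Mapping.keys c. S (Poly_Mapping.single \<sigma> (Poly_Mapping.lookup c \<sigma>)))"
    using Modules.additive.sum[OF S] poly_mapping_eq_sum_single[of c] by metis
  also have "\<dots> = (\<Sum>\<sigma>\<in>Poly_Mapping.keys c. T (Poly_Mapping.single \<sigma> (Poly_Mapping.lookup c \<sigma>)))"
    by (rule sum.cong) (auto simp: eq)
  also have "\<dots> = T c"
    using Modules.additive.sum[OF T] poly_mapping_eq_sum_single[of c] by metis
  finally show ?thesis .
qed

lemma additive_compose: "Modules.additive S \<Longrightarrow> Modules.additive T \<Longrightarrow> Modules.additive (\<lambda>x. S (T x))"
  by (simp add: Modules.additive_def)

lemma additive_minus: "Modules.additive S \<Longrightarrow> Modules.additive T \<Longrightarrow> Modules.additive (\<lambda>x. S x - T x)"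
  by (simp add: Modules.additive_def)

lemma additive_single: "Modules.additive (Poly_Mapping.single \<sigma>)"
  by (simp add: Modules.additive_def single_add)

text \<open>When each \<open>F \<sigma>\<close> is additive, this is the map out of a direct sum
  given by its components. The coefficient is an argument of \<open>F\<close>, because the target is
  a mere abelian group without an action of the ring.\<close>

definition rext :: "('s \<Rightarrow> 'r \<Rightarrow> 'b) \<Rightarrow> ('s \<Rightarrow>\<^sub>0 'r::ab_group_add) \<Rightarrow> 'b::ab_group_add" where
  "rext F c = (\<Sum>\<sigma>\<in>Poly_Mapping.keys c. F \<sigma> (Poly_Mapping.lookup c \<sigma>))"

lemma rext_superset:
  assumes "\<And>\<sigma>. F \<sigma> 0 = 0" "finite A" "Poly_Mapping.keys c \<subseteq> A"
  shows "rext F c = (\<Sum>\<sigma>\<in>A. F \<sigma> (Poly_Mapping.lookup c \<sigma>))"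
  unfolding rext_def using assms
  by (intro sum.mono_neutral_left) (auto simp: in_keys_iff)

lemma additive_rext:
  assumes "\<And>\<sigma>. Modules.additive (F \<sigma>)"
  shows "Modules.additive (rext F)"
proof
  fix x y :: "'a \<Rightarrow>\<^sub>0 'b"
  let ?A = "Poly_Mapping.keys x \<union> Poly_Mapping.keys y"
  have 0: "\<And>\<sigma>. F \<sigma> 0 = 0" using assms Modules.additive.zero by blast
  show "rext F (x + y) = rext F x + rext F y"
    using Poly_Mapping.keys_add[of x y]
    by (simp add: rext_superset[where F = F, OF 0, of ?A] lookup_add Modules.additive.add[OF assms] sum.distrib)
qed

lemma rext_single:
  assumes "Modules.additive (F \<sigma>)"
  shows "rext F (Poly_Mapping.single \<sigma> r) = F \<sigma> r"
  using Modules.additive.zero[OF assms] by (auto simp: rext_def)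

section \<open>Boundaries and chain maps as additive extensions\<close>

definition simplex_boundary ::
    "nat \<Rightarrow> ((nat \<Rightarrow> real) \<Rightarrow> 'a) \<Rightarrow> 'r::{comm_ring,monoid_mult} \<Rightarrow> ('a, 'r) rchain" where
  "simplex_boundary p \<sigma> r =
    (if p = 0 then 0 else \<Sum>k\<le>p. Poly_Mapping.single (singular_face p k \<sigma>) ((-1) ^ k * r))"

lemma additive_simplex_boundary: "Modules.additive (simplex_boundary p \<sigma>)"
  by (cases p)
    (auto simp: Modules.additive_def simplex_boundary_def distrib_left single_add sum.distrib simp del: sum.atMost_Suc)

lemma rchain_boundary_eq_rext: "rchain_boundary p = rext (simplex_boundary p)"
  by (auto simp: rchain_boundary_def rext_def simplex_boundary_def)

lemma rchain_map_eq_rext: "rchain_map p g = rext (\<lambda>\<sigma>. Poly_Mapping.single (simplex_map p g \<sigma>))"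
  by (auto simp: rchain_map_def rext_def)

lemma additive_rchain_boundary: "Modules.additive (rchain_boundary p)"
  unfolding rchain_boundary_eq_rext by (intro additive_rext additive_simplex_boundary)

lemma additive_rchain_map: "Modules.additive (rchain_map p g)"
  unfolding rchain_map_eq_rext by (intro additive_rext additive_single)

lemma rchain_boundary_single:
  "rchain_boundary p (Poly_Mapping.single \<sigma> r) = simplex_boundary p \<sigma> r"
  unfolding rchain_boundary_eq_rext by (intro rext_single additive_simplex_boundary)

lemma rchain_map_single:
  "rchain_map p g (Poly_Mapping.single \<sigma> r) = Poly_Mapping.single (simplex_map p g \<sigma>) r"
  unfolding rchain_map_eq_rext by (intro rext_single additive_single)

lemma single_int_eq: "Poly_Mapping.single \<sigma> n = frag_cmul n (frag_of \<sigma>)"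
  by (rule poly_mapping_eqI) (simp add: lookup_single when_def)

lemma additive_chain_boundary: "Modules.additive (chain_boundary p)"
  by (simp add: Modules.additive_def chain_boundary_add)

lemma additive_chain_map: "Modules.additive (chain_map p g)"
  by (simp add: Modules.additive_def chain_map_add)

text \<open>For integer coefficients this is the boundary operator of the library, whose results on
  integral chains then produce the chains of the universal prism.\<close>

lemma rchain_boundary_int: "rchain_boundary p c = chain_boundary p c"
proof (rule additive_eq_on_singles[OF additive_rchain_boundary additive_chain_boundary])
  fix \<sigma> :: "(nat \<Rightarrow> real) \<Rightarrow> 'a" and r :: int
  have "Poly_Mapping.single \<tau> ((-1) ^ k * r) = frag_cmul r (frag_cmul ((-1) ^ k) (frag_of \<tau>))"
    for \<tau> :: "(nat \<Rightarrow> real) \<Rightarrow> 'a" and k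
    unfolding single_int_eq[of \<tau> "(-1) ^ k * r"] by (simp add: mult.commute)
  then show "rchain_boundary p (Poly_Mapping.single \<sigma> r) = chain_boundary p (Poly_Mapping.single \<sigma> r)"
    unfolding single_int_eq[of \<sigma> r] chain_boundary_cmul chain_boundary_of
    by (simp add: rchain_boundary_single simplex_boundary_def frag_cmul_sum single_int_eq[of \<sigma> r, symmetric]
        del: sum.atMost_Suc frag_cmul_cmul)
qed

lemma rchain_map_int: "rchain_map p g c = chain_map p g c"
proof (rule additive_eq_on_singles[OF additive_rchain_map additive_chain_map])
  fix \<sigma> and r :: int
  show "rchain_map p g (Poly_Mapping.single \<sigma> r) = chain_map p g (Poly_Mapping.single \<sigma> r)"
    unfolding rchain_map_single single_int_eq[of "simplex_map p g \<sigma>" r]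
    unfolding single_int_eq[of \<sigma> r] by simp
qed

lemma rsingular_chain_int: "rsingular_chain p X c \<longleftrightarrow> singular_chain p X c"
  by (simp add: rsingular_chain_def singular_chain_def)

lemma rsingular_chain_single: "singular_simplex p X \<sigma> \<Longrightarrow> rsingular_chain p X (Poly_Mapping.single \<sigma> r)"
  by (auto simp: rsingular_chain_def split: if_splits)

lemma rsingular_chain_diff:
  "rsingular_chain p X a \<Longrightarrow> rsingular_chain p X b \<Longrightarrow> rsingular_chain p X (a - b)"
  unfolding rsingular_chain_def using keys_diff[of a b] by blast

lemma rsingular_chain_sum:
  "(\<And>i. i \<in> I \<Longrightarrow> rsingular_chain p X (a i)) \<Longrightarrow> rsingular_chain p X (sum a I)"
  unfolding rsingular_chain_def using keys_sum[of a I] by blast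

lemma rsingular_chain_rext:
  assumes "rsingular_chain p X c" "\<And>\<sigma> r. singular_simplex p X \<sigma> \<Longrightarrow> rsingular_chain q Y (F \<sigma> r)"
  shows "rsingular_chain q Y (rext F c)"
  unfolding rext_def using assms by (intro rsingular_chain_sum) (auto simp: rsingular_chain_def)

lemma rsingular_chain_map:
  "rsingular_chain p X c \<Longrightarrow> continuous_map X Y g \<Longrightarrow> rsingular_chain p Y (rchain_map p g c)"
  unfolding rchain_map_eq_rext
  by (erule rsingular_chain_rext) (intro rsingular_chain_single singular_simplex_simplex_map)

lemma rchain_map_compose: "rchain_map p (h \<circ> g) c = rchain_map p h (rchain_map p g c)"
  by (rule additive_eq_on_singles[OF additive_rchain_map additive_compose[OF additive_rchain_map additive_rchain_map]])
    (simp add: rchain_map_single simplex_map_compose)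

lemma rchain_map_cong:
  assumes "rsingular_chain p X c" "\<And>x. x \<in> topspace X \<Longrightarrow> f x = g x"
  shows "rchain_map p f c = rchain_map p g c"
proof (rule additive_eq_on_singles[OF additive_rchain_map additive_rchain_map])
  fix \<sigma> and r :: 'b
  assume "\<sigma> \<in> Poly_Mapping.keys c"
  then have "singular_simplex p X \<sigma>"
    using assms(1) by (auto simp: rsingular_chain_def)
  then show "rchain_map p f (Poly_Mapping.single \<sigma> r) = rchain_map p g (Poly_Mapping.single \<sigma> r)"
    using simplex_map_eq[of p X \<sigma> f g] assms(2) by (simp add: rchain_map_single)
qed

lemma rchain_map_ident:
  assumes "rsingular_chain p X c" "\<And>x. x \<in> topspace X \<Longrightarrow> f x = x"
  shows "rchain_map p f c = c"
proof -
  have "rchain_map p f c = (\<lambda>c. c) c"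
  proof (rule additive_eq_on_singles[OF additive_rchain_map])
    show "Modules.additive (\<lambda>c::('a,'b) rchain. c)"
      by (simp add: Modules.additive_def)
    fix \<sigma> and r :: 'b
    assume "\<sigma> \<in> Poly_Mapping.keys c"
    then have "singular_simplex p X \<sigma>"
      using assms(1) by (auto simp: rsingular_chain_def)
    then show "rchain_map p f (Poly_Mapping.single \<sigma> r) = Poly_Mapping.single \<sigma> r"
      using simplex_map_id_gen[of p X \<sigma> f] assms(2) by (simp add: rchain_map_single)
  qed
  then show ?thesis .
qed

lemma singular_face_map:
  assumes "0 < p" "k \<le> p"
  shows "singular_face p k (simplex_map p g \<sigma>) = simplex_map (p - Suc 0) g (singular_face p k \<sigma>)"
  using assms
  by (auto simp: singular_face_def simplex_map_def fun_eq_iff simplical_face_in_standard_simplex)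

lemma rchain_boundary_map:
  "rchain_boundary p (rchain_map p g c) = rchain_map (p - Suc 0) g (rchain_boundary p c)"
  by (rule additive_eq_on_singles[OF additive_compose[OF additive_rchain_boundary additive_rchain_map]
        additive_compose[OF additive_rchain_map additive_rchain_boundary]])
    (simp add: rchain_map_single rchain_boundary_single simplex_boundary_def singular_face_map
      Modules.additive.sum[OF additive_rchain_map] Modules.additive.zero[OF additive_rchain_map] del: sum.atMost_Suc)

section \<open>Homologous chains and induced classes\<close>

lemma rhomologous_refl: "rhomologous p X a a"
  unfolding rhomologous_def
  by (rule exI[of _ 0]) (simp add: rsingular_chain_def Modules.additive.zero[OF additive_rchain_boundary])

lemma rhomologous_sym: "rhomologous p X a b \<Longrightarrow> rhomologous p X b a"
  unfolding rhomologous_def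
proof (elim exE conjE)
  fix d assume "rsingular_chain (Suc p) X d" "rchain_boundary (Suc p) d = a - b"
  then show "\<exists>d. rsingular_chain (Suc p) X d \<and> rchain_boundary (Suc p) d = b - a"
    by (intro exI[of _ "- d"]) (simp add: rsingular_chain_def Modules.additive.minus[OF additive_rchain_boundary])
qed

lemma rhomologous_trans:
  "rhomologous p X a b \<Longrightarrow> rhomologous p X b c \<Longrightarrow> rhomologous p X a c"
  unfolding rhomologous_def
proof (elim exE conjE)
  fix d e assume "rsingular_chain (Suc p) X d" "rchain_boundary (Suc p) d = a - b"
    "rsingular_chain (Suc p) X e" "rchain_boundary (Suc p) e = b - c"
  then show "\<exists>d. rsingular_chain (Suc p) X d \<and> rchain_boundary (Suc p) d = a - c"
    using Poly_Mapping.keys_add[of d e]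
    by (intro exI[of _ "d + e"]) (auto simp: rsingular_chain_def Modules.additive.add[OF additive_rchain_boundary])
qed

lemma rhomologous_map:
  assumes "rhomologous p X a b" "continuous_map X Y g"
  shows "rhomologous p Y (rchain_map p g a) (rchain_map p g b)"
proof -
  obtain d where d: "rsingular_chain (Suc p) X d" "rchain_boundary (Suc p) d = a - b"
    using assms(1) by (auto simp: rhomologous_def)
  then show ?thesis
    unfolding rhomologous_def using rsingular_chain_map[OF d(1) assms(2)]
    by (intro exI[of _ "rchain_map (Suc p) g d"])
      (simp add: rchain_boundary_map Modules.additive.diff[OF additive_rchain_map])
qed

lemma rsingular_cycle_map:
  assumes "rsingular_cycle p X a" "continuous_map X Y g"
  shows "rsingular_cycle p Y (rchain_map p g a)"
  using assms
  by (auto simp: rsingular_cycle_def rsingular_chain_map rchain_boundary_map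
      Modules.additive.zero[OF additive_rchain_map])

text \<open>The induced map is defined by a union over all representatives of a class. A chain map
  preserves homologous chains, so all of them contribute the same coset.\<close>

lemma rhom_induced_class:
  assumes "continuous_map X Y g"
  shows "rhom_induced Y g (p, {b. rhomologous p X a b}) = (p, {b. rhomologous p Y (rchain_map p g a) b})"
proof -
  have "(\<Union>a'\<in>{b. rhomologous p X a b}. {b. rhomologous p Y (rchain_map p g a') b}) =
      {b. rhomologous p Y (rchain_map p g a) b}"
  proof (intro subset_antisym subsetI)
    fix b assume "b \<in> (\<Union>a'\<in>{b. rhomologous p X a b}. {b. rhomologous p Y (rchain_map p g a') b})"
    then obtain a' where "rhomologous p X a a'" "rhomologous p Y (rchain_map p g a') b"
      by blast
    then show "b \<in> {b. rhomologous p Y (rchain_map p g a) b}"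
      using rhomologous_trans[OF rhomologous_map[OF _ assms]] by blast
  next
    fix b assume "b \<in> {b. rhomologous p Y (rchain_map p g a) b}"
    then show "b \<in> (\<Union>a'\<in>{b. rhomologous p X a b}. {b. rhomologous p Y (rchain_map p g a') b})"
      using rhomologous_refl[of p X a] by blast
  qed
  then show ?thesis
    unfolding rhom_induced_def by simp
qed

text \<open>The integral homotopy theorem of the library is stated for cycles only. To obtain it with
  coefficients, a natural chain homotopy is needed: it is determined by its values \<open>D q\<close> on the
  identity of the standard simplex, which exist since \<open>[0,1] \<times> \<Delta>\<^sup>q\<close> is acyclic over the integers.\<close>

abbreviation simplex_top :: "nat \<Rightarrow> (nat \<Rightarrow> real) topology" where
  "simplex_top q \<equiv> subtopology (powertop_real UNIV) (standard_simplex q)"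

abbreviation prism_top :: "nat \<Rightarrow> (real \<times> (nat \<Rightarrow> real)) topology" where
  "prism_top q \<equiv> prod_topology (top_of_set {0..1}) (simplex_top q)"

definition id_simplex :: "nat \<Rightarrow> (nat \<Rightarrow> real) \<Rightarrow> nat \<Rightarrow> real" where
  "id_simplex q = restrict id (standard_simplex q)"

text \<open>With i_s the inclusion of the simplex at height s, this is the identity d D = i_1 - i_0
  - D d on the identity simplex. By naturality, D of the \<open>k\<close>-th face is the image of
  \<open>D (q - 1)\<close> under the face inclusion, with the height unchanged.\<close>

definition universal_prism :: "(nat \<Rightarrow> (real \<times> (nat \<Rightarrow> real)) chain) \<Rightarrow> nat \<Rightarrow> bool" where
  "universal_prism D q \<longleftrightarrow> singular_chain (Suc q) (prism_top q) (D q) \<and>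
     chain_boundary (Suc q) (D q) =
       frag_of (simplex_map q (Pair 1) (id_simplex q)) - frag_of (simplex_map q (Pair 0) (id_simplex q)) -
       (if q = 0 then 0 else \<Sum>k\<le>q. frag_cmul ((-1) ^ k)
          (chain_map q (\<lambda>(s, x). (s, simplical_face k x)) (D (q - 1))))"

text \<open>Integral multiples in any abelian group; at most one of the two sums is nonempty. They
  are needed because \<open>D q\<close> has integer coefficients while its images are chains over an
  arbitrary ring.\<close>

definition zscale :: "int \<Rightarrow> 'b::ab_group_add \<Rightarrow> 'b" where
  "zscale n x = (\<Sum>i<nat n. x) - (\<Sum>i<nat (- n). x)"

lemma zscale_diff_nat: "zscale (int a - int b) x = (\<Sum>i<a. x) - (\<Sum>i<b. x)"
proof -
  have *: "(\<Sum>i<m + n. x) = (\<Sum>i<m. x) + (\<Sum>i<n. x)" for m n :: nat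
    by (induction n) (auto simp: add_ac)
  show ?thesis
  proof (cases "b \<le> a")
    case True
    then obtain c where c: "a = b + c" using le_Suc_ex by blast
    show ?thesis unfolding c * by (simp add: zscale_def)
  next
    case False
    then obtain c where c: "b = a + c" using le_Suc_ex nat_le_linear by blast
    show ?thesis unfolding c * by (simp add: zscale_def)
  qed
qed

lemma zscale_add: "zscale (m + n) x = zscale m x + zscale n x"
proof -
  obtain a b c d where eq: "m = int a - int b" "n = int c - int d"
    by (metis int_diff_cases)
  have *: "(\<Sum>i<m + n. x) = (\<Sum>i<m. x) + (\<Sum>i<n. x)" for m n :: nat
    by (induction n) (auto simp: add_ac)
  have "m + n = int (a + c) - int (b + d)" using eq by simp
  then have "zscale (m + n) x = (\<Sum>i<a + c. x) - (\<Sum>i<b + d. x)"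
    by (simp only: zscale_diff_nat)
  then show ?thesis
    unfolding eq zscale_diff_nat * by simp
qed

lemma zscale_1 [simp]: "zscale 1 x = x"
  by (simp add: zscale_def)

lemma additive_zscale: "Modules.additive (\<lambda>n. zscale n x)"
  by (simp add: Modules.additive_def zscale_add)

lemma zscale_minus: "zscale (- n) x = - zscale n x"
  by (simp add: zscale_def)

lemma additive_zscale_right: "Modules.additive (zscale n)"
  by (simp add: Modules.additive_def zscale_def sum.distrib)

lemma zscale_sign: "zscale ((-1) ^ k) x = (if even k then x else - x)"
  by (simp add: zscale_minus)

lemma single_sign:
  "Poly_Mapping.single \<sigma> ((-1) ^ k * r) = zscale ((-1) ^ k) (Poly_Mapping.single \<sigma> (r::'r::{comm_ring,monoid_mult}))"
proof -
  have "(-1) ^ k * r = (if even k then r else - r)"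
    by (induction k) auto
  then show ?thesis by (simp add: zscale_sign single_uminus)
qed

text \<open>The homomorphism from a free abelian group determined by its values \<open>b\<close> on
  the generators; \<open>fext_unique\<close> is the uniqueness half of the universal
  property.\<close>

definition fext :: "('t \<Rightarrow> 'b::ab_group_add) \<Rightarrow> ('t \<Rightarrow>\<^sub>0 int) \<Rightarrow> 'b" where
  "fext b = rext (\<lambda>\<tau> n. zscale n (b \<tau>))"

lemma additive_fext: "Modules.additive (fext b)"
  unfolding fext_def by (intro additive_rext additive_zscale)

lemma fext_single: "fext b (Poly_Mapping.single \<tau> n) = zscale n (b \<tau>)"
  unfolding fext_def by (intro rext_single additive_zscale)

lemma fext_of: "fext b (frag_of \<tau>) = b \<tau>"
  by (simp add: fext_single)

lemma additive_zscale_commute: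
  assumes "Modules.additive T"
  shows "T (zscale n x) = zscale n (T x)"
  by (simp add: zscale_def Modules.additive.diff[OF assms] Modules.additive.sum[OF assms])

lemma fext_cong: "(\<And>\<tau>. \<tau> \<in> Poly_Mapping.keys c \<Longrightarrow> b \<tau> = b' \<tau>) \<Longrightarrow> fext b c = fext b' c"
  by (simp add: fext_def rext_def)

lemma fext_compose:
  assumes "Modules.additive T"
  shows "T (fext b c) = fext (\<lambda>\<tau>. T (b \<tau>)) c"
  by (simp add: fext_def rext_def Modules.additive.sum[OF assms] additive_zscale_commute[OF assms])

lemma frag_cmul_eq_zscale: "frag_cmul n c = zscale n c"
proof -
  have "(\<lambda>c. frag_cmul n c) c = zscale n c"
  proof (rule additive_eq_on_singles[OF _ additive_zscale_right])
    show "Modules.additive (frag_cmul n)"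
      by (simp add: Modules.additive_def frag_cmul_distrib2)
    fix \<sigma> :: 'a and r :: int
    have "(\<lambda>n. frag_cmul n (Poly_Mapping.single \<sigma> r)) n = zscale n (Poly_Mapping.single \<sigma> r)"
    proof -
      obtain a b where n: "n = int a - int b" by (metis int_diff_cases)
      have *: "frag_cmul (int m) x = (\<Sum>i<m. x)" for m and x :: "'a \<Rightarrow>\<^sub>0 int"
        by (induction m) (auto simp: frag_cmul_distrib add.commute)
      show ?thesis unfolding n zscale_diff_nat by (simp add: frag_cmul_diff_distrib *)
    qed
    then show "frag_cmul n (Poly_Mapping.single \<sigma> r) = zscale n (Poly_Mapping.single \<sigma> r)" .
  qed
  then show ?thesis .
qed

lemma fext_unique:
  assumes T: "Modules.additive T" and eq: "\<And>\<tau>. \<tau> \<in> Poly_Mapping.keys c \<Longrightarrow> T (frag_of \<tau>) = b \<tau>"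
  shows "T c = fext b c"
proof (rule additive_eq_on_singles[OF T additive_fext])
  fix \<tau> r assume "\<tau> \<in> Poly_Mapping.keys c"
  then show "T (Poly_Mapping.single \<tau> r) = fext b (Poly_Mapping.single \<tau> r)"
    unfolding single_int_eq[of \<tau> r] frag_cmul_eq_zscale additive_zscale_commute[OF T]
      additive_zscale_commute[OF additive_fext] fext_of by (simp only: eq)
qed

text \<open>The image of \<open>D q\<close> under (s, x) \<mapsto> H (s, \<sigma> x), with the
  integer coefficients acting on \<open>r\<close>. Pushing forward from the identity simplex makes
  the homotopy natural in \<sigma>.\<close>

definition prism_simplex ::
  "(nat \<Rightarrow> (real \<times> (nat \<Rightarrow> real)) chain) \<Rightarrow> (real \<times> 'a \<Rightarrow> 'b) \<Rightarrow> nat \<Rightarrow> ((nat \<Rightarrow> real) \<Rightarrow> 'a) \<Rightarrow>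
    'r::{comm_ring,monoid_mult} \<Rightarrow> ('b, 'r) rchain" where
  "prism_simplex D H q \<sigma> r =
     fext (\<lambda>\<tau>. Poly_Mapping.single (simplex_map (Suc q) (\<lambda>(s, x). H (s, \<sigma> x)) \<tau>) r) (D q)"

lemma additive_prism_simplex: "Modules.additive (prism_simplex D H q \<sigma>)"
  unfolding Modules.additive_def prism_simplex_def fext_def rext_def
  by (simp add: single_add Modules.additive.add[OF additive_zscale_right] sum.distrib)

lemma continuous_map_prism:
  assumes "continuous_map (prod_topology (top_of_set {0..1}) S) U H" "singular_simplex q S \<sigma>"
  shows "continuous_map (prism_top q) U (\<lambda>(s, x). H (s, \<sigma> x))"
proof -
  have "continuous_map (prism_top q) (prod_topology (top_of_set {0..1}) S) (\<lambda>z. (fst z, (\<sigma> \<circ> snd) z))"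
    using assms(2)
    by (intro continuous_map_pairedI continuous_map_fst continuous_map_compose[OF continuous_map_snd])
      (auto simp: singular_simplex_def)
  from continuous_map_compose[OF this assms(1)] show ?thesis
    by (simp add: o_def case_prod_beta')
qed

lemma rsingular_chain_prism:
  assumes "singular_chain (Suc q) (prism_top q) (D q)"
    and "continuous_map (prod_topology (top_of_set {0..1}) S) U H" "singular_simplex q S \<sigma>"
  shows "rsingular_chain (Suc q) U (prism_simplex D H q \<sigma> r)"
  unfolding prism_simplex_def fext_def
proof (rule rsingular_chain_rext)
  show "rsingular_chain (Suc q) (prism_top q) (D q)"
    using assms(1) by (simp add: rsingular_chain_int)
  fix \<tau> and n :: int
  assume "singular_simplex (Suc q) (prism_top q) \<tau>"
  then have "singular_simplex (Suc q) U (simplex_map (Suc q) (\<lambda>(s, x). H (s, \<sigma> x)) \<tau>)"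
    using continuous_map_prism[OF assms(2,3)] by (rule singular_simplex_simplex_map)
  then show "rsingular_chain (Suc q) U
      (zscale n (Poly_Mapping.single (simplex_map (Suc q) (\<lambda>(s, x). H (s, \<sigma> x)) \<tau>) r))"
    unfolding zscale_def by (intro rsingular_chain_diff rsingular_chain_sum rsingular_chain_single)
qed

lemma prism_boundary_simplex:
  assumes D: "universal_prism D q" "q > 0 \<Longrightarrow> universal_prism D (q - 1)"
    and H: "\<And>x. H (0, x) = f x" "\<And>x. H (1, x) = g x"
    and \<sigma>: "singular_simplex q S \<sigma>"
  shows "rchain_boundary (Suc q) (prism_simplex D H q \<sigma> (r::'r::{comm_ring,monoid_mult})) =
    Poly_Mapping.single (simplex_map q g \<sigma>) r - Poly_Mapping.single (simplex_map q f \<sigma>) r -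
    (if q = 0 then 0 else rext (prism_simplex D H (q - 1)) (simplex_boundary q \<sigma> r))"
proof -
  let ?H = "\<lambda>\<sigma>. \<lambda>(s, x). H (s, \<sigma> x)"
  \<comment> \<open>\<open>\<Theta>\<close> transports integral \<open>q\<close>-chains of the prism
    along (s, x) \<mapsto> H (s, \<sigma> x), with \<open>r\<close> as coefficient. It turns the
    identity assumed for \<open>D q\<close> into the one to be proved.\<close>
  define \<Theta> where "\<Theta> = fext (\<lambda>\<tau>. Poly_Mapping.single (simplex_map q (?H \<sigma>) \<tau>) r)"
  have add: "Modules.additive \<Theta>" unfolding \<Theta>_def by (rule additive_fext)
  have "rchain_boundary (Suc q) (prism_simplex D H q \<sigma> r) =
      fext (\<lambda>\<tau>. rchain_boundary (Suc q) (Poly_Mapping.single (simplex_map (Suc q) (?H \<sigma>) \<tau>) r)) (D q)"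
    unfolding prism_simplex_def by (rule fext_compose[OF additive_rchain_boundary])
  also have "\<dots> = fext (\<lambda>\<tau>. \<Theta> (chain_boundary (Suc q) (frag_of \<tau>))) (D q)"
  proof (rule fext_cong)
    fix \<tau>
    show "rchain_boundary (Suc q) (Poly_Mapping.single (simplex_map (Suc q) (?H \<sigma>) \<tau>) r) =
        \<Theta> (chain_boundary (Suc q) (frag_of \<tau>))"
      by (simp add: rchain_boundary_single simplex_boundary_def chain_boundary_of Modules.additive.sum[OF add]
          frag_cmul_eq_zscale additive_zscale_commute[OF add] single_sign singular_face_map
          del: sum.atMost_Suc) (simp add: \<Theta>_def fext_of del: sum.atMost_Suc)
  qed
  also have "\<dots> = \<Theta> (chain_boundary (Suc q) (D q))"
    by (rule fext_unique[OF additive_compose[OF add additive_chain_boundary], symmetric]) (rule refl)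
  also have "\<dots> = \<Theta> (frag_of (simplex_map q (Pair 1) (id_simplex q))) -
      \<Theta> (frag_of (simplex_map q (Pair 0) (id_simplex q))) -
      (if q = 0 then 0 else \<Sum>k\<le>q. zscale ((-1) ^ k)
          (\<Theta> (chain_map q (\<lambda>(s, x). (s, simplical_face k x)) (D (q - 1)))))"
    using D(1) unfolding universal_prism_def
    by (simp add: Modules.additive.diff[OF add] Modules.additive.sum[OF add] frag_cmul_eq_zscale
        additive_zscale_commute[OF add] Modules.additive.zero[OF add] del: sum.atMost_Suc)
  also have "\<Theta> (frag_of (simplex_map q (Pair 1) (id_simplex q))) = Poly_Mapping.single (simplex_map q g \<sigma>) r"
    unfolding \<Theta>_def fext_of by (rule arg_cong[where f = "\<lambda>\<tau>. Poly_Mapping.single \<tau> r"])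
      (auto simp: simplex_map_def id_simplex_def H fun_eq_iff)
  also have "\<Theta> (frag_of (simplex_map q (Pair 0) (id_simplex q))) = Poly_Mapping.single (simplex_map q f \<sigma>) r"
    unfolding \<Theta>_def fext_of by (rule arg_cong[where f = "\<lambda>\<tau>. Poly_Mapping.single \<tau> r"])
      (auto simp: simplex_map_def id_simplex_def H fun_eq_iff)
  also have "(if q = 0 then 0 else \<Sum>k\<le>q. zscale ((-1) ^ k)
          (\<Theta> (chain_map q (\<lambda>(s, x). (s, simplical_face k x)) (D (q - 1))))) =
      (if q = 0 then 0 else rext (prism_simplex D H (q - 1)) (simplex_boundary q \<sigma> r))"
  proof (cases "q = 0")
    case False
    have "\<Theta> (chain_map q (\<lambda>(s, x). (s, simplical_face k x)) (D (q - 1))) =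
        prism_simplex D H (q - 1) (singular_face q k \<sigma>) r" if "k \<le> q" for k
    proof -
      let ?F = "\<lambda>(s::real, x::nat \<Rightarrow> real). (s, simplical_face k x)"
      have chain: "singular_chain q (prism_top (q - 1)) (D (q - 1))"
        using D(2) False by (simp add: universal_prism_def)
      have "\<Theta> (chain_map q ?F (D (q - 1))) = fext (\<lambda>\<tau>. \<Theta> (frag_of (simplex_map q ?F \<tau>))) (D (q - 1))"
        by (rule fext_unique[OF additive_compose[OF add additive_chain_map]]) simp
      also have "\<dots> = prism_simplex D H (q - 1) (singular_face q k \<sigma>) r"
        unfolding prism_simplex_def
      proof (rule fext_cong)
        fix \<tau> assume "\<tau> \<in> Poly_Mapping.keys (D (q - 1))"
        then have \<tau>: "singular_simplex q (prism_top (q - 1)) \<tau>"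
          using chain by (auto simp: singular_chain_def)
        \<comment> \<open>\<open>singular_face\<close> is restricted to the standard simplex, so the
          two maps are compared on the prism only; that is enough, as \<tau> takes its values
          there.\<close>
        have "simplex_map q (?H \<sigma> \<circ> ?F) \<tau> = simplex_map q (?H (singular_face q k \<sigma>)) \<tau>"
          using False
          by (intro simplex_map_eq[OF \<tau>]) (auto simp: singular_face_def)
        then show "\<Theta> (frag_of (simplex_map q ?F \<tau>)) =
            Poly_Mapping.single (simplex_map (Suc (q - 1)) (?H (singular_face q k \<sigma>)) \<tau>) r"
          using False by (simp add: \<Theta>_def fext_of simplex_map_compose)
      qed
      finally show ?thesis .
    qed
    then show ?thesis
      using False
      by (simp add: simplex_boundary_def Modules.additive.sum[OF additive_rext[OF additive_prism_simplex]]
          rext_single[OF additive_prism_simplex] single_sign del: sum.atMost_Suc)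
        (simp add: additive_zscale_commute[OF additive_rext[OF additive_prism_simplex]]
          rext_single[OF additive_prism_simplex] del: sum.atMost_Suc)
  qed simp
  finally show ?thesis .
qed

lemma prism_boundary:
  assumes D: "universal_prism D q" "q > 0 \<Longrightarrow> universal_prism D (q - 1)"
    and H: "\<And>x. H (0, x) = f x" "\<And>x. H (1, x) = g x"
    and c: "rsingular_chain q S c"
  shows "rchain_boundary (Suc q) (rext (prism_simplex D H q) c) =
    rchain_map q g c - rchain_map q f c -
    (if q = 0 then 0 else rext (prism_simplex D H (q - 1)) (rchain_boundary q c))"
proof -
  note add = additive_rext[OF additive_prism_simplex]
  have eq: "rchain_boundary (Suc q) (prism_simplex D H q \<sigma> r) =
    rchain_map q g (Poly_Mapping.single \<sigma> r) - rchain_map q f (Poly_Mapping.single \<sigma> r) -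
    (if q = 0 then 0 else rext (prism_simplex D H (q - 1)) (rchain_boundary q (Poly_Mapping.single \<sigma> r)))"
    if "\<sigma> \<in> Poly_Mapping.keys c" for \<sigma> r
    unfolding rchain_map_single rchain_boundary_single
    by (rule prism_boundary_simplex[OF D H]) (use c that in \<open>auto simp: rsingular_chain_def\<close>)
  have "Modules.additive (\<lambda>c. (if q = 0 then 0 else rext (prism_simplex D H (q - 1)) (rchain_boundary q c)))"
    using additive_compose[OF additive_rext[of "prism_simplex D H (q - 1)", OF additive_prism_simplex]
        additive_rchain_boundary[of q]]
    by (cases "q = 0") (auto simp: Modules.additive_def)
  then show ?thesis
    by (intro additive_eq_on_singles[where c = c and
          S = "\<lambda>c. rchain_boundary (Suc q) (rext (prism_simplex D H q) c)" and
          T = "\<lambda>c. rchain_map q g c - rchain_map q f c -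
            (if q = 0 then 0 else rext (prism_simplex D H (q - 1)) (rchain_boundary q c))"]
        additive_minus additive_rchain_map additive_compose[OF additive_rchain_boundary add])
      (simp_all only: rext_single[OF additive_prism_simplex] eq)
qed

section \<open>Contractibility of the prism and existence of the universal chain homotopy\<close>

lemma contractible_simplex_top: "contractible_space (simplex_top q)"
proof -
  let ?e = "\<lambda>i::nat. if i = 0 then 1 else (0::real)"
  \<comment> \<open>The straight line from each point to the vertex \<open>?e\<close>, run from time
    \<open>0\<close> to time \<open>1\<close>.\<close>
  let ?h = "\<lambda>z::real \<times> (nat \<Rightarrow> real). \<lambda>i. (1 - fst z) * snd z i + fst z * ?e i"
  have e: "?e \<in> standard_simplex q" by simp
  have "?h z \<in> standard_simplex q" if "z \<in> topspace (prism_top q)" for z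
    using convex_standard_simplex[of "snd z" q ?e "fst z"] that e by auto
  moreover have "continuous_map (prism_top q) (powertop_real UNIV) ?h"
    unfolding continuous_map_componentwise_UNIV
  proof
    fix i
    have "continuous_map (simplex_top q) euclideanreal (\<lambda>x. x i)"
      by (intro continuous_map_from_subtopology continuous_map_product_projection) simp
    then have "continuous_map (prism_top q) euclideanreal (\<lambda>z. snd z i)"
      using continuous_map_compose[OF continuous_map_snd] by (fastforce simp: o_def)
    moreover have "continuous_map (prism_top q) euclideanreal fst"
      using continuous_map_fst continuous_map_in_subtopology by blast
    ultimately show "continuous_map (prism_top q) euclideanreal (\<lambda>z. (1 - fst z) * snd z i + fst z * ?e i)"
      by (intro continuous_map_add continuous_map_real_mult continuous_map_diff continuous_map_const[THEN iffD2])
        auto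
  qed
  ultimately have "continuous_map (prism_top q) (simplex_top q) ?h"
    unfolding continuous_map_in_subtopology by blast
  then have "homotopic_with (\<lambda>_. True) (simplex_top q) (simplex_top q) id (\<lambda>_. ?e)"
    unfolding homotopic_with_def by (intro exI[of _ ?h]) (auto simp: fun_eq_iff)
  then show ?thesis
    unfolding contractible_space_def by blast
qed

lemma contractible_prism_top: "contractible_space (prism_top q)"
  using contractible_simplex_top contractible_space_prod_topology is_interval_contractible_1
  by (metis contractible_space_top_of_set is_interval_cc)

text \<open>The identity is homotopic to a constant, so \<open>c\<close> is homologous to its image
  in a one-point space, where cycles of positive degree bound. In degree \<open>0\<close> they need
  not; there the assumption on constant maps says that the coefficients of \<open>c\<close> sum to
  zero.\<close>

lemma contractible_cycle_is_boundary:
  fixes X :: "'a topology"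
  assumes X: "contractible_space X" and c: "singular_chain p X c" "chain_boundary p c = 0"
    and 0: "\<And>a::'a. p = 0 \<Longrightarrow> chain_map p (\<lambda>_. a) c = 0"
  shows "\<exists>d. singular_chain (Suc p) X d \<and> chain_boundary (Suc p) d = c"
proof (cases "topspace X = {}")
  case True
  then have "c = 0" using c(1) by (simp add: singular_chain_empty)
  then show ?thesis by (intro exI[of _ 0]) simp
next
  case False
  obtain a where a: "homotopic_with (\<lambda>_. True) X X id (\<lambda>_. a)"
    using X by (auto simp: contractible_space_def)
  then have cont: "continuous_map X X (\<lambda>_. a)"
    using homotopic_with_imp_continuous_maps by blast
  then have aX: "a \<in> topspace X"
    using False by (auto simp: continuous_map_def)
  have cyc: "singular_relcycle p X {} c"
    using c by (simp add: singular_cycle)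
  have "homologous_rel p X {} (chain_map p id c) (chain_map p (\<lambda>_. a) c)"
    using homotopic_imp_homologous_rel_chain_maps[of "{}" "{}" X X id "\<lambda>_. a"] a cyc by simp
  moreover have "singular_relboundary p X {} (chain_map p (\<lambda>_. a) c)"
  proof (cases "p = 0")
    case True
    then show ?thesis using 0 by simp
  next
    case False
    let ?A = "subtopology X {a}"
    have "singular_relcycle p ?A {} (chain_map p (\<lambda>_. a) c)"
      by (rule singular_relcycle_chain_map[OF cyc]) (use aX in auto)
    then have "singular_relboundary p ?A {} (chain_map p (\<lambda>_. a) c)"
      using singular_boundary_eq_cycle_singleton[of ?A a p] aX False by auto
    then show ?thesis
      using singular_boundary_mono[of "{a}" "topspace X" p X] aX by simp
  qed
  ultimately have "singular_relboundary p X {} c"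
    using chain_map_ident[OF c(1)] singular_relboundary_add unfolding homologous_rel_def
    by (metis diff_add_cancel)
  then show ?thesis
    by (simp add: singular_boundary)
qed

lemma singular_simplex_id: "singular_simplex q (simplex_top q) (id_simplex q)"
  by (simp add: singular_simplex_def id_simplex_def)

lemma continuous_map_Pair_prism: "s \<in> {0..1} \<Longrightarrow> continuous_map (simplex_top q) (prism_top q) (Pair s)"
  by (auto simp: continuous_map_pairwise o_def)

text \<open>The argument of acyclic models: the prescribed boundary of \<open>D q\<close> is a cycle
  by the identities in lower degrees, hence it bounds in the contractible prism. In degree
  \<open>0\<close> the coefficients \<open>1\<close> and \<open>-1\<close> cancel. The bounded
  quantifier allows the sequence to be extended by one entry at a time.\<close>

lemma universal_prism_exists: "\<exists>D. \<forall>i\<le>q. universal_prism D i"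
proof (induction q)
  case 0
  let ?w = "frag_of (simplex_map 0 (Pair (1::real)) (id_simplex 0)) -
    frag_of (simplex_map 0 (Pair (0::real)) (id_simplex 0))"
  have "singular_chain 0 (prism_top 0) ?w"
    using singular_simplex_simplex_map[OF singular_simplex_id continuous_map_Pair_prism, of _ 0]
    by (intro singular_chain_diff) (auto simp: singular_chain_of)
  moreover have "chain_map 0 (\<lambda>_. a) ?w = 0" for a :: "real \<times> (nat \<Rightarrow> real)"
  proof -
    have "simplex_map 0 (\<lambda>_. a) (simplex_map 0 (Pair (1::real)) (id_simplex 0)) =
        simplex_map 0 (\<lambda>_. a) (simplex_map 0 (Pair (0::real)) (id_simplex 0))"
      by (auto simp: simplex_map_def)
    then show ?thesis by (simp only: chain_map_diff chain_map_of diff_self)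
  qed
  moreover have "chain_boundary 0 ?w = 0"
    by (simp add: chain_boundary_def)
  ultimately obtain d where "singular_chain (Suc 0) (prism_top 0) d \<and> chain_boundary (Suc 0) d = ?w"
    using contractible_cycle_is_boundary[OF contractible_prism_top] by meson
  then have "universal_prism (\<lambda>_. d) 0"
    unfolding universal_prism_def by simp
  then show ?case
    by (intro exI[of _ "\<lambda>_. d"]) simp
next
  case (Suc q)
  then obtain D where D: "\<And>i. i \<le> q \<Longrightarrow> universal_prism D i" by blast
  let ?\<iota> = "id_simplex (Suc q)" and ?S = "simplex_top (Suc q)"
  let ?c = "chain_boundary (Suc q) (frag_of ?\<iota>)"
  \<comment> \<open>The chain homotopy applied to the boundary of the identity simplex. In this form
    its boundary is given by \<open>prism_boundary\<close>; fact \<open>T\<close> below rewrites it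
    as the alternating sum in \<open>universal_prism\<close>.\<close>
  let ?T = "rext (prism_simplex D (\<lambda>z. z) q) ?c"
  let ?i = "\<lambda>s::real. frag_of (simplex_map (Suc q) (Pair s) ?\<iota>)"
  let ?w = "?i 1 - ?i 0 - ?T"
  have \<iota>: "singular_chain (Suc q) ?S (frag_of ?\<iota>)"
    by (simp add: singular_chain_of singular_simplex_id)
  have c: "singular_chain q ?S ?c"
    using singular_chain_boundary[OF \<iota>] by simp
  have cc: "chain_boundary q ?c = 0"
    using chain_boundary_boundary_alt[OF \<iota>] by simp
  have Hcont: "continuous_map (prod_topology (top_of_set {0..1}) ?S) (prism_top (Suc q)) (\<lambda>z. z)"
    by simp
  have "rsingular_chain (Suc q) (prism_top (Suc q)) ?T"
    using c D[of q] Hcont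
    by (intro rsingular_chain_rext[of q ?S] rsingular_chain_prism[of q D ?S])
      (auto simp: rsingular_chain_int universal_prism_def)
  then have wchain: "singular_chain (Suc q) (prism_top (Suc q)) ?w"
    using singular_simplex_simplex_map[OF singular_simplex_id continuous_map_Pair_prism, of _ "Suc q"]
    by (intro singular_chain_diff) (auto simp: singular_chain_of rsingular_chain_int)
  have "rchain_boundary (Suc q) ?T = rchain_map q (Pair 1) ?c - rchain_map q (Pair 0) ?c -
      (if q = 0 then 0 else rext (prism_simplex D (\<lambda>z. z) (q - 1)) (rchain_boundary q ?c))"
    using D c by (intro prism_boundary[where S = ?S]) (auto simp: rsingular_chain_int)
  then have "chain_boundary (Suc q) ?T = chain_map q (Pair 1) ?c - chain_map q (Pair 0) ?c"
    by (simp add: rchain_boundary_int rchain_map_int cc rext_def)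
  moreover have "chain_boundary (Suc q) (?i s) = chain_map q (Pair s) ?c" for s
    using chain_boundary_chain_map[OF \<iota>, of "Pair s"] by simp
  ultimately have "chain_boundary (Suc q) ?w = 0"
    by (simp add: chain_boundary_diff)
  then obtain d where d: "singular_chain (Suc (Suc q)) (prism_top (Suc q)) d"
      "chain_boundary (Suc (Suc q)) d = ?w"
    using contractible_cycle_is_boundary[OF contractible_prism_top wchain] by auto
  have T: "?T = (\<Sum>k\<le>Suc q. frag_cmul ((-1) ^ k) (chain_map (Suc q) (\<lambda>(s, x). (s, simplical_face k x)) (D q)))"
  proof -
    have face: "prism_simplex D (\<lambda>z. z) q (singular_face (Suc q) k ?\<iota>) (1::int) =
        chain_map (Suc q) (\<lambda>(s, x). (s, simplical_face k x)) (D q)" if "k \<le> Suc q" for k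
    proof -
      let ?F = "\<lambda>(s::real, x::nat \<Rightarrow> real). (s, simplical_face k x)"
      have "chain_map (Suc q) ?F (D q) = fext (\<lambda>\<tau>. frag_of (simplex_map (Suc q) ?F \<tau>)) (D q)"
        by (rule fext_unique[OF additive_chain_map]) simp
      also have "\<dots> = prism_simplex D (\<lambda>z. z) q (singular_face (Suc q) k ?\<iota>) 1"
        unfolding prism_simplex_def
      proof (rule fext_cong)
        fix \<tau> assume "\<tau> \<in> Poly_Mapping.keys (D q)"
        then have \<tau>: "singular_simplex (Suc q) (prism_top q) \<tau>"
          using D[of q] by (auto simp: singular_chain_def universal_prism_def)
        have "simplex_map (Suc q) ?F \<tau> =
            simplex_map (Suc q) (\<lambda>(s, x). (s, singular_face (Suc q) k ?\<iota> x)) \<tau>"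
          using that by (intro simplex_map_eq[OF \<tau>])
            (auto simp: singular_face_def id_simplex_def simplical_face_in_standard_simplex)
        then show "frag_of (simplex_map (Suc q) ?F \<tau>) =
            frag_of (simplex_map (Suc q) (\<lambda>(s, x). (s, singular_face (Suc q) k ?\<iota> x)) \<tau>)"
          by simp
      qed
      finally show ?thesis by simp
    qed
    have add: "Modules.additive (rext (prism_simplex D (\<lambda>z. z) q))"
      by (rule additive_rext[OF additive_prism_simplex])
    have "?T = (\<Sum>k\<le>Suc q. frag_cmul ((-1) ^ k)
        (prism_simplex D (\<lambda>z. z) q (singular_face (Suc q) k ?\<iota>) (1::int)))"
      by (simp add: chain_boundary_of Modules.additive.sum[OF add] frag_cmul_eq_zscale
          additive_zscale_commute[OF add] rext_single[OF additive_prism_simplex] del: sum.atMost_Suc)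
    then show ?thesis
      using face by (simp del: sum.atMost_Suc)
  qed
  let ?D = "D(Suc q := d)"
  have "universal_prism ?D i" if "i \<le> Suc q" for i
  proof (cases "i = Suc q")
    case True
    then show ?thesis
      using d T by (simp add: universal_prism_def del: sum.atMost_Suc)
  next
    case False
    then show ?thesis
      using D[of i] that by (auto simp: universal_prism_def)
  qed
  then show ?case by blast
qed

text \<open>On a cycle the last term of \<open>prism_boundary\<close> vanishes, and what remains
  exhibits g_* c - f_* c as a boundary.\<close>

theorem homotopic_imp_rhomologous:
  assumes h: "homotopic_with (\<lambda>_. True) S U f g" and c: "rsingular_cycle p S c"
  shows "rhomologous p U (rchain_map p g c) (rchain_map p f c)"
proof -
  obtain H where H: "continuous_map (prod_topology (top_of_set {0..1::real}) S) U H"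
      "\<And>x. H (0, x) = f x" "\<And>x. H (1, x) = g x"
    using h by (auto simp: homotopic_with_def)
  obtain D where D: "\<And>i. i \<le> p \<Longrightarrow> universal_prism D i"
    using universal_prism_exists by blast
  have c': "rsingular_chain p S c" "rchain_boundary p c = 0"
    using c by (auto simp: rsingular_cycle_def)
  have "rsingular_chain (Suc p) U (rext (prism_simplex D H p) c)"
    using D[of p] H(1) by (intro rsingular_chain_rext[OF c'(1)] rsingular_chain_prism[of p D S])
      (auto simp: universal_prism_def)
  moreover have "rchain_boundary (Suc p) (rext (prism_simplex D H p) c) = rchain_map p g c - rchain_map p f c"
    using prism_boundary[of D p H f g S c] D H(2,3) c' by (simp add: rext_def)
  ultimately show ?thesis
    unfolding rhomologous_def by blast
qed

section \<open>Images in homology on the level of chains\<close>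

definition in_image :: "nat \<Rightarrow> 'a topology \<Rightarrow> 'a set \<Rightarrow> ('a, 'r::{comm_ring,monoid_mult}) rchain \<Rightarrow> bool" where
  "in_image p X S a \<longleftrightarrow> (\<exists>c. rsingular_cycle p (subtopology X S) c \<and> rhomologous p X c a)"

text \<open>A class is a full coset, so classes agree exactly when their representatives are
  homologous. This allows the edge relation to be handled with cycles in place of cosets.\<close>

lemma class_in_image_iff:
  "(p, {b. rhomologous p X a b}) \<in> rhom_induced X id ` rhomology (subtopology X S) \<longleftrightarrow> in_image p X S a"
proof -
  have id: "continuous_map (subtopology X S) X id"
    by (simp add: continuous_map_from_subtopology)
  have ind: "rhom_induced X id (q, {b. rhomologous q (subtopology X S) c b}) = (q, {b. rhomologous q X c b})"
    if "rsingular_cycle q (subtopology X S) c" for q c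
    using rhom_induced_class[OF id, of q c] rchain_map_ident[of q "subtopology X S" c id] that
    by (simp add: rsingular_cycle_def)
  have eq: "{b. rhomologous p X a b} = {b. rhomologous p X c b} \<longleftrightarrow> rhomologous p X c a" for c
  proof
    assume "{b. rhomologous p X a b} = {b. rhomologous p X c b}"
    then show "rhomologous p X c a" using rhomologous_refl[of p X a] by blast
  next
    assume "rhomologous p X c a"
    then show "{b. rhomologous p X a b} = {b. rhomologous p X c b}"
      using rhomologous_trans rhomologous_sym by blast
  qed
  have "(p, {b. rhomologous p X a b}) \<in> rhom_induced X id ` rhomology (subtopology X S) \<longleftrightarrow>
    (\<exists>q c. rsingular_cycle q (subtopology X S) c \<and>
      (p, {b. rhomologous p X a b}) = rhom_induced X id (q, {b. rhomologous q (subtopology X S) c b}))"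
    unfolding rhomology_def image_iff by blast
  also have "\<dots> \<longleftrightarrow> in_image p X S a"
    unfolding in_image_def using ind eq by (metis Pair_inject)
  finally show ?thesis .
qed

lemma in_image_map:
  assumes g: "continuous_map X Y g" and S: "\<And>x. x \<in> topspace X \<Longrightarrow> x \<in> S \<Longrightarrow> g x \<in> T" and a: "in_image p X S a"
  shows "in_image p Y T (rchain_map p g a)"
proof -
  obtain c where c: "rsingular_cycle p (subtopology X S) c" "rhomologous p X c a"
    using a by (auto simp: in_image_def)
  have "continuous_map (subtopology X S) (subtopology Y T) g"
    using g S by (auto simp: continuous_map_in_subtopology continuous_map_from_subtopology)
  then show ?thesis
    unfolding in_image_def using rsingular_cycle_map[OF c(1)] rhomologous_map[OF c(2) g] by blast
qed

lemma in_image_rhomologous: "in_image p X S a \<Longrightarrow> rhomologous p X a b \<Longrightarrow> in_image p X S b"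
  unfolding in_image_def using rhomologous_trans by blast

section \<open>Points of the geometric realisation\<close>

abbreviation ucube :: "nat \<Rightarrow> (nat \<Rightarrow> real) set" where
  "ucube n \<equiv> {1..n} \<rightarrow>\<^sub>E {0..1}"

definition cell_points :: "'a precubical \<Rightarrow> ('a \<times> (nat \<Rightarrow> real)) set" where
  "cell_points P = {(x, u). x \<in> cubes P \<and> u \<in> ucube (deg P x)}"

lemma cell_points_iff [simp]: "(x, u) \<in> cell_points P \<longleftrightarrow> x \<in> cubes P \<and> u \<in> ucube (deg P x)"
  by (simp add: cell_points_def)

lemma topspace_realisation_cell_points: "topspace (realisation P) = rpoint P ` cell_points P"
  by (auto simp: topspace_realisation topspace_unit_cube image_iff cell_points_def)

lemma precubical_set_bd:
  assumes "precubical_set P" "x \<in> cubes P" "i \<in> {1..deg P x}"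
  shows "bd P k i x \<in> cubes P" "deg P (bd P k i x) = deg P x - 1"
  using assms by (auto simp: precubical_set_def)

section \<open>Face inclusions of cubes and deletion of coordinates\<close>

definition drop_coord :: "nat \<Rightarrow> nat \<Rightarrow> (nat \<Rightarrow> real) \<Rightarrow> nat \<Rightarrow> real" where
  "drop_coord n i w = (\<lambda>j\<in>{1..n - 1}. if j < i then w j else w (j + 1))"

lemma cube_face_at: "i \<in> {1..n} \<Longrightarrow> cube_face n k i u i = of_bool k"
  by (simp add: cube_face_def)

lemma cube_face_in: "u \<in> ucube (n - 1) \<Longrightarrow> i \<in> {1..n} \<Longrightarrow> cube_face n k i u \<in> ucube n"
  unfolding cube_face_def PiE_iff
proof (intro conjI ballI)
  fix j assume u: "(\<forall>i\<in>{1..n - 1}. u i \<in> {0..1}) \<and> u \<in> extensional {1..n - 1}" and i: "i \<in> {1..n}"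
    and j: "j \<in> {1..n}"
  consider "j < i" "j \<in> {1..n - 1}" | "j = i" | "i < j" "j - 1 \<in> {1..n - 1}"
    using i j by fastforce
  then show "(\<lambda>j\<in>{1..n}. if j < i then u j else if j = i then of_bool k else u (j - 1)) j \<in> {0..1}"
    using u j by cases auto
qed auto

lemma drop_coord_in: "w \<in> ucube n \<Longrightarrow> drop_coord n i w \<in> ucube (n - 1)"
  by (auto simp: drop_coord_def PiE_iff)

lemma drop_cube_face: 
  assumes "u \<in> ucube (n - 1)" "i \<in> {1..n}"
  shows "drop_coord n i (cube_face n k i u) = u"
proof (rule PiE_ext[OF drop_coord_in[OF cube_face_in[OF assms]] assms(1)])
  fix j assume "j \<in> {1..n - 1}"
  then show "drop_coord n i (cube_face n k i u) j = u j"
    using assms(2) by (auto simp: drop_coord_def cube_face_def)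
qed

lemma cube_face_drop:
  assumes "w \<in> ucube n" "i \<in> {1..n}" "w i = of_bool k"
  shows "cube_face n k i (drop_coord n i w) = w"
proof (rule PiE_ext[OF cube_face_in[OF drop_coord_in[OF assms(1)] assms(2)] assms(1)])
  fix j assume "j \<in> {1..n}"
  then show "cube_face n k i (drop_coord n i w) j = w j"
    using assms(2,3) by (auto simp: drop_coord_def cube_face_def)
qed

text \<open>A face inclusion inserts one constant coordinate, so a coordinatewise relation only
  gains the instance at that constant. \<open>R\<close> is general in order to serve for corners,
  for the order and for frozen coordinates alike.\<close>

lemma cube_face_ball:
  assumes "i \<in> {1..n}"
  shows "(\<forall>j\<in>{1..n}. R (cube_face n k i u j) (cube_face n k i v j)) \<longleftrightarrow>
    R (of_bool k) (of_bool k) \<and> (\<forall>j\<in>{1..n - 1}. R (u j) (v j))"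
proof
  assume L: "\<forall>j\<in>{1..n}. R (cube_face n k i u j) (cube_face n k i v j)"
  have "R (u j) (v j)" if "j \<in> {1..n - 1}" for j
  proof (cases "j < i")
    case True
    then show ?thesis using L[rule_format, of j] that by (auto simp: cube_face_def)
  next
    case False
    then show ?thesis using L[rule_format, of "j + 1"] that by (auto simp: cube_face_def)
  qed
  then show "R (of_bool k) (of_bool k) \<and> (\<forall>j\<in>{1..n - 1}. R (u j) (v j))"
    using L[rule_format, OF assms] assms by (simp add: cube_face_at)
next
  assume R: "R (of_bool k) (of_bool k) \<and> (\<forall>j\<in>{1..n - 1}. R (u j) (v j))"
  show "\<forall>j\<in>{1..n}. R (cube_face n k i u j) (cube_face n k i v j)"
  proof
    fix j assume j: "j \<in> {1..n}"
    consider "j < i" "j \<in> {1..n - 1}" | "j = i" | "i < j" "j - 1 \<in> {1..n - 1}"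
      using assms j by fastforce
    then show "R (cube_face n k i u j) (cube_face n k i v j)"
      using R j by cases (auto simp: cube_face_def)
  qed
qed

lemma cube_face_map:
  assumes "i \<in> {1..n}" "g (of_bool k) = of_bool k"
  shows "cube_face n k i (\<lambda>j\<in>{1..n - 1}. g (u j)) = (\<lambda>j\<in>{1..n}. g (cube_face n k i u j))"
proof
  fix j
  consider "j < i" "j \<in> {1..n - 1}" | "j = i" | "i < j" "j - 1 \<in> {1..n - 1}" | "j \<notin> {1..n}"
    using assms by fastforce
  then show "cube_face n k i (\<lambda>j\<in>{1..n - 1}. g (u j)) j = (\<lambda>j\<in>{1..n}. g (cube_face n k i u j)) j"
    using assms by cases (auto simp: cube_face_def)
qed

text \<open>Points are classes of the equivalence generated by faces, so a function of
  representatives descends as soon as it respects single faces. Properties of points are accordingly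
  defined on representatives.\<close>

lemma rpoint_invariant:
  assumes eq: "rpoint P p = rpoint P q"
    and inv: "\<And>x i k u. x \<in> cubes P \<Longrightarrow> i \<in> {1..deg P x} \<Longrightarrow> u \<in> ucube (deg P x - 1) \<Longrightarrow>
      \<Phi> (bd P k i x, u) = \<Phi> (x, cube_face (deg P x) k i u)"
  shows "\<Phi> p = \<Phi> q"
proof -
  have step: "\<Phi> y = \<Phi> z" if "face_rel P y z" for y z
    using that by cases (simp add: inv topspace_unit_cube)
  have "equivclp (face_rel P) p q"
    using eq by (simp add: rpoint_eq_iff)
  then show ?thesis
  proof (induction rule: equivclp_induct)
    case (step y z)
    then show ?case using \<open>\<And>z y. face_rel P y z \<Longrightarrow> \<Phi> y = \<Phi> z\<close> by metis
  qed simp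
qed

lemma rpoint_face': 
  "\<lbrakk>x \<in> cubes P; i \<in> {1..deg P x}; u \<in> ucube (deg P x - 1)\<rbrakk>
    \<Longrightarrow> rpoint P (bd P k i x, u) = rpoint P (x, cube_face (deg P x) k i u)"
  by (rule rpoint_face) (simp_all add: topspace_unit_cube)

text \<open>On a representative this expresses that the point is a vertex; see
  \<open>corner_rpoint_eq\<close> and \<open>corner_vertex\<close>.\<close>

definition corner :: "'a precubical \<Rightarrow> 'a \<times> (nat \<Rightarrow> real) \<Rightarrow> bool" where
  "corner P = (\<lambda>(x, u). \<forall>j\<in>{1..deg P x}. u j \<in> {0, 1})"

lemma corner_rpoint_eq:
  assumes P: "precubical_set P" and eq: "rpoint P p = rpoint P q"
  shows "corner P p = corner P q"
  using eq
proof (rule rpoint_invariant)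
  fix x i k u assume "x \<in> cubes P" and i: "i \<in> {1..deg P x}" and "u \<in> ucube (deg P x - 1)"
  then show "corner P (bd P k i x, u) = corner P (x, cube_face (deg P x) k i u)"
    using precubical_set_bd(2)[OF P] cube_face_ball[OF i, of "\<lambda>s _. s \<in> {0, 1}" k u u] by (simp add: corner_def)
qed

text \<open>On the unit cube, rounding moves exactly the coordinates strictly between
  \<open>0\<close> and \<open>1\<close>, so this is the lowest corner of the smallest cell
  containing the point. With ceilings it is the highest.\<close>

definition floor_point :: "'a precubical \<Rightarrow> 'a \<times> (nat \<Rightarrow> real) \<Rightarrow> 'a point" where
  "floor_point P = (\<lambda>(x, u). rpoint P (x, \<lambda>j\<in>{1..deg P x}. of_int \<lfloor>u j\<rfloor>))"

definition ceiling_point :: "'a precubical \<Rightarrow> 'a \<times> (nat \<Rightarrow> real) \<Rightarrow> 'a point" where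
  "ceiling_point P = (\<lambda>(x, u). rpoint P (x, \<lambda>j\<in>{1..deg P x}. of_int \<lceil>u j\<rceil>))"

lemma round_in_ucube:
  assumes "u \<in> ucube n"
  shows "(\<lambda>j\<in>{1..n}. of_int \<lfloor>u j\<rfloor>) \<in> ucube n" "(\<lambda>j\<in>{1..n}. of_int \<lceil>u j\<rceil>) \<in> ucube n"
proof -
  have "0 \<le> \<lfloor>u j\<rfloor> \<and> \<lfloor>u j\<rfloor> \<le> 1 \<and> 0 \<le> \<lceil>u j\<rceil> \<and> \<lceil>u j\<rceil> \<le> 1" if "j \<in> {1..n}" for j
  proof -
    have "0 \<le> u j" "u j \<le> 1" using assms that by (auto simp: PiE_iff)
    then show ?thesis by linarith
  qed
  then show "(\<lambda>j\<in>{1..n}. of_int \<lfloor>u j\<rfloor>) \<in> ucube n" "(\<lambda>j\<in>{1..n}. of_int \<lceil>u j\<rceil>) \<in> ucube n"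
    by (auto simp: PiE_iff)
qed

lemma floor_point_rpoint_eq:
  assumes P: "precubical_set P" and eq: "rpoint P p = rpoint P q"
  shows "floor_point P p = floor_point P q" "ceiling_point P p = ceiling_point P q"
  using eq eq
proof (rule_tac [!] rpoint_invariant)
  fix x i k u assume *: "x \<in> cubes P" "i \<in> {1..deg P x}" "u \<in> ucube (deg P x - 1)"
  show "floor_point P (bd P k i x, u) = floor_point P (x, cube_face (deg P x) k i u)"
    using rpoint_face'[OF *(1,2) round_in_ucube(1)[OF *(3)], of k] precubical_set_bd(2)[OF P *(1,2), of k]
      cube_face_map[OF *(2), of "\<lambda>s. of_int \<lfloor>s\<rfloor>" k u] by (simp add: floor_point_def)
  show "ceiling_point P (bd P k i x, u) = ceiling_point P (x, cube_face (deg P x) k i u)"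
    using rpoint_face'[OF *(1,2) round_in_ucube(2)[OF *(3)], of k] precubical_set_bd(2)[OF P *(1,2), of k]
      cube_face_map[OF *(2), of "\<lambda>s. of_int \<lceil>s\<rceil>" k u] by (simp add: ceiling_point_def)
qed

text \<open>The smallest closed cell containing the given point.\<close>

definition closed_carrier :: "'a precubical \<Rightarrow> 'a \<times> (nat \<Rightarrow> real) \<Rightarrow> 'a point set" where
  "closed_carrier P = (\<lambda>(x, u). {rpoint P (x, v) |v. v \<in> ucube (deg P x) \<and>
      (\<forall>j\<in>{1..deg P x}. u j \<in> {0, 1} \<longrightarrow> v j = u j)})"

text \<open>Coordinates \<open>0\<close> and \<open>1\<close> are frozen in the carrier. Passing
  from a face to the cube adds one frozen coordinate and no free one.\<close>

lemma closed_carrier_rpoint_eq: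
  assumes P: "precubical_set P" and eq: "rpoint P p = rpoint P q"
  shows "closed_carrier P p = closed_carrier P q"
  using eq
proof (rule rpoint_invariant)
  fix x i k u assume x: "x \<in> cubes P" and i: "i \<in> {1..deg P x}" and u: "u \<in> ucube (deg P x - 1)"
  let ?n = "deg P x"
  let ?f = "cube_face ?n k i"
  have d: "deg P (bd P k i x) = ?n - 1" using precubical_set_bd(2)[OF P x i] .
  have ball: "(\<forall>j\<in>{1..?n}. ?f u j \<in> {0, 1} \<longrightarrow> ?f v j = ?f u j) \<longleftrightarrow>
      (\<forall>j\<in>{1..?n - 1}. u j \<in> {0, 1} \<longrightarrow> v j = u j)" for v
    using cube_face_ball[OF i, of "\<lambda>s t. s \<in> {0, 1} \<longrightarrow> t = s" k u v] by (simp only: simp_thms)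
  show "closed_carrier P (bd P k i x, u) = closed_carrier P (x, ?f u)"
  proof (intro subset_antisym subsetI)
    fix z assume "z \<in> closed_carrier P (bd P k i x, u)"
    then obtain v where v: "z = rpoint P (bd P k i x, v)" "v \<in> ucube (?n - 1)"
        "\<forall>j\<in>{1..?n - 1}. u j \<in> {0, 1} \<longrightarrow> v j = u j"
      by (auto simp: closed_carrier_def d)
    have "\<forall>j\<in>{1..?n}. ?f u j \<in> {0, 1} \<longrightarrow> ?f v j = ?f u j"
      using v(3) unfolding ball .
    moreover have "z = rpoint P (x, ?f v)"
      unfolding v(1) by (rule rpoint_face'[OF x i v(2)])
    ultimately have "z = rpoint P (x, ?f v) \<and> ?f v \<in> ucube ?n \<and> (\<forall>j\<in>{1..?n}. ?f u j \<in> {0, 1} \<longrightarrow> ?f v j = ?f u j)"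
      using cube_face_in[OF v(2) i] by iprover
    then show "z \<in> closed_carrier P (x, ?f u)"
      unfolding closed_carrier_def prod.case mem_Collect_eq by (rule exI[of _ "?f v"])
  next
    fix z assume "z \<in> closed_carrier P (x, ?f u)"
    then obtain v where v: "z = rpoint P (x, v)" "v \<in> ucube ?n"
        "\<forall>j\<in>{1..?n}. ?f u j \<in> {0, 1} \<longrightarrow> v j = ?f u j"
      by (auto simp: closed_carrier_def)
    let ?v = "drop_coord ?n i v"
    have "v i = of_bool k" using v(3)[rule_format, OF i] cube_face_at[OF i, of k u] by (cases k) simp_all
    then have eq: "?f ?v = v" using cube_face_drop[OF v(2) i] by simp
    have "z = rpoint P (bd P k i x, ?v)"
      using v(1) rpoint_face'[OF x i drop_coord_in[OF v(2)], of k] eq by simp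
    moreover have "\<forall>j\<in>{1..?n - 1}. u j \<in> {0, 1} \<longrightarrow> ?v j = u j"
      using v(3) ball[of ?v] unfolding eq by iprover
    ultimately show "z \<in> closed_carrier P (bd P k i x, u)"
      using drop_coord_in[OF v(2), of i] unfolding closed_carrier_def prod.case d mem_Collect_eq
      by (intro exI[of _ ?v] conjI)
  qed
qed

text \<open>A coordinate equal to \<open>0\<close> or \<open>1\<close> can be deleted by passing to
  a face, which stays in \<open>X\<close> and has smaller degree.\<close>

lemma interior_representative:
  assumes P: "precubical_set P" and X: "precubical_subset P X"
    and x: "x \<in> X" "u \<in> ucube (deg P x)"
  shows "\<exists>c\<in>X. \<exists>w\<in>ucube (deg P c). rpoint P (x, u) = rpoint P (c, w) \<and> (\<forall>j\<in>{1..deg P c}. w j \<notin> {0, 1})"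
  using x
proof (induction "deg P x" arbitrary: x u rule: less_induct)
  case less
  have xc: "x \<in> cubes P" using X less.prems by (auto simp: precubical_subset_def)
  show ?case
  proof (cases "\<exists>i\<in>{1..deg P x}. u i \<in> {0, 1}")
    case True
    then obtain i where i: "i \<in> {1..deg P x}" "u i \<in> {0, 1}" by blast
    then obtain k where k: "u i = of_bool k"
      by (cases "u i = 0") (auto intro: that[of False] that[of True])
    let ?u = "drop_coord (deg P x) i u" and ?x = "bd P k i x"
    have d: "deg P ?x = deg P x - 1" using precubical_set_bd(2)[OF P xc i(1)] .
    have "?x \<in> X" using X less.prems(1) i(1) by (auto simp: precubical_subset_def)
    moreover have "?u \<in> ucube (deg P ?x)" using drop_coord_in[OF less.prems(2)] d by simp
    moreover have "deg P ?x < deg P x" using d i(1) by simp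
    moreover have "rpoint P (?x, ?u) = rpoint P (x, u)"
      using rpoint_face'[OF xc i(1) drop_coord_in[OF less.prems(2)]] cube_face_drop[OF less.prems(2) i(1) k]
      by simp
    ultimately show ?thesis using less.hyps[of ?x ?u] by metis
  next
    case False
    then show ?thesis using less.prems by blast
  qed
qed

lemma precubical_subset_cubes: "precubical_set P \<Longrightarrow> precubical_subset P (cubes P)"
  by (simp add: precubical_subset_def precubical_set_def)

text \<open>The interior representative of a corner has no coordinates left.\<close>

lemma corner_vertex:
  assumes P: "precubical_set P" and X: "precubical_subset P X"
    and x: "x \<in> X" "u \<in> ucube (deg P x)" and c: "corner P (x, u)"
  shows "\<exists>w\<in>X. deg P w = 0 \<and> rpoint P (x, u) = vertex_point P w"
proof -
  obtain w v where w: "w \<in> X" "v \<in> ucube (deg P w)" "rpoint P (x, u) = rpoint P (w, v)"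
      "\<forall>j\<in>{1..deg P w}. v j \<notin> {0, 1}"
    using interior_representative[OF P X x] by blast
  have "corner P (w, v)"
    using corner_rpoint_eq[OF P w(3)] c by simp
  then have d: "deg P w = 0"
    using w(4) by (cases "deg P w") (auto simp: corner_def)
  then have "v = (\<lambda>_. undefined)" using w(2) by simp
  then show ?thesis using w d by (auto simp: vertex_point_def)
qed

section \<open>Normal forms of points under passage to faces\<close>

lemma confluent_face_rel_wlog:
  assumes P: "precubical_set P" and x: "x \<in> cubes P" and ij: "i < j" "i \<in> {1..deg P x}" "j \<in> {1..deg P x}"
    and w: "w = cube_face (deg P x) k i u" "w = cube_face (deg P x) l j u'"
    and u: "u \<in> ucube (deg P x - 1)" "u' \<in> ucube (deg P x - 1)"
  shows "\<exists>s. face_rel P s (bd P k i x, u) \<and> face_rel P s (bd P l j x, u')"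
proof -
  let ?n = "deg P x"
  \<comment> \<open>Both faces share the face in which the coordinates \<open>i\<close> and
    \<open>j\<close> of \<open>w\<close> are deleted; once \<open>i\<close> is gone, the other one
    has index \<open>j - 1\<close>.\<close>
  let ?t = "drop_coord (?n - 1) (j - 1) u"
  have n: "?n - 1 - 1 = ?n - 2" by simp
  have wc: "w \<in> ucube ?n" using w(1) cube_face_in[OF u(1) ij(2)] by simp
  have ud: "u = drop_coord ?n i w" "u' = drop_coord ?n j w"
    using w(1) w(2) drop_cube_face[OF u(1) ij(2), of k] drop_cube_face[OF u(2) ij(3), of l] by metis+
  have wi: "w i = of_bool k" "w j = of_bool l"
    using w cube_face_at[OF ij(2)] cube_face_at[OF ij(3)] by metis+
  have tt: "drop_coord (?n - 1) i u' = ?t"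
    unfolding ud drop_coord_def using ij by (auto simp: fun_eq_iff)
  have j1: "j - 1 \<in> {1..?n - 1}" and i1: "i \<in> {1..?n - 1}" using ij by auto
  have "u (j - 1) = of_bool l" "u' i = of_bool k"
    unfolding ud using wi ij by (auto simp: drop_coord_def)
  then have "cube_face (?n - 1) l (j - 1) ?t = u" "cube_face (?n - 1) k i ?t = u'"
    using cube_face_drop[OF u(1) j1, of l] cube_face_drop[OF u(2) i1, of k] tt by simp_all
  moreover have "bd P l (j - 1) (bd P k i x) = bd P k i (bd P l j x)"
    using P x ij by (auto simp: precubical_set_def)
  moreover have "?t \<in> topspace (unit_cube (?n - 1 - 1))"
    using drop_coord_in[OF u(1)] by (simp add: topspace_unit_cube)
  ultimately show ?thesis
    using face_rel.intros[of "bd P k i x" P "j - 1" ?t l] face_rel.intros[of "bd P l j x" P i ?t k]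
      precubical_set_bd[OF P x ij(2), of k] precubical_set_bd[OF P x ij(3), of l] i1 j1
    by metis
qed

text \<open>The relation is reversed so that a step goes from a cube to a face. Steps at different
  indices commute by the precubical identity; at the same index, the coordinate of \<open>w\<close>
  determines which of the two faces is taken.\<close>

lemma strong_confluentp_face_rel:
  assumes P: "precubical_set P"
  shows "strong_confluentp (face_rel P)\<inverse>\<inverse>"
proof
  fix p q r
  assume "(face_rel P)\<inverse>\<inverse> p q" "(face_rel P)\<inverse>\<inverse> p r"
  then have "face_rel P q p" "face_rel P r p" by simp_all
  then obtain x w i k u j l u' where p: "p = (x, w)" and x: "x \<in> cubes P"
    and q: "q = (bd P k i x, u)" "i \<in> {1..deg P x}" "u \<in> ucube (deg P x - 1)" "w = cube_face (deg P x) k i u"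
    and r: "r = (bd P l j x, u')" "j \<in> {1..deg P x}" "u' \<in> ucube (deg P x - 1)" "w = cube_face (deg P x) l j u'"
    by (elim face_rel.cases) (auto simp: topspace_unit_cube)
  have "(\<exists>s. face_rel P s q \<and> face_rel P s r) \<or> q = r"
  proof (cases i j rule: linorder_cases)
    case less
    then show ?thesis using confluent_face_rel_wlog[OF P x less q(2) r(2) q(4) r(4) q(3) r(3)] q r by blast
  next
    case greater
    then show ?thesis using confluent_face_rel_wlog[OF P x greater r(2) q(2) r(4) q(4) r(3) q(3)] q r by blast
  next
    case equal
    then have "of_bool k = (of_bool l :: real)"
      using q(4) r(4) cube_face_at[OF q(2), of k u] cube_face_at[OF q(2), of l u'] by simp
    then have "k = l" by (cases k; cases l) auto
    moreover have "u = u'" using equal q r drop_cube_face[OF q(3,2)] drop_cube_face[OF r(3,2)] by metis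
    ultimately show ?thesis using equal q r by simp
  qed
  then show "\<exists>s. (face_rel P)\<inverse>\<inverse>\<^sup>*\<^sup>* q s \<and> (face_rel P)\<inverse>\<inverse>\<^sup>=\<^sup>= r s"
    by blast
qed

text \<open>No step leads from a vertex to a face, so vertices are normal forms, and by confluence
  equivalent normal forms coincide.\<close>

lemma vertex_point_inject:
  assumes P: "precubical_set P" and v: "deg P v = 0" "deg P w = 0" and eq: "vertex_point P v = vertex_point P w"
  shows "v = w"
proof -
  let ?r = "(face_rel P)\<inverse>\<inverse>"
  have irred: "s = (y, t)" if "?r\<^sup>*\<^sup>* (y, t) s" "deg P y = 0" for y t s
    using that(1)
  proof (cases rule: converse_rtranclpE)
    case (step s')
    then have "face_rel P s' (y, t)" by simp
    then show ?thesis using that(2) by cases auto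
  qed simp
  have "equivclp ?r (v, \<lambda>_. undefined) (w, \<lambda>_. undefined)"
    using eq by (simp add: vertex_point_def rpoint_eq_iff)
  then obtain s where "?r\<^sup>*\<^sup>* (v, \<lambda>_. undefined) s" "?r\<^sup>*\<^sup>* (w, \<lambda>_. undefined) s"
    using semiconfluentp_equivclp[OF strong_confluentp_into_semiconfluentp[OF strong_confluentp_face_rel[OF P]]]
    by (metis conversep_conversep relcomppE rtranclp_conversep conversepE)
  then show ?thesis using irred v by blast
qed

subsection \<open>Paths\<close>

text \<open>A relation on points of the realisation, so that maps between realisations can be
  applied to it directly; \<open>vertex_point_inject\<close> allows the return to vertices.\<close>

definition edge_step :: "'a precubical \<Rightarrow> 'a point \<Rightarrow> 'a point \<Rightarrow> bool" where
  "edge_step P z z' \<longleftrightarrow> (\<exists>e\<in>cubes P. deg P e = 1 \<and>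
     z = vertex_point P (bd P False 1 e) \<and> z' = vertex_point P (bd P True 1 e))"

abbreviation reach :: "'a precubical \<Rightarrow> 'a point \<Rightarrow> 'a point \<Rightarrow> bool" where
  "reach P \<equiv> (edge_step P)\<^sup>*\<^sup>*"

lemma precubical_path_imp_reach:
  assumes "precubical_path P v w k \<omega>"
  shows "reach P (vertex_point P v) (vertex_point P w)"
proof -
  have \<omega>: "precubical_morphism (pinterval 0 k) P \<omega>" "0 \<le> k" "\<omega> (Vertex 0) = v" "\<omega> (Vertex k) = w"
    using assms by (auto simp: precubical_path_def)
  have "int j \<le> k \<Longrightarrow> reach P (vertex_point P v) (vertex_point P (\<omega> (Vertex (int j))))" for j
  proof (induction j)
    case (Suc j)
    let ?e = "\<omega> (Edge (int (Suc j)))"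
    have "Edge (int (Suc j)) \<in> cubes (pinterval 0 k)"
      using Suc.prems by (simp add: pinterval_def)
    then have e: "?e \<in> cubes P \<and> deg P ?e = deg (pinterval 0 k) (Edge (int (Suc j))) \<and>
        (\<forall>b. \<forall>i\<in>{1..deg (pinterval 0 k) (Edge (int (Suc j)))}.
          \<omega> (bd (pinterval 0 k) b i (Edge (int (Suc j)))) = bd P b i ?e)"
      using \<omega>(1) unfolding precubical_morphism_def by blast
    have "edge_step P (vertex_point P (\<omega> (Vertex (int j)))) (vertex_point P (\<omega> (Vertex (int (Suc j)))))"
      unfolding edge_step_def
    proof (intro bexI conjI)
      show "?e \<in> cubes P" using e by blast
      show "deg P ?e = 1" using e by (simp add: pinterval_def)
      show "vertex_point P (\<omega> (Vertex (int j))) = vertex_point P (bd P False 1 ?e)"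
        "vertex_point P (\<omega> (Vertex (int (Suc j)))) = vertex_point P (bd P True 1 ?e)"
        using e[THEN conjunct2, THEN conjunct2, rule_format, of 1 False]
          e[THEN conjunct2, THEN conjunct2, rule_format, of 1 True] by (simp_all add: pinterval_def add.commute)
    qed
    then show ?case using Suc by (auto intro: rtranclp.rtrancl_into_rtrancl)
  qed (simp add: \<omega>(3))
  from this[of "nat k"] show ?thesis using \<omega> by simp
qed

lemma reach_imp_precubical_path:
  assumes P: "precubical_set P" and v: "v \<in> cubes P" "deg P v = 0"
    and r: "reach P (vertex_point P v) z"
  shows "\<exists>w k \<omega>. w \<in> cubes P \<and> deg P w = 0 \<and> z = vertex_point P w \<and> precubical_path P v w k \<omega>"
  using r
proof induction
  case base
  have "precubical_path P v v 0 (\<lambda>_. v)"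
    using v by (auto simp: precubical_path_def precubical_morphism_def pinterval_def)
  then show ?case using v by blast
next
  case (step y z)
  then obtain w k \<omega> where w: "w \<in> cubes P" "deg P w = 0" "y = vertex_point P w" "precubical_path P v w k \<omega>"
    by blast
  obtain e where e: "e \<in> cubes P" "deg P e = 1" "y = vertex_point P (bd P False 1 e)"
      "z = vertex_point P (bd P True 1 e)"
    using step.hyps(2) by (auto simp: edge_step_def)
  have bd: "bd P b 1 e \<in> cubes P" "deg P (bd P b 1 e) = 0" for b
    using precubical_set_bd[OF P e(1), of 1 b] e(2) by auto
  \<comment> \<open>Up to here, the end of the path and the start of the new edge are only known to
    agree as points.\<close>
  have we: "w = bd P False 1 e"
    using vertex_point_inject[OF P w(2) bd(2)] w(3) e(3) by blast
  let ?w = "bd P True 1 e"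
  let ?om = "\<lambda>c. if c = Vertex (k + 1) then ?w else if c = Edge (k + 1) then e else \<omega> c"
  have \<omega>: "precubical_morphism (pinterval 0 k) P \<omega>" "0 \<le> k" "\<omega> (Vertex 0) = v" "\<omega> (Vertex k) = w"
    using w(4) by (auto simp: precubical_path_def)
  have V: "\<omega> (Vertex j) \<in> cubes P \<and> deg P (\<omega> (Vertex j)) = 0" if "j \<in> {0..k}" for j
    using \<omega>(1) that by (auto simp: precubical_morphism_def pinterval_def)
  have E: "\<omega> (Edge j) \<in> cubes P \<and> deg P (\<omega> (Edge j)) = 1 \<and>
      bd P b (Suc 0) (\<omega> (Edge j)) = \<omega> (Vertex (if b then j else j - 1))" if j: "j \<in> {0<..k}" for j b
  proof -
    have "Edge j \<in> cubes (pinterval 0 k)" using j by (simp add: pinterval_def)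
    then have "\<omega> (Edge j) \<in> cubes P \<and> deg P (\<omega> (Edge j)) = deg (pinterval 0 k) (Edge j) \<and>
        (\<forall>b. \<forall>i\<in>{1..deg (pinterval 0 k) (Edge j)}.
          \<omega> (bd (pinterval 0 k) b i (Edge j)) = bd P b i (\<omega> (Edge j)))"
      using \<omega>(1) unfolding precubical_morphism_def by blast
    then show ?thesis by (simp add: pinterval_def)
  qed
  have "precubical_morphism (pinterval 0 (k + 1)) P ?om"
    unfolding precubical_morphism_def
  proof (intro conjI ballI allI)
    fix c assume c: "c \<in> cubes (pinterval 0 (k + 1))"
    consider j where "c = Vertex j" "j \<in> {0..k}" | "c = Vertex (k + 1)"
      | j where "c = Edge j" "j \<in> {0<..k}" | "c = Edge (k + 1)"
      using c by (fastforce simp: pinterval_def)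
    note cs = this
    show "?om c \<in> cubes P" using cs by cases (use V E bd e in auto)
    show "deg P (?om c) = deg (pinterval 0 (k + 1)) c"
      using cs by cases (use V E bd e in \<open>auto simp: pinterval_def\<close>)
    fix b i assume i: "i \<in> {1..deg (pinterval 0 (k + 1)) c}"
    show "?om (bd (pinterval 0 (k + 1)) b i c) = bd P b i (?om c)"
      using cs
    proof cases
      case (3 j)
      then have "i = Suc 0" using i by (simp add: pinterval_def)
      then show ?thesis using 3 E[of j b] by (auto simp: pinterval_def)
    next
      case 4
      then have "i = Suc 0" using i by (simp add: pinterval_def)
      then show ?thesis using 4 we \<omega>(4) by (cases b) (auto simp: pinterval_def)
    qed (use i in \<open>simp_all add: pinterval_def\<close>)
  qed
  then have "precubical_path P v ?w (k + 1) ?om"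
    using \<omega> by (auto simp: precubical_path_def)
  then show ?case using bd e(4) by blast
qed

lemma precubical_path_iff_reach:
  assumes P: "precubical_set P" and v: "v \<in> cubes P" "deg P v = 0" and w: "deg P w = 0"
  shows "(\<exists>k \<omega>. precubical_path P v w k \<omega>) \<longleftrightarrow> reach P (vertex_point P v) (vertex_point P w)"
proof
  assume "reach P (vertex_point P v) (vertex_point P w)"
  then obtain w' k \<omega> where "w' \<in> cubes P" "deg P w' = 0" "vertex_point P w = vertex_point P w'"
      "precubical_path P v w' k \<omega>"
    using reach_imp_precubical_path[OF P v] by blast
  then show "\<exists>k \<omega>. precubical_path P v w k \<omega>"
    using vertex_point_inject[OF P w] by blast
qed (blast dest: precubical_path_imp_reach)

text \<open>Corners with a common coordinate lie in a common face of smaller degree. The induction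
  hypothesis of \<open>reach_corners\<close> appears as an assumption because this step is used
  there for several indices.\<close>

lemma reach_corners_face:
  assumes P: "precubical_set P" and x: "x \<in> cubes P" and i: "i \<in> {1..deg P x}"
    and IH: "\<And>y v w. deg P y < deg P x \<Longrightarrow> y \<in> cubes P \<Longrightarrow> v \<in> ucube (deg P y) \<Longrightarrow> w \<in> ucube (deg P y) \<Longrightarrow>
      corner P (y, v) \<Longrightarrow> corner P (y, w) \<Longrightarrow> \<forall>j\<in>{1..deg P y}. v j \<le> w j \<Longrightarrow>
      reach P (rpoint P (y, v)) (rpoint P (y, w))"
    and v: "v \<in> ucube (deg P x)" "corner P (x, v)" and w: "w \<in> ucube (deg P x)" "corner P (x, w)"
    and le: "\<forall>j\<in>{1..deg P x}. v j \<le> w j" and eq: "v i = w i"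
  shows "reach P (rpoint P (x, v)) (rpoint P (x, w))"
proof -
  let ?n = "deg P x"
  have "v i \<in> {0, 1}" using v(2) i by (auto simp: corner_def)
  then obtain k where k: "v i = of_bool k"
    by (cases "v i = 0") (auto intro: that[of False] that[of True])
  let ?y = "bd P k i x" and ?d = "drop_coord ?n i"
  have y: "?y \<in> cubes P" "deg P ?y = ?n - 1" using precubical_set_bd[OF P x i] by auto
  have f: "cube_face ?n k i (?d v) = v" "cube_face ?n k i (?d w) = w"
    using cube_face_drop[OF v(1) i] cube_face_drop[OF w(1) i] k eq by auto
  have rp: "rpoint P (?y, ?d v) = rpoint P (x, v)" "rpoint P (?y, ?d w) = rpoint P (x, w)"
    using rpoint_face'[OF x i drop_coord_in[OF v(1)], of k] rpoint_face'[OF x i drop_coord_in[OF w(1)], of k] f by auto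
  have "corner P (?y, ?d v)" "corner P (?y, ?d w)"
    using corner_rpoint_eq[OF P rp(1)] corner_rpoint_eq[OF P rp(2)] v w by auto
  moreover have "\<forall>j\<in>{1..?n - 1}. ?d v j \<le> ?d w j"
    using le cube_face_ball[OF i, of "(\<le>)" k "?d v" "?d w"] unfolding f by blast
  ultimately show ?thesis
    using IH[of ?y "?d v" "?d w"] y drop_coord_in[OF v(1), of i] drop_coord_in[OF w(1), of i] i
    unfolding rp by auto
qed

text \<open>By induction on the degree. Corners with a common coordinate lie in a face; all others
  are the lowest and the highest corner, which form a single step only in degree
  \<open>1\<close>.\<close>

lemma reach_corners:
  assumes P: "precubical_set P"
  shows "x \<in> cubes P \<Longrightarrow> v \<in> ucube (deg P x) \<Longrightarrow> w \<in> ucube (deg P x) \<Longrightarrow>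
    corner P (x, v) \<Longrightarrow> corner P (x, w) \<Longrightarrow> \<forall>j\<in>{1..deg P x}. v j \<le> w j \<Longrightarrow>
    reach P (rpoint P (x, v)) (rpoint P (x, w))"
proof (induction "deg P x" arbitrary: x v w rule: less_induct)
  case less
  let ?n = "deg P x"
  note face = reach_corners_face[OF P less.prems(1) _ less.hyps]
  show ?case
  proof (cases "\<exists>i\<in>{1..?n}. v i = w i")
    case True
    then show ?thesis using face less.prems by blast
  next
    case False
    have v01: "v j = 0 \<and> w j = 1" if "j \<in> {1..?n}" for j
    proof -
      have "v j \<noteq> w j" "v j \<le> w j" "v j \<in> {0, 1}" "w j \<in> {0, 1}"
        using False less.prems that by (auto simp: corner_def)
      then show ?thesis by auto
    qed
    consider "?n = 0" | "?n = 1" | "2 \<le> ?n" by linarith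
    then show ?thesis
    proof cases
      case 1
      then have "v = w" using less.prems by simp
      then show ?thesis by simp
    next
      case 2
      have eq: "rpoint P (x, u) = vertex_point P (bd P k 1 x)" if "u \<in> ucube ?n" "u 1 = of_bool k" for u k
      proof -
        have "drop_coord ?n 1 u = (\<lambda>_. undefined)" using 2 by (auto simp: drop_coord_def)
        then show ?thesis
          using rpoint_face'[OF less.prems(1) _ drop_coord_in[OF that(1), of 1], of 1 k]
            cube_face_drop[OF that(1) _ that(2)] 2 by (simp add: vertex_point_def)
      qed
      have "edge_step P (rpoint P (x, v)) (rpoint P (x, w))"
        unfolding edge_step_def using 2 less.prems(1) eq[OF less.prems(2), of False] eq[OF less.prems(3), of True]
          v01[of 1] by auto
      then show ?thesis by blast
    next
      case 3
      \<comment> \<open>An intermediate corner: it shares coordinate \<open>1\<close> with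
        \<open>v\<close>, which is \<open>0\<close> everywhere, and coordinate \<open>2\<close> with
        \<open>w\<close>, which is \<open>1\<close> everywhere.\<close>
      let ?u = "w(1 := 0)"
      have u: "?u \<in> ucube ?n" "corner P (x, ?u)"
        using less.prems 3 by (auto simp: corner_def PiE_iff extensional_def)
      have "reach P (rpoint P (x, v)) (rpoint P (x, ?u))"
        using u less.prems v01 3 by (intro face[of 1]) auto
      also have "reach P (rpoint P (x, ?u)) (rpoint P (x, w))"
        using u less.prems v01 3 by (intro face[of 2]) auto
      finally (rtranclp_trans) show ?thesis .
    qed
  qed
qed

subsection \<open>Precubical subsets and sets of points\<close>

lemma realisation_subset_eq: "realisation_subset P X = {rpoint P (x, u) |x u. x \<in> X \<and> u \<in> ucube (deg P x)}"
  by (simp add: realisation_subset_def topspace_unit_cube)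

lemma closed_carrier_subset:
  assumes P: "precubical_set P" and z: "rpoint P p \<in> realisation_subset P X"
  shows "closed_carrier P p \<subseteq> realisation_subset P X"
proof -
  obtain x u where x: "x \<in> X" "u \<in> ucube (deg P x)" "rpoint P p = rpoint P (x, u)"
    using z by (auto simp: realisation_subset_eq)
  then have "closed_carrier P p = closed_carrier P (x, u)"
    using closed_carrier_rpoint_eq[OF P] by blast
  then show ?thesis
    using x by (auto simp: closed_carrier_def realisation_subset_eq)
qed

text \<open>The largest precubical subset whose realisation is contained in
  \<open>S\<close>.\<close>

definition cells_within :: "'a precubical \<Rightarrow> 'a point set \<Rightarrow> 'a set" where
  "cells_within P S = {c \<in> cubes P. \<forall>u\<in>ucube (deg P c). rpoint P (c, u) \<in> S}"

lemma precubical_subset_cells_within: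
  assumes P: "precubical_set P"
  shows "precubical_subset P (cells_within P S)"
  unfolding precubical_subset_def
proof (intro conjI ballI allI)
  fix x k i assume x: "x \<in> cells_within P S" and i: "i \<in> {1..deg P x}"
  then have xc: "x \<in> cubes P" by (simp add: cells_within_def)
  have "rpoint P (bd P k i x, u) \<in> S" if "u \<in> ucube (deg P x - 1)" for u
    using x rpoint_face'[OF xc i that, of k] cube_face_in[OF that i, of k] by (simp add: cells_within_def)
  then show "bd P k i x \<in> cells_within P S"
    using precubical_set_bd[OF P xc i, of k] by (simp add: cells_within_def)
qed (auto simp: cells_within_def)

text \<open>The interior representative \<open>(c, w)\<close> freezes no coordinate, so its carrier
  is the whole closed cube of \<open>c\<close>, which thus lies in \<open>S\<close>.\<close>

lemma in_cells_within:
  assumes P: "precubical_set P" and x: "x \<in> cubes P" "u \<in> ucube (deg P x)"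
    and S: "closed_carrier P (x, u) \<subseteq> S"
  shows "rpoint P (x, u) \<in> realisation_subset P (cells_within P S)"
proof -
  obtain c w where c: "c \<in> cubes P" "w \<in> ucube (deg P c)" "rpoint P (x, u) = rpoint P (c, w)"
      "\<forall>j\<in>{1..deg P c}. w j \<notin> {0, 1}"
    using interior_representative[OF P precubical_subset_cubes[OF P] x] by blast
  have "closed_carrier P (c, w) \<subseteq> S"
    using S closed_carrier_rpoint_eq[OF P c(3)] by simp
  then have "c \<in> cells_within P S"
    using c(1,4) by (auto simp: closed_carrier_def cells_within_def)
  then show ?thesis using c by (auto simp: realisation_subset_eq)
qed

subsection \<open>Maps that are defined on all cubes\<close>

text \<open>Commuting with face inclusions is what makes \<open>cellwise_map\<close> well defined,
  whose value is a union over all representatives of a point.\<close>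

definition coherent :: "'a precubical \<Rightarrow> ('a \<Rightarrow> (nat \<Rightarrow> real) \<Rightarrow> nat \<Rightarrow> real) \<Rightarrow> bool" where
  "coherent P E \<longleftrightarrow> (\<forall>x\<in>cubes P. (\<forall>u\<in>ucube (deg P x). E x u \<in> ucube (deg P x)) \<and>
     (\<forall>k. \<forall>i\<in>{1..deg P x}. \<forall>u\<in>ucube (deg P x - 1).
        E x (cube_face (deg P x) k i u) = cube_face (deg P x) k i (E (bd P k i x) u)))"

definition cellwise_map :: "'a precubical \<Rightarrow> ('a \<Rightarrow> (nat \<Rightarrow> real) \<Rightarrow> nat \<Rightarrow> real) \<Rightarrow> 'a point \<Rightarrow> 'a point" where
  "cellwise_map P E z = (\<Union>(x, u)\<in>z. rpoint P (x, E x u))"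

lemma cellwise_map_rpoint:
  assumes P: "precubical_set P" and E: "coherent P E"
  shows "cellwise_map P E (rpoint P (x, u)) = rpoint P (x, E x u)"
proof -
  have "(case q of (y, v) \<Rightarrow> rpoint P (y, E y v)) = rpoint P (x, E x u)" if "q \<in> rpoint P (x, u)" for q
  proof -
    have "rpoint P q = rpoint P (x, u)" using that unfolding rpoint_eq_iff by (simp add: rpoint_def equivclp_sym)
    then have "(case q of (y, v) \<Rightarrow> rpoint P (y, E y v)) = (case (x, u) of (y, v) \<Rightarrow> rpoint P (y, E y v))"
    proof (rule rpoint_invariant)
      fix y i k v assume y: "y \<in> cubes P" "i \<in> {1..deg P y}" "v \<in> ucube (deg P y - 1)"
      have "E (bd P k i y) v \<in> ucube (deg P y - 1)"
        using E y precubical_set_bd[OF P y(1,2), of k] unfolding coherent_def by metis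
      then show "(case (bd P k i y, v) of (y, v) \<Rightarrow> rpoint P (y, E y v)) =
          (case (y, cube_face (deg P y) k i v) of (y, v) \<Rightarrow> rpoint P (y, E y v))"
        using rpoint_face'[OF y(1,2), of "E (bd P k i y) v" k] E y by (simp add: coherent_def)
    qed
    then show ?thesis by simp
  qed
  moreover have "(x, u) \<in> rpoint P (x, u)" by (simp add: rpoint_def)
  ultimately have "(\<lambda>(y, v). rpoint P (y, E y v)) ` rpoint P (x, u) = {rpoint P (x, E x u)}" by blast
  then show ?thesis by (simp add: cellwise_map_def)
qed

text \<open>Products distribute over disjoint sums: around each point there are basic neighbourhoods
  that stay inside one summand.\<close>

lemma continuous_map_prod_sum_topology:
  assumes f: "\<And>x. x \<in> A \<Longrightarrow> continuous_map (prod_topology I (X x)) Y (\<lambda>(s, u). f (s, (x, u)))"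
  shows "continuous_map (prod_topology I (sum_topology X A)) Y f"
  unfolding continuous_map_def
proof (intro conjI allI impI)
  show "f \<in> topspace (prod_topology I (sum_topology X A)) \<rightarrow> topspace Y"
    using f by (force simp: continuous_map_def Pi_iff)
  fix U assume U: "openin Y U"
  let ?W = "{z \<in> topspace (prod_topology I (sum_topology X A)). f z \<in> U}"
  show "openin (prod_topology I (sum_topology X A)) ?W"
    unfolding openin_prod_topology_alt
  proof (intro allI impI)
    fix s q assume W: "(s, q) \<in> ?W"
    obtain x u where q: "q = (x, u)" by fastforce
    have x: "x \<in> A" "s \<in> topspace I" "u \<in> topspace (X x)" "f (s, (x, u)) \<in> U" using W q by auto
    have op: "openin (prod_topology I (X x)) {z \<in> topspace (prod_topology I (X x)). (case z of (s, u) \<Rightarrow> f (s, (x, u))) \<in> U}"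
      using f[OF x(1)] U by (rule openin_continuous_map_preimage)
    have "(s, u) \<in> {z \<in> topspace (prod_topology I (X x)). (case z of (s, u) \<Rightarrow> f (s, (x, u))) \<in> U}"
      using x by simp
    from openin_prod_topology_alt[THEN iffD1, rule_format, OF op this]
    obtain B C where BC: "openin I B" "openin (X x) C" "s \<in> B" "u \<in> C"
        "B \<times> C \<subseteq> {z \<in> topspace (prod_topology I (X x)). (case z of (s, u) \<Rightarrow> f (s, (x, u))) \<in> U}"
      by blast
    have "openin (sum_topology X A) (Pair x ` C)"
      using open_map_component_injection[OF x(1), of X] BC(2) by (simp add: open_map_def)
    moreover have "B \<times> Pair x ` C \<subseteq> ?W"
    proof
      fix z assume "z \<in> B \<times> Pair x ` C"
      then obtain t v where z: "z = (t, (x, v))" "t \<in> B" "v \<in> C" by blast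
      then have "(t, v) \<in> {z \<in> topspace (prod_topology I (X x)). (case z of (s, u) \<Rightarrow> f (s, (x, u))) \<in> U}"
        using subsetD[OF BC(5), of "(t, v)"] by simp
      then show "z \<in> ?W" using z(1) x(1) by simp
    qed
    ultimately show "\<exists>B C. openin I B \<and> openin (sum_topology X A) C \<and> s \<in> B \<and> q \<in> C \<and> B \<times> C \<subseteq> ?W"
      using BC q by blast
  qed
qed

text \<open>The straight-line homotopy from the identity to \<open>E\<close> inside each
  cube.\<close>

definition blend :: "'a precubical \<Rightarrow> ('a \<Rightarrow> (nat \<Rightarrow> real) \<Rightarrow> nat \<Rightarrow> real) \<Rightarrow> real \<Rightarrow> 'a \<Rightarrow> (nat \<Rightarrow> real) \<Rightarrow> nat \<Rightarrow> real" where
  "blend P E s x u = (\<lambda>j\<in>{1..deg P x}. (1 - s) * u j + s * E x u j)"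

lemma coherent_blend:
  assumes P: "precubical_set P" and E: "coherent P E" and s: "s \<in> {0..1}"
  shows "coherent P (blend P E s)"
  unfolding coherent_def
proof (intro ballI conjI allI)
  fix x u assume x: "x \<in> cubes P" and u: "u \<in> ucube (deg P x)"
  then have "E x u \<in> ucube (deg P x)" using E by (auto simp: coherent_def)
  then show "blend P E s x u \<in> ucube (deg P x)"
    using u s convex_bound_le[of _ 1 _ "1 - s" s] by (auto simp: blend_def PiE_iff)
next
  fix x k i u assume x: "x \<in> cubes P" and i: "i \<in> {1..deg P x}" and u: "u \<in> ucube (deg P x - 1)"
  show "blend P E s x (cube_face (deg P x) k i u) = cube_face (deg P x) k i (blend P E s (bd P k i x) u)"
  proof
    fix j
    let ?n = "deg P x"
    have Eq: "E x (cube_face ?n k i u) = cube_face ?n k i (E (bd P k i x) u)"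
      using E x i u by (simp add: coherent_def)
    have d: "deg P (bd P k i x) = ?n - 1" using precubical_set_bd(2)[OF P x i] .
    consider "j < i" "j \<in> {1..?n - 1}" | "j = i" | "i < j" "j - 1 \<in> {1..?n - 1}" | "j \<notin> {1..?n}"
      using i by fastforce
    then show "blend P E s x (cube_face ?n k i u) j = cube_face ?n k i (blend P E s (bd P k i x) u) j"
      unfolding blend_def Eq d using i by cases (auto simp: cube_face_def algebra_simps)
  qed
qed

text \<open>The straight-line homotopy is coherent at each time and so descends to the realisation.
  Its continuity in time and point together is checked before passing to the quotient, one cube at a
  time.\<close>

lemma homotopic_cellwise_map:
  assumes P: "precubical_set P" and E: "coherent P E"
    and cont: "\<And>x j. x \<in> cubes P \<Longrightarrow> j \<in> {1..deg P x} \<Longrightarrow> continuous_map (unit_cube (deg P x)) euclideanreal (\<lambda>u. E x u j)"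
  shows "homotopic_with (\<lambda>_. True) (realisation P) (realisation P) id (cellwise_map P E)"
proof -
  let ?I = "top_of_set {0..1::real}"
  let ?S = "sum_topology (\<lambda>x. unit_cube (deg P x)) (cubes P)"
  let ?H = "\<lambda>(s, z). cellwise_map P (blend P E s) z"
  have q: "quotient_map ?S (realisation P) (rpoint P)"
    unfolding realisation_def by (rule quotient_map_quotient_topology)
  \<comment> \<open>Local compactness of the interval makes its product with a quotient map a
    quotient map again.\<close>
  have "locally_compact_space ?I" "Hausdorff_space ?I"
    by (simp_all add: compact_imp_locally_compact_space compact_space_subtopology Hausdorff_space_subtopology)
  then have qI: "quotient_map (prod_topology ?I ?S) (prod_topology ?I (realisation P)) (\<lambda>(s, p). (s, rpoint P p))"
    using q by (intro quotient_map_prod_right) auto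
  have blend_in: "blend P E s x u \<in> ucube (deg P x)" if "x \<in> cubes P" "u \<in> ucube (deg P x)" "s \<in> {0..1}" for s x u
    using coherent_blend[OF P E that(3)] that by (auto simp: coherent_def)
  have "continuous_map (prod_topology ?I (unit_cube (deg P x))) (realisation P)
      (\<lambda>(s, u). rpoint P (x, blend P E s x u))" if x: "x \<in> cubes P" for x
  proof -
    let ?n = "deg P x" and ?T = "prod_topology ?I (unit_cube (deg P x))"
    have fst: "continuous_map ?T euclideanreal fst"
      using continuous_map_fst continuous_map_in_subtopology by blast
    have comp: "continuous_map ?T ?I (\<lambda>z. blend P E (fst z) x (snd z) j)" if j: "j \<in> {1..?n}" for j
    proof -
      have "continuous_map (unit_cube ?n) euclideanreal (\<lambda>u. u j)"
        unfolding unit_cube_def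
        using continuous_map_product_projection[OF j, of "\<lambda>_. ?I"] continuous_map_in_subtopology by blast
      then have "continuous_map ?T euclideanreal ((\<lambda>u. u j) \<circ> snd)"
        by (rule continuous_map_compose[OF continuous_map_snd])
      moreover have "continuous_map ?T euclideanreal ((\<lambda>u. E x u j) \<circ> snd)"
        by (rule continuous_map_compose[OF continuous_map_snd cont[OF x j]])
      ultimately have "continuous_map ?T euclideanreal (\<lambda>z. snd z j)" "continuous_map ?T euclideanreal (\<lambda>z. E x (snd z) j)"
        by (simp_all add: o_def)
      then have "continuous_map ?T euclideanreal (\<lambda>z. (1 - fst z) * snd z j + fst z * E x (snd z) j)"
        using fst by (intro continuous_map_add continuous_map_real_mult continuous_map_diff) auto
      then have "continuous_map ?T euclideanreal (\<lambda>z. blend P E (fst z) x (snd z) j)"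
        using j by (simp add: blend_def)
      moreover have "blend P E (fst z) x (snd z) j \<in> {0..1}" if "z \<in> topspace ?T" for z
        using blend_in[OF x, of "snd z" "fst z"] that j by (auto simp: topspace_unit_cube PiE_iff)
      ultimately show ?thesis
        unfolding continuous_map_in_subtopology by auto
    qed
    have "continuous_map ?T (product_topology (\<lambda>_. ?I) {1..?n}) (\<lambda>z. blend P E (fst z) x (snd z))"
      using comp by (subst continuous_map_componentwise) (auto simp: blend_def)
    then have "continuous_map ?T (unit_cube ?n) (\<lambda>z. blend P E (fst z) x (snd z))"
      by (simp add: unit_cube_def)
    then have "continuous_map ?T ?S (Pair x \<circ> (\<lambda>z. blend P E (fst z) x (snd z)))"
      by (rule continuous_map_compose) (rule continuous_map_component_injection[OF x])
    then have "continuous_map ?T (realisation P) (rpoint P \<circ> (Pair x \<circ> (\<lambda>z. blend P E (fst z) x (snd z))))"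
      by (rule continuous_map_compose) (rule quotient_imp_continuous_map[OF q])
    then show ?thesis
      by (simp add: o_def case_prod_beta')
  qed
  then have "continuous_map (prod_topology ?I ?S) (realisation P) (\<lambda>(s, (x, u)). rpoint P (x, blend P E s x u))"
    by (intro continuous_map_prod_sum_topology) simp
  then have "continuous_map (prod_topology ?I ?S) (realisation P) (?H \<circ> (\<lambda>(s, p). (s, rpoint P p)))"
  proof (rule continuous_map_eq)
    fix z assume "z \<in> topspace (prod_topology ?I ?S)"
    then show "(case z of (s, (x, u)) \<Rightarrow> rpoint P (x, blend P E s x u)) = (?H \<circ> (\<lambda>(s, p). (s, rpoint P p))) z"
      using cellwise_map_rpoint[OF P coherent_blend[OF P E]] by auto
  qed
  then have "continuous_map (prod_topology ?I (realisation P)) (realisation P) ?H"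
    by (rule continuous_compose_quotient_map[OF qI])
  moreover have "?H (0, z) = id z" "?H (1, z) = cellwise_map P E z" if z: "z \<in> topspace (realisation P)" for z
  proof -
    obtain x u where x: "z = rpoint P (x, u)" "x \<in> cubes P" "u \<in> ucube (deg P x)"
      using z by (auto simp: topspace_realisation_cell_points)
    have "E x u \<in> ucube (deg P x)" using E x by (auto simp: coherent_def)
    then have "blend P E 0 x u = u" "blend P E 1 x u = E x u"
      using x by (auto simp: blend_def fun_eq_iff PiE_iff extensional_def)
    then show "?H (0, z) = id z" "?H (1, z) = cellwise_map P E z"
      using x cellwise_map_rpoint[OF P E] cellwise_map_rpoint[OF P coherent_blend[OF P E, of 0]]
        cellwise_map_rpoint[OF P coherent_blend[OF P E, of 1]] by simp_all
  qed
  ultimately have "\<exists>h. continuous_map (prod_topology ?I (realisation P)) (realisation P) h \<and>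
      (\<forall>z\<in>topspace (realisation P). h (0, z) = id z) \<and>
      (\<forall>z\<in>topspace (realisation P). h (1, z) = cellwise_map P E z)"
    by blast
  then show ?thesis
    by (simp add: homotopic_with)
qed

section \<open>Charts of a weak morphism\<close>

text \<open>\<open>cell_face P a cs x\<close> is the face of \<open>x\<close> described by \<open>cs\<close>, whose entries refer to the coordinates
  \<open>a + 1, a + 2, \<dots>\<close> of \<open>x\<close>.\<close>

fun cell_face :: "'a precubical \<Rightarrow> nat \<Rightarrow> icube list \<Rightarrow> 'a \<Rightarrow> 'a" where
  "cell_face P a [] x = x"
| "cell_face P a (Vertex j # cs) x = bd P (j = 1) (Suc a) (cell_face P (Suc a) cs x)"
| "cell_face P a (Edge j # cs) x = cell_face P (Suc a) cs x"

abbreviation unit_grid :: "nat \<Rightarrow> icube list precubical" where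
  "unit_grid m \<equiv> tensor_list (replicate m (pinterval 0 1))"

lemma pgrid_unit: "pgrid n (\<lambda>_. 1) = unit_grid n"
  by (simp add: pgrid_def map_replicate_const del: upt_Suc)

lemma unit_grid_cases:
  assumes "cs \<in> cubes (unit_grid (Suc m))"
  obtains b cs' where "cs = Vertex (of_bool b) # cs'" "cs' \<in> cubes (unit_grid m)"
  | cs' where "cs = Edge 1 # cs'" "cs' \<in> cubes (unit_grid m)"
proof -
  obtain c cs' where cs: "cs = c # cs'" "c \<in> cubes (pinterval 0 1)" "cs' \<in> cubes (unit_grid m)"
    using assms by (auto simp: tensor_Cons_def)
  have "c = Vertex (of_bool False) \<or> c = Vertex (of_bool True) \<or> c = Edge 1"
    using cs(2) by (auto simp: pinterval_def image_iff)
  then show thesis using cs that by blast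
qed

text \<open>The recursion takes faces in later coordinates first, so coordinate \<open>Suc a\<close>
  still has its original index when its turn comes, and the first \<open>a\<close> coordinates are
  never touched.\<close>

lemma cell_face_in:
  assumes P: "precubical_set P" and x: "x \<in> cubes P"
  shows "cs \<in> cubes (unit_grid m) \<Longrightarrow> deg P x = a + m \<Longrightarrow>
    cell_face P a cs x \<in> cubes P \<and> deg P (cell_face P a cs x) = a + deg (unit_grid m) cs"
proof (induction m arbitrary: a cs)
  case 0
  then show ?case using x by simp
next
  case (Suc m)
  show ?case
    using Suc.prems(1)
  proof (cases rule: unit_grid_cases)
    case (1 b cs')
    let ?y = "cell_face P (Suc a) cs' x"
    have y: "?y \<in> cubes P" "deg P ?y = Suc a + deg (unit_grid m) cs'"
      using Suc.IH[OF 1(2), of "Suc a"] Suc.prems(2) by auto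
    have "bd P k (Suc a) ?y \<in> cubes P" "deg P (bd P k (Suc a) ?y) = deg P ?y - 1" for k
      using precubical_set_bd[OF P y(1), of "Suc a" k] y(2) by auto
    then show ?thesis using y 1 by (simp add: tensor_Cons_def pinterval_def)
  next
    case (2 cs')
    then show ?thesis using Suc.IH[OF 2(2), of "Suc a"] Suc.prems(2) by (simp add: tensor_Cons_def pinterval_def)
  qed
qed

text \<open>The outer face at index \<open>Suc a\<close> moves past a later one by the precubical
  identity, which lowers the index of the latter by one. A face at a leading edge just turns this
  edge into a vertex.\<close>

lemma cell_face_bd:
  assumes P: "precubical_set P" and x: "x \<in> cubes P"
  shows "cs \<in> cubes (unit_grid m) \<Longrightarrow> deg P x = a + m \<Longrightarrow> j \<in> {1..deg (unit_grid m) cs} \<Longrightarrow>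
    cell_face P a (bd (unit_grid m) k j cs) x = bd P k (a + j) (cell_face P a cs x)"
proof (induction m arbitrary: a cs j)
  case 0
  then show ?case by simp
next
  case (Suc m)
  show ?case
    using Suc.prems(1)
  proof (cases rule: unit_grid_cases)
    case (1 b cs')
    let ?y = "cell_face P (Suc a) cs' x"
    have j: "j \<in> {1..deg (unit_grid m) cs'}"
      using Suc.prems(3) 1 by (simp add: tensor_Cons_def pinterval_def)
    have y: "?y \<in> cubes P" "deg P ?y = Suc a + deg (unit_grid m) cs'"
      using cell_face_in[OF P x 1(2), of "Suc a"] Suc.prems(2) by auto
    have "1 \<le> Suc a \<and> Suc a < Suc a + j \<and> Suc a + j \<le> deg P ?y"
      using y(2) j by simp
    then have "bd P b (Suc a) (bd P k (Suc a + j) ?y) = bd P k (Suc a + j - 1) (bd P b (Suc a) ?y)"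
      using P y(1) unfolding precubical_set_def by blast
    then show ?thesis using Suc.IH[OF 1(2) _ j, of "Suc a"] Suc.prems(2) 1 j
      by (simp add: tensor_Cons_def pinterval_def)
  next
    case (2 cs')
    show ?thesis
    proof (cases "j = 1")
      case True
      then show ?thesis using 2 by (cases k) (simp_all add: tensor_Cons_def pinterval_def)
    next
      case False
      then have "j - 1 \<in> {1..deg (unit_grid m) cs'}"
        using Suc.prems(3) 2 by (auto simp: tensor_Cons_def pinterval_def)
      then show ?thesis using Suc.IH[OF 2(2), of "Suc a" "j - 1"] Suc.prems(2) 2 False
        by (auto simp: tensor_Cons_def pinterval_def)
    qed
  qed
qed

lemma cell_face_edges: "cell_face P a (map (\<lambda>j. Edge (i j)) js) x = x"
  by (induction js arbitrary: a) auto

text \<open>The characteristic morphism of the cube \<open>x\<close>, on which the second condition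
  on weak morphisms is evaluated.\<close>

lemma cell_face_morphism:
  assumes P: "precubical_set P" and x: "x \<in> cubes P"
  shows "precubical_morphism (pgrid (deg P x) (\<lambda>_. 1)) P (\<lambda>cs. cell_face P 0 cs x)"
  unfolding precubical_morphism_def pgrid_unit
  using cell_face_in[OF P x, of _ "deg P x" 0] cell_face_bd[OF P x, of _ "deg P x" 0] by simp

lemma realisation_map_cell_face:
  assumes P: "precubical_set P" and x: "x \<in> cubes P" and t: "t \<in> ucube (deg P x)"
  shows "realisation_map P (\<lambda>cs. cell_face P 0 cs x) (grid_point (deg P x) (\<lambda>_. 1) t) = rpoint P (x, t)"
proof -
  let ?n = "deg P x"
  \<comment> \<open>The index is cut off at \<open>1 - 1\<close>, so it is \<open>0\<close> also for
    \<open>t j = 1\<close>.\<close>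
  have idx: "grid_index (\<lambda>_. 1) t j = 0" if "j \<in> {1..?n}" for j
  proof -
    have "0 \<le> t j" using t that by (auto simp: PiE_iff)
    then show ?thesis by (simp add: grid_index_def)
  qed
  have "(\<lambda>j\<in>{1..?n}. t j - of_int (grid_index (\<lambda>_. 1) t j)) = t"
    using t idx by (auto simp: fun_eq_iff PiE_iff extensional_def)
  then show ?thesis
    unfolding grid_point_def realisation_map_rpoint[OF cell_face_morphism[OF P x]]
    by (simp add: grid_cube_def cell_face_edges[of P 0 "\<lambda>j. grid_index (\<lambda>_. 1) t j + 1"] del: upt_Suc)
qed

subsection \<open>Order isomorphisms of boxes\<close>

definition axis_point :: "nat \<Rightarrow> nat \<Rightarrow> real \<Rightarrow> nat \<Rightarrow> real" where
  "axis_point n j r = (\<lambda>m\<in>{1..n}. if m = j then r else 0)"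

abbreviation rbox :: "nat \<Rightarrow> (nat \<Rightarrow> real) \<Rightarrow> (nat \<Rightarrow> real) set" where
  "rbox n d \<equiv> (\<Pi>\<^sub>E j\<in>{1..n}. {0..d j})"

definition le_box :: "nat \<Rightarrow> (nat \<Rightarrow> real) \<Rightarrow> (nat \<Rightarrow> real) \<Rightarrow> bool" where
  "le_box n s t \<longleftrightarrow> (\<forall>j\<in>{1..n}. s j \<le> t j)"

lemma axis_point_in:
  assumes "j \<in> {1..n}" "0 \<le> r" "r \<le> d j" "\<And>i. i \<in> {1..n} \<Longrightarrow> 0 \<le> d i"
  shows "axis_point n j r \<in> rbox n d"
  unfolding axis_point_def restrict_PiE_iff using assms by simp

lemma axis_point_apply: "i \<in> {1..n} \<Longrightarrow> axis_point n j r i = (if i = j then r else 0)"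
  by (simp add: axis_point_def)

lemma axis_point_eqI:
  assumes "s \<in> rbox n d" "\<And>i. i \<in> {1..n} \<Longrightarrow> i \<noteq> j \<Longrightarrow> s i = 0"
  shows "s = axis_point n j (s j)"
proof (rule extensionalityI[of _ "{1..n}"])
  show "s \<in> extensional {1..n}" using assms(1) by (simp add: PiE_iff)
  show "axis_point n j (s j) \<in> extensional {1..n}" by (simp add: axis_point_def)
  show "s i = axis_point n j (s j) i" if "i \<in> {1..n}" for i
    using assms(2)[OF that] that by (simp add: axis_point_apply)
qed

lemma rbox_bounds: "s \<in> rbox n d \<Longrightarrow> i \<in> {1..n} \<Longrightarrow> 0 \<le> s i" "s \<in> rbox n d \<Longrightarrow> i \<in> {1..n} \<Longrightarrow> s i \<le> d i"
  by (auto dest: PiE_mem)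

lemma le_axis_point_iff:
  assumes "s \<in> rbox n d" "j \<in> {1..n}"
  shows "le_box n s (axis_point n j r) \<longleftrightarrow> s j \<le> r \<and> (\<forall>i\<in>{1..n}. i \<noteq> j \<longrightarrow> s i = 0)"
proof
  assume L: "le_box n s (axis_point n j r)"
  have "s i = 0" if "i \<in> {1..n}" "i \<noteq> j" for i
  proof -
    have "s i \<le> 0" using L that unfolding le_box_def by (metis axis_point_apply)
    then show ?thesis using rbox_bounds(1)[OF assms(1) that(1)] by simp
  qed
  moreover have "s j \<le> r" using L assms(2) unfolding le_box_def by (metis axis_point_apply)
  ultimately show "s j \<le> r \<and> (\<forall>i\<in>{1..n}. i \<noteq> j \<longrightarrow> s i = 0)" by blast
next
  assume "s j \<le> r \<and> (\<forall>i\<in>{1..n}. i \<noteq> j \<longrightarrow> s i = 0)"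
  then show "le_box n s (axis_point n j r)"
    unfolding le_box_def by (simp add: axis_point_apply)
qed

lemma axis_point_le_iff:
  assumes "s \<in> rbox n d" "j \<in> {1..n}"
  shows "le_box n (axis_point n j r) s \<longleftrightarrow> r \<le> s j"
proof
  assume "le_box n (axis_point n j r) s"
  then show "r \<le> s j" using assms(2) unfolding le_box_def by (metis axis_point_apply)
next
  assume "r \<le> s j"
  then show "le_box n (axis_point n j r) s"
    unfolding le_box_def using rbox_bounds(1)[OF assms(1)] by (simp add: axis_point_apply)
qed

lemma le_axis_point:
  assumes "s \<in> rbox n d" "j \<in> {1..n}" "le_box n s (axis_point n j r)"
  shows "s = axis_point n j (s j)"
  using assms by (intro axis_point_eqI[OF assms(1)]) (simp add: le_axis_point_iff[OF assms(1,2)])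

text \<open>The points on the axes are those below which the order is total.\<close>

lemma total_below_imp_axis:
  assumes p: "p \<in> rbox n d" and m: "m \<in> {1..n}" "0 < p m"
    and total: "\<And>s t. s \<in> rbox n d \<Longrightarrow> t \<in> rbox n d \<Longrightarrow> le_box n s p \<Longrightarrow> le_box n t p \<Longrightarrow> le_box n s t \<or> le_box n t s"
  shows "p = axis_point n m (p m)"
proof (rule axis_point_eqI[OF p], rule ccontr)
  fix i assume i: "i \<in> {1..n}" "i \<noteq> m" "p i \<noteq> 0"
  have in_box: "axis_point n j (p j) \<in> rbox n d" if "j \<in> {1..n}" for j
    using axis_point_in[where d = d, OF that rbox_bounds[OF p that]] rbox_bounds[OF p] by (meson order_trans)
  have below: "le_box n (axis_point n j (p j)) p" if "j \<in> {1..n}" for j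
    using axis_point_le_iff[OF p that] by simp
  have "le_box n (axis_point n m (p m)) (axis_point n i (p i)) \<or> le_box n (axis_point n i (p i)) (axis_point n m (p m))"
    using total[OF in_box in_box below below] m(1) i(1) by blast
  then have "p m \<le> 0 \<or> p i \<le> 0"
    using axis_point_le_iff[OF in_box[OF i(1)] m(1), of "p m"] axis_point_le_iff[OF in_box[OF m(1)] i(1), of "p i"]
      axis_point_apply[OF m(1), of i "p i"] axis_point_apply[OF i(1), of m "p m"] i(2) by simp
  then show False
    using i m rbox_bounds(1)[OF p i(1)] by simp
qed

lemma total_below_axis:
  assumes j: "j \<in> {1..n}" and s: "s \<in> rbox n d" "le_box n s (axis_point n j r)"
    and t: "t \<in> rbox n d" "le_box n t (axis_point n j r)"
  shows "le_box n s t \<or> le_box n t s"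
proof -
  have "s i = 0 \<and> t i = 0" if "i \<in> {1..n}" "i \<noteq> j" for i
    using le_axis_point_iff[OF s(1) j, of r] le_axis_point_iff[OF t(1) j, of r] s(2) t(2) that by blast
  then have "s i \<le> t i" if "s j \<le> t j" "i \<in> {1..n}" for i
    using that by (cases "i = j") auto
  moreover have "t i \<le> s i" if "t j \<le> s j" "i \<in> {1..n}" for i
    using that \<open>\<And>i. i \<in> {1..n} \<Longrightarrow> i \<noteq> j \<Longrightarrow> s i = 0 \<and> t i = 0\<close> by (cases "i = j") auto
  ultimately show ?thesis
    unfolding le_box_def by (meson linear)
qed

text \<open>\<open>\<psi>\<close> sends the end of the \<open>m\<close>-th axis of the box to a
  point below which the order is total, hence onto an axis of the cube; \<open>\<tau> m\<close> is
  the index of that axis, and \<open>A m\<close> is \<open>\<phi>\<close> along it. The order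
  recovers every coordinate of a point as the largest point of an axis below it, so
  \<open>\<phi>\<close> is determined by its values on the axes.\<close>

lemma box_order_iso_product:
  assumes l: "\<And>m. m \<in> {1..n} \<Longrightarrow> 0 < l m"
    and \<phi>: "\<And>t. t \<in> ucube n \<Longrightarrow> \<phi> t \<in> rbox n l" and \<psi>: "\<And>s. s \<in> rbox n l \<Longrightarrow> \<psi> s \<in> ucube n"
    and inv: "\<And>t. t \<in> ucube n \<Longrightarrow> \<psi> (\<phi> t) = t" "\<And>s. s \<in> rbox n l \<Longrightarrow> \<phi> (\<psi> s) = s"
    and mono: "\<And>s t. s \<in> ucube n \<Longrightarrow> t \<in> ucube n \<Longrightarrow> le_box n s t \<Longrightarrow> le_box n (\<phi> s) (\<phi> t)"
      "\<And>s t. s \<in> rbox n l \<Longrightarrow> t \<in> rbox n l \<Longrightarrow> le_box n s t \<Longrightarrow> le_box n (\<psi> s) (\<psi> t)"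
  shows "\<exists>A \<tau>. bij_betw \<tau> {1..n} {1..n} \<and> (\<forall>m\<in>{1..n}. A m ` {0..1} = {0..l m} \<and> strict_mono_on {0..1} (A m)) \<and>
    (\<forall>t\<in>ucube n. \<forall>m\<in>{1..n}. \<phi> t m = A m (t (\<tau> m)))"
proof -
  let ?q = "\<lambda>m. axis_point n m (l m)" and ?e = "\<lambda>j r. axis_point n j r"
  have l0: "0 \<le> l m" if "m \<in> {1..n}" for m using l[OF that] by simp
  have box: "?e m y \<in> rbox n l" if "m \<in> {1..n}" "0 \<le> y" "y \<le> l m" for m y
    using axis_point_in[where d = l, OF that] l0 by blast
  have q: "?q m \<in> rbox n l" if "m \<in> {1..n}" for m
    using box[OF that] l0[OF that] by simp
  have e: "?e j r \<in> ucube n" if "j \<in> {1..n}" "0 \<le> r" "r \<le> 1" for j r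
    using axis_point_in[of j n r "\<lambda>_. 1"] that by simp
  have emb: "le_box n s t" if "le_box n (\<phi> s) (\<phi> t)" "s \<in> ucube n" "t \<in> ucube n" for s t
    using mono(2)[OF \<phi> \<phi> that(1)] that inv(1) by simp
  have emb': "le_box n s t" if "le_box n (\<psi> s) (\<psi> t)" "s \<in> rbox n l" "t \<in> rbox n l" for s t
    using mono(1)[OF \<psi> \<psi> that(1)] that inv(2) by simp
  have "\<exists>j\<in>{1..n}. \<phi> (?e j 1) = ?q m" if m: "m \<in> {1..n}" for m
  proof -
    let ?p = "\<psi> (?q m)"
    have p: "?p \<in> ucube n" using \<psi>[OF q[OF m]] .
    \<comment> \<open>Otherwise \<open>?p\<close> would be the least point of the cube, whereas the
      end of an axis is not the least point of the box.\<close>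
    have "\<exists>j\<in>{1..n}. 0 < ?p j"
    proof (rule ccontr)
      assume np: "\<not> (\<exists>j\<in>{1..n}. 0 < ?p j)"
      have z: "?e m 0 \<in> rbox n l" using box[OF m] l0[OF m] by simp
      have "le_box n ?p (\<psi> (?e m 0))"
        unfolding le_box_def
      proof
        fix j assume j: "j \<in> {1..n}"
        then have "?p j \<le> 0" using np by force
        then show "?p j \<le> \<psi> (?e m 0) j" using rbox_bounds(1)[OF \<psi>[OF z] j] by simp
      qed
      then have "le_box n (?q m) (?e m 0)" using emb' q[OF m] z by blast
      then show False
        using axis_point_le_iff[OF z m, of "l m"] axis_point_apply[OF m, of m 0] l[OF m] by simp
    qed
    then obtain j where j: "j \<in> {1..n}" "0 < ?p j" by blast
    have pj: "?p = ?e j (?p j)"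
    proof (rule total_below_imp_axis[OF p j])
      fix s t assume *: "s \<in> ucube n" "t \<in> ucube n" "le_box n s ?p" "le_box n t ?p"
      have "le_box n (\<phi> s) (?q m)" "le_box n (\<phi> t) (?q m)"
        using mono(1)[OF *(1) p *(3)] mono(1)[OF *(2) p *(4)] inv(2)[OF q[OF m]] by simp_all
      then have "le_box n (\<phi> s) (\<phi> t) \<or> le_box n (\<phi> t) (\<phi> s)"
        by (intro total_below_axis[OF m \<phi>[OF *(1)] _ \<phi>[OF *(2)]])
      then show "le_box n s t \<or> le_box n t s" using emb *(1,2) by blast
    qed
    have ej: "?e j 1 \<in> ucube n" using e[OF j(1)] by simp
    \<comment> \<open>The end of the \<open>j\<close>-th axis lies above \<open>?p\<close>, so its
      image lies above \<open>?q m\<close>. As the image is again on an axis, it is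
      \<open>?q m\<close> itself.\<close>
    let ?w = "\<phi> (?e j 1)"
    have w: "?w \<in> rbox n l" using \<phi>[OF ej] .
    have "le_box n (?e j (?p j)) (?e j 1)"
      using axis_point_le_iff[OF ej j(1)] axis_point_apply[OF j(1), of j 1] rbox_bounds(2)[OF p j(1)] by simp
    then have "le_box n ?p (?e j 1)" using pj by simp
    then have "le_box n (?q m) ?w"
      using mono(1)[OF p ej] inv(2)[OF q[OF m]] by simp
    then have wm: "l m \<le> ?w m" using axis_point_le_iff[OF w m] by simp
    have "?w = axis_point n m (?w m)"
    proof (rule total_below_imp_axis[OF w m])
      show "0 < ?w m" using wm l[OF m] by simp
      fix s t assume *: "s \<in> rbox n l" "t \<in> rbox n l" "le_box n s ?w" "le_box n t ?w"
      have "le_box n (\<psi> s) (?e j 1)" "le_box n (\<psi> t) (?e j 1)"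
        using mono(2)[OF *(1) w *(3)] mono(2)[OF *(2) w *(4)] inv(1)[OF ej] by simp_all
      then have "le_box n (\<psi> s) (\<psi> t) \<or> le_box n (\<psi> t) (\<psi> s)"
        by (intro total_below_axis[OF j(1) \<psi>[OF *(1)] _ \<psi>[OF *(2)]])
      then show "le_box n s t \<or> le_box n t s" using emb' *(1,2) by blast
    qed
    moreover have "?w m = l m"
      using rbox_bounds(2)[OF w m] wm by simp
    ultimately have "?w = ?q m" by simp
    then show ?thesis using j(1) by blast
  qed
  then have "\<forall>m\<in>{1..n}. \<exists>j. j \<in> {1..n} \<and> \<phi> (?e j 1) = ?q m" by blast
  then obtain \<tau> where \<tau>': "\<forall>m\<in>{1..n}. \<tau> m \<in> {1..n} \<and> \<phi> (?e (\<tau> m) 1) = ?q m"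
    by (rule bchoice[THEN exE])
  have \<tau>: "\<tau> m \<in> {1..n}" "\<phi> (?e (\<tau> m) 1) = ?q m" if "m \<in> {1..n}" for m
    using \<tau>' that by blast+
  have "inj_on \<tau> {1..n}"
  proof
    fix m m' assume m: "m \<in> {1..n}" "m' \<in> {1..n}" "\<tau> m = \<tau> m'"
    then have "?q m m = ?q m' m" using \<tau>(2)[OF m(1)] \<tau>(2)[OF m(2)] by simp
    then show "m = m'" using l[OF m(1)] axis_point_apply[OF m(1)] by (simp split: if_splits)
  qed
  moreover have "\<tau> ` {1..n} \<subseteq> {1..n}" using \<tau>(1) by blast
  ultimately have bij: "bij_betw \<tau> {1..n} {1..n}"
    using endo_inj_surj[of "{1..n}" \<tau>] by (simp add: bij_betw_def)
  define A where "A = (\<lambda>m r. \<phi> (?e (\<tau> m) r) m)"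
  have e1: "?e (\<tau> m) 1 \<in> ucube n" if "m \<in> {1..n}" for m
    using e[OF \<tau>(1)[OF that]] by simp
  have le: "le_box n (?e (\<tau> m) r) (?e (\<tau> m) r')" if "m \<in> {1..n}" "r \<le> r'" for m r r'
    unfolding le_box_def using that(2) by (simp add: axis_point_apply)
  have axis: "\<phi> (?e (\<tau> m) r) = ?e m (A m r)" if m: "m \<in> {1..n}" and r: "0 \<le> r" "r \<le> 1" for m r
  proof -
    have er: "?e (\<tau> m) r \<in> ucube n" using e[OF \<tau>(1)[OF m] r] .
    have "le_box n (\<phi> (?e (\<tau> m) r)) (?q m)"
      using mono(1)[OF er e1[OF m] le[OF m r(2)]] \<tau>(2)[OF m] by simp
    then show ?thesis
      unfolding A_def by (rule le_axis_point[OF \<phi>[OF er] m])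
  qed
  have coord: "\<phi> t m = A m (t (\<tau> m))" if t: "t \<in> ucube n" and m: "m \<in> {1..n}" for t m
  proof -
    \<comment> \<open>The largest points below \<open>t\<close> and \<open>\<phi> t\<close> on
      corresponding axes. Equality results since \<open>?v\<close> lies below
      \<open>\<phi> ?u\<close>, while \<open>?u\<close> lies below \<open>t\<close>.\<close>
    let ?u = "?e (\<tau> m) (t (\<tau> m))" and ?v = "?e m (\<phi> t m)"
    have u: "?u \<in> ucube n" using e[OF \<tau>(1)[OF m] rbox_bounds[OF t \<tau>(1)[OF m]]] .
    have v: "?v \<in> rbox n l" using box[OF m rbox_bounds[OF \<phi>[OF t] m]] .
    have vt: "le_box n ?v (\<phi> t)" "le_box n ?v (?q m)"
      using axis_point_le_iff[OF \<phi>[OF t] m] axis_point_le_iff[OF q[OF m] m]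
        axis_point_apply[OF m, of m "l m"] rbox_bounds(2)[OF \<phi>[OF t] m] by simp_all
    have "le_box n (\<psi> ?v) t"
      using mono(2)[OF v \<phi>[OF t] vt(1)] inv(1)[OF t] by simp
    then have "\<psi> ?v (\<tau> m) \<le> t (\<tau> m)" using \<tau>(1)[OF m] unfolding le_box_def by blast
    moreover have "le_box n (\<psi> ?v) (?e (\<tau> m) 1)"
      using mono(2)[OF v q[OF m] vt(2)] inv(1)[OF e1[OF m]] \<tau>(2)[OF m] by simp
    ultimately have "le_box n (\<psi> ?v) ?u"
      unfolding le_axis_point_iff[OF \<psi>[OF v] \<tau>(1)[OF m]] by blast
    then have "le_box n ?v (\<phi> ?u)"
      using mono(1)[OF \<psi>[OF v] u] inv(2)[OF v] by simp
    then have "\<phi> t m \<le> \<phi> ?u m" using axis_point_le_iff[OF \<phi>[OF u] m] by simp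
    moreover have "le_box n ?u t"
      using axis_point_le_iff[OF t \<tau>(1)[OF m]] by simp
    then have "\<phi> ?u m \<le> \<phi> t m" using mono(1)[OF u t] m unfolding le_box_def by blast
    ultimately show ?thesis unfolding A_def by simp
  qed
  have surj: "A m ` {0..1} = {0..l m}" if m: "m \<in> {1..n}" for m
  proof (intro subset_antisym subsetI)
    fix y assume "y \<in> A m ` {0..1}"
    then obtain r where r: "y = A m r" "0 \<le> r" "r \<le> 1" by auto
    have er: "?e (\<tau> m) r \<in> ucube n" using e[OF \<tau>(1)[OF m] r(2,3)] .
    show "y \<in> {0..l m}"
      using rbox_bounds[OF \<phi>[OF er] m] unfolding r(1) A_def by simp
  next
    fix y assume y: "y \<in> {0..l m}"
    let ?v = "?e m y"
    have v: "?v \<in> rbox n l" using box[OF m] y by simp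
    have "le_box n ?v (?q m)"
      using axis_point_le_iff[OF q[OF m] m] axis_point_apply[OF m, of m "l m"] y by simp
    then have "le_box n (\<psi> ?v) (?e (\<tau> m) 1)"
      using mono(2)[OF v q[OF m]] inv(1)[OF e1[OF m]] \<tau>(2)[OF m] by simp
    then have eq: "\<psi> ?v = ?e (\<tau> m) (\<psi> ?v (\<tau> m))"
      by (rule le_axis_point[OF \<psi>[OF v] \<tau>(1)[OF m]])
    have "A m (\<psi> ?v (\<tau> m)) = y"
      unfolding A_def eq[symmetric] inv(2)[OF v] using axis_point_apply[OF m] by simp
    moreover have "\<psi> ?v (\<tau> m) \<in> {0..1}" using rbox_bounds[OF \<psi>[OF v] \<tau>(1)[OF m]] by simp
    ultimately show "y \<in> A m ` {0..1}" using image_eqI[of y "A m" "\<psi> ?v (\<tau> m)"] by simp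
  qed
  have strict: "strict_mono_on {0..1} (A m)" if m: "m \<in> {1..n}" for m
  proof (rule strict_mono_onI)
    fix r r' :: real assume r: "r \<in> {0..1}" "r' \<in> {0..1}" "r < r'"
    have er: "?e (\<tau> m) r \<in> ucube n" "?e (\<tau> m) r' \<in> ucube n" using e[OF \<tau>(1)[OF m]] r by simp_all
    have "le_box n (\<phi> (?e (\<tau> m) r)) (\<phi> (?e (\<tau> m) r'))"
      by (rule mono(1)[OF er le[OF m less_imp_le[OF r(3)]]])
    then have "A m r \<le> A m r'"
      using m unfolding A_def le_box_def by (rule bspec)
    moreover have "A m r \<noteq> A m r'"
    proof
      assume "A m r = A m r'"
      then have "\<phi> (?e (\<tau> m) r) = \<phi> (?e (\<tau> m) r')"
        using axis[OF m, of r] axis[OF m, of r'] r by simp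
      then have "\<psi> (\<phi> (?e (\<tau> m) r)) = \<psi> (\<phi> (?e (\<tau> m) r'))"
        by (rule arg_cong)
      then have "?e (\<tau> m) r = ?e (\<tau> m) r'"
        unfolding inv(1)[OF er(1)] inv(1)[OF er(2)] .
      then have "?e (\<tau> m) r (\<tau> m) = ?e (\<tau> m) r' (\<tau> m)" by (rule fun_cong)
      then show False using r(3) unfolding axis_point_apply[OF \<tau>(1)[OF m]] by simp
    qed
    ultimately show "A m r < A m r'" by simp
  qed
  show ?thesis
    by (intro exI[of _ A] exI[of _ \<tau>] conjI ballI bij surj strict coord)
qed

subsection \<open>The chart of a cube\<close>

text \<open>The map \<open>A\<close> records the coordinates of \<open>\<phi>\<close>, and \<open>c i\<close> is the image under \<open>\<zeta>\<close> of the \<open>n\<close>-cube of the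
  grid with lower corner \<open>i\<close>, where \<open>\<phi>\<close> and \<open>\<zeta>\<close> are given by the definition of a weak morphism.\<close>

locale cell_chart =
  fixes P :: "'a precubical" and Q :: "'b precubical" and f :: "'a point \<Rightarrow> 'b point" and x :: 'a
    and n :: nat and l :: "nat \<Rightarrow> int" and A :: "nat \<Rightarrow> real \<Rightarrow> real" and \<tau> :: "nat \<Rightarrow> nat"
    and c :: "(nat \<Rightarrow> int) \<Rightarrow> 'b"
  assumes Q: "precubical_set Q" and x: "x \<in> cubes P" and n: "n = deg P x"
    and l: "\<And>m. m \<in> {1..n} \<Longrightarrow> 1 \<le> l m"
    and image: "\<And>m. m \<in> {1..n} \<Longrightarrow> A m ` {0..1} = {0..of_int (l m)}"
    and strict: "\<And>m. m \<in> {1..n} \<Longrightarrow> strict_mono_on {0..1} (A m)"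
    and perm: "bij_betw \<tau> {1..n} {1..n}"
    and c: "\<And>i. (\<And>m. m \<in> {1..n} \<Longrightarrow> 0 \<le> i m \<and> i m < l m) \<Longrightarrow> c i \<in> cubes Q \<and> deg Q (c i) = n"
    and f_eq: "\<And>t i. t \<in> ucube n \<Longrightarrow> (\<And>m. m \<in> {1..n} \<Longrightarrow> 0 \<le> i m \<and> i m < l m \<and>
        of_int (i m) \<le> A m (t (\<tau> m)) \<and> A m (t (\<tau> m)) \<le> of_int (i m) + 1) \<Longrightarrow>
      f (rpoint P (x, t)) = rpoint Q (c i, \<lambda>m\<in>{1..n}. A m (t (\<tau> m)) - of_int (i m))"

text \<open>A vertex is treated apart, as the condition on grids concerns \<open>n \<ge> 1\<close>
  only. In positive degree this condition is applied to the characteristic morphism of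
  \<open>x\<close>.\<close>

lemma weak_morphism_chart:
  assumes P: "precubical_set P" and Q: "precubical_set Q" and f: "weak_morphism P Q f" and x: "x \<in> cubes P"
  shows "\<exists>l A \<tau> c. cell_chart P Q f x (deg P x) l A \<tau> c"
proof (cases "deg P x = 0")
  case True
  then obtain w where w: "w \<in> cubes Q" "deg Q w = 0" "f (vertex_point P x) = vertex_point Q w"
    using f x unfolding weak_morphism_def by blast
  \<comment> \<open>Without coordinates the conditions on the grid data are vacuous, and default
    values serve.\<close>
  have "cell_chart P Q f x (deg P x) (\<lambda>_. 1) (\<lambda>_ _. 0) id (\<lambda>_. w)"
  proof
    fix t and i :: "nat \<Rightarrow> int" assume "t \<in> ucube (deg P x)"
    then have t: "t = (\<lambda>_. undefined)" using True by simp
    have "(\<lambda>m\<in>{1..deg P x}. 0 - real_of_int (i m)) = (\<lambda>_. undefined)" using True by auto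
    then show "f (rpoint P (x, t)) = rpoint Q (w, \<lambda>m\<in>{1..deg P x}. 0 - of_int (i m))"
      using w(3) unfolding t vertex_point_def by simp
  qed (use True w x Q in simp_all)
  then show ?thesis by blast
next
  case False
  let ?n = "deg P x" and ?\<xi> = "\<lambda>cs. cell_face P 0 cs x"
  have n: "1 \<le> ?n" using False by simp
  have "\<forall>k \<xi>. (\<forall>j\<in>{1..?n}. k j \<ge> 1) \<and> precubical_morphism (pgrid ?n k) P \<xi> \<longrightarrow>
        (\<exists>l \<zeta> \<phi> \<psi>. (\<forall>j\<in>{1..?n}. l j \<ge> 1) \<and> precubical_morphism (pgrid ?n l) Q \<zeta> \<and>
           homeomorphic_maps (box ?n k) (box ?n l) \<phi> \<psi> \<and> box_mono ?n k \<phi> \<and> box_mono ?n l \<psi> \<and>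
           (\<forall>t\<in>topspace (box ?n k).
              f (realisation_map P \<xi> (grid_point ?n k t)) =
              realisation_map Q \<zeta> (grid_point ?n l (\<phi> t))))"
    using f n unfolding weak_morphism_def by blast
  from this[rule_format, of "\<lambda>_. 1" ?\<xi>] cell_face_morphism[OF P x]
  obtain l \<zeta> \<phi> \<psi> where l: "\<forall>j\<in>{1..?n}. l j \<ge> 1" and \<zeta>: "precubical_morphism (pgrid ?n l) Q \<zeta>"
    and hom: "homeomorphic_maps (box ?n (\<lambda>_. 1)) (box ?n l) \<phi> \<psi>"
    and mono: "box_mono ?n (\<lambda>_. 1) \<phi>" "box_mono ?n l \<psi>"
    and eq: "\<forall>t\<in>topspace (box ?n (\<lambda>_. 1)). f (realisation_map P ?\<xi> (grid_point ?n (\<lambda>_. 1) t)) =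
              realisation_map Q \<zeta> (grid_point ?n l (\<phi> t))"
    by auto
  have top1: "topspace (box ?n (\<lambda>_. 1)) = ucube ?n" and topl: "topspace (box ?n l) = rbox ?n (\<lambda>m. of_int (l m))"
    by (simp_all add: box_def)
  have "\<exists>A \<tau>. bij_betw \<tau> {1..?n} {1..?n} \<and>
    (\<forall>m\<in>{1..?n}. A m ` {0..1} = {0..of_int (l m)} \<and> strict_mono_on {0..1} (A m)) \<and>
    (\<forall>t\<in>ucube ?n. \<forall>m\<in>{1..?n}. \<phi> t m = A m (t (\<tau> m)))"
  proof (rule box_order_iso_product)
    fix m assume "m \<in> {1..?n}"
    then show "0 < real_of_int (l m)" using l by force
  next
    fix t assume "t \<in> ucube ?n"
    then show "\<phi> t \<in> rbox ?n (\<lambda>m. of_int (l m))" "\<psi> (\<phi> t) = t"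
      using hom unfolding homeomorphic_maps_def continuous_map_def top1 topl by auto
  next
    fix s assume "s \<in> rbox ?n (\<lambda>m. of_int (l m))"
    then show "\<psi> s \<in> ucube ?n" "\<phi> (\<psi> s) = s"
      using hom unfolding homeomorphic_maps_def continuous_map_def top1 topl by auto
  next
    fix s t assume "s \<in> ucube ?n" "t \<in> ucube ?n" "le_box ?n s t"
    then show "le_box ?n (\<phi> s) (\<phi> t)"
      using mono(1) unfolding box_mono_def top1 le_box_def by blast
  next
    fix s t assume "s \<in> rbox ?n (\<lambda>m. of_int (l m))" "t \<in> rbox ?n (\<lambda>m. of_int (l m))" "le_box ?n s t"
    then show "le_box ?n (\<psi> s) (\<psi> t)"
      using mono(2) unfolding box_mono_def topl le_box_def by blast
  qed
  then obtain A \<tau> where A\<tau>: "bij_betw \<tau> {1..?n} {1..?n} \<and>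
    (\<forall>m\<in>{1..?n}. A m ` {0..1} = {0..of_int (l m)} \<and> strict_mono_on {0..1} (A m)) \<and>
    (\<forall>t\<in>ucube ?n. \<forall>m\<in>{1..?n}. \<phi> t m = A m (t (\<tau> m)))"
    by (elim exE)
  note \<tau> = A\<tau>[THEN conjunct1] and A = A\<tau>[THEN conjunct2, THEN conjunct1, rule_format]
    and \<phi>A = A\<tau>[THEN conjunct2, THEN conjunct2, rule_format]
  have "cell_chart P Q f x ?n l A \<tau> (\<lambda>i. \<zeta> (grid_cube ?n i))"
  proof
    show "precubical_set Q" "x \<in> cubes P" "deg P x = deg P x" "bij_betw \<tau> {1..?n} {1..?n}"
      using Q x \<tau> by auto
    fix m assume "m \<in> {1..?n}"
    then show "1 \<le> l m" "A m ` {0..1} = {0..of_int (l m)}" "strict_mono_on {0..1} (A m)"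
      using l A by auto
  next
    fix i assume "\<And>m. m \<in> {1..?n} \<Longrightarrow> 0 \<le> i m \<and> i m < l m"
    then have "grid_cube ?n i \<in> cubes (pgrid ?n l)"
      by (intro grid_cube_in_pgrid) blast
    then show "\<zeta> (grid_cube ?n i) \<in> cubes Q \<and> deg Q (\<zeta> (grid_cube ?n i)) = ?n"
      using \<zeta> deg_grid_cube[of ?n l i] unfolding precubical_morphism_def by metis
  next
    fix t i assume t: "t \<in> ucube ?n"
      and i: "\<And>m. m \<in> {1..?n} \<Longrightarrow> 0 \<le> i m \<and> i m < l m \<and>
        of_int (i m) \<le> A m (t (\<tau> m)) \<and> A m (t (\<tau> m)) \<le> of_int (i m) + 1"
    let ?u = "\<lambda>m\<in>{1..?n}. A m (t (\<tau> m)) - of_int (i m)"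
    have "\<phi> t \<in> rbox ?n (\<lambda>m. of_int (l m))"
      using hom t unfolding homeomorphic_maps_def continuous_map_def top1 topl by blast
    then have "\<phi> t = (\<lambda>m\<in>{1..?n}. of_int (i m) + ?u m)"
      using \<phi>A[OF t] by (intro extensionalityI[of _ "{1..?n}"]) (simp_all add: PiE_iff)
    \<comment> \<open>\<open>grid_point_eq\<close> admits any grid cube containing the point, not
      just the one selected by \<open>grid_index\<close>.\<close>
    moreover have "grid_point ?n l (\<lambda>m\<in>{1..?n}. of_int (i m) + ?u m) = rpoint (pgrid ?n l) (grid_cube ?n i, ?u)"
    proof (rule grid_point_eq)
      show "\<forall>j\<in>{1..?n}. 0 \<le> i j \<and> i j < l j" using i by blast
      have "?u m \<in> {0..1}" if "m \<in> {1..?n}" for m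
        using i[OF that] that by simp
      then show "?u \<in> topspace (unit_cube ?n)"
        unfolding topspace_unit_cube by (intro PiE_I) auto
    qed
    ultimately have "grid_point ?n l (\<phi> t) = rpoint (pgrid ?n l) (grid_cube ?n i, ?u)"
      by (simp only:)
    then show "f (rpoint P (x, t)) = rpoint Q (\<zeta> (grid_cube ?n i), ?u)"
      using eq[unfolded top1, rule_format, OF t] realisation_map_cell_face[OF P x t]
        realisation_map_rpoint[OF \<zeta>] by simp
  qed
  then show ?thesis by blast
qed

context cell_chart
begin

section \<open>The map f in grid coordinates\<close>

definition coords :: "(nat \<Rightarrow> real) \<Rightarrow> nat \<Rightarrow> real" where
  "coords t m = A m (t (\<tau> m))"

lemma perm_in: "m \<in> {1..n} \<Longrightarrow> \<tau> m \<in> {1..n}"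
  using perm by (auto simp: bij_betw_def)

lemma coords_in:
  assumes "t \<in> ucube n" "m \<in> {1..n}"
  shows "coords t m \<in> {0..of_int (l m)}"
  unfolding coords_def image[OF assms(2), symmetric]
  by (rule imageI) (rule PiE_mem[OF assms(1) perm_in[OF assms(2)]])

lemma A_less_iff: "m \<in> {1..n} \<Longrightarrow> r \<in> {0..1} \<Longrightarrow> s \<in> {0..1} \<Longrightarrow> A m r < A m s \<longleftrightarrow> r < s"
  by (rule strict_mono_on_less[OF strict])

lemma A_le_iff: "m \<in> {1..n} \<Longrightarrow> r \<in> {0..1} \<Longrightarrow> s \<in> {0..1} \<Longrightarrow> A m r \<le> A m s \<longleftrightarrow> r \<le> s"
  by (rule strict_mono_on_less_eq[OF strict])

lemma A_0: assumes m: "m \<in> {1..n}" shows "A m 0 = 0"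
proof -
  have "(0::real) \<in> {0..of_int (l m)}" using l[OF m] by simp
  then obtain r where r: "r \<in> {0..1}" "A m r = 0"
    using image[OF m] by (metis imageE)
  have "A m 0 \<in> {0..of_int (l m)}" unfolding image[OF m, symmetric] by (rule imageI) simp
  moreover have "A m 0 \<le> A m r" using A_le_iff[OF m _ r(1), of 0] r(1) by simp
  ultimately show ?thesis using r by simp
qed

lemma A_1: assumes m: "m \<in> {1..n}" shows "A m 1 = of_int (l m)"
proof -
  have "(of_int (l m)::real) \<in> {0..of_int (l m)}" using l[OF m] by simp
  then obtain r where r: "r \<in> {0..1}" "A m r = of_int (l m)"
    using image[OF m] by (metis imageE)
  have "A m 1 \<in> {0..of_int (l m)}" unfolding image[OF m, symmetric] by (rule imageI) simp
  moreover have "A m r \<le> A m 1" using A_le_iff[OF m r(1), of 1] r(1) by simp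
  ultimately show ?thesis using r by simp
qed

text \<open>Since \<open>\<tau>\<close> is a permutation, the equations involve different
  coordinates of \<open>t\<close> and can be solved one by one.\<close>

lemma coords_surj:
  assumes s: "\<And>m. m \<in> {1..n} \<Longrightarrow> s m \<in> {0..of_int (l m)}"
  shows "\<exists>t\<in>ucube n. \<forall>m\<in>{1..n}. coords t m = s m"
proof -
  have "\<exists>r\<in>{0..1}. A m r = s m" if "m \<in> {1..n}" for m
    using s[OF that] unfolding image[OF that, symmetric] by auto
  then obtain r where r: "\<And>m. m \<in> {1..n} \<Longrightarrow> r m \<in> {0..1} \<and> A m (r m) = s m" by metis
  define t where "t = (\<lambda>j\<in>{1..n}. r (inv_into {1..n} \<tau> j))"
  have inv: "inv_into {1..n} \<tau> j \<in> {1..n}" if "j \<in> {1..n}" for j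
    using that perm by (metis bij_betw_def inv_into_into)
  have "t \<in> ucube n" unfolding t_def using r inv by (intro PiE_I) auto
  moreover have "coords t m = s m" if m: "m \<in> {1..n}" for m
    using r[OF m] perm_in[OF m] m inv_into_f_f[of \<tau> "{1..n}" m] perm
    unfolding coords_def t_def bij_betw_def by simp
  ultimately show ?thesis by blast
qed

text \<open>Cut off like \<open>grid_index\<close>, so that the far end \<open>l m\<close> belongs
  to the last cube of the grid.\<close>

definition index :: "(nat \<Rightarrow> real) \<Rightarrow> nat \<Rightarrow> int" where
  "index s m = min \<lfloor>s m\<rfloor> (l m - 1)"

text \<open>The last two bounds are for rounding: neither the floor nor the ceiling of a coordinate
  leaves the selected grid cube.\<close>

lemma index_props:
  assumes m: "m \<in> {1..n}" and s: "s m \<in> {0..of_int (l m)}"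
  shows "0 \<le> index s m" "index s m < l m" "of_int (index s m) \<le> s m" "s m \<le> of_int (index s m) + 1"
    "of_int (index s m) \<le> (of_int \<lfloor>s m\<rfloor> :: real)" "of_int \<lceil>s m\<rceil> \<le> (of_int (index s m) + 1 :: real)"
proof -
  show "0 \<le> index s m" "index s m < l m" using s l[OF m] by (auto simp: index_def)
  have *: "\<lfloor>s m\<rfloor> \<le> index s m + 1 \<and> s m \<le> of_int (index s m) + 1"
  proof (cases "\<lfloor>s m\<rfloor> \<le> l m - 1")
    case True
    then have "index s m = \<lfloor>s m\<rfloor>" by (simp add: index_def)
    then show ?thesis by linarith
  next
    case False
    then have "index s m = l m - 1" by (simp add: index_def)
    then show ?thesis using s by (auto simp: floor_le_iff)
  qed
  then show "s m \<le> of_int (index s m) + 1" by blast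
  have "index s m \<le> \<lfloor>s m\<rfloor>" by (simp add: index_def)
  then show "of_int (index s m) \<le> (of_int \<lfloor>s m\<rfloor> :: real)" "of_int (index s m) \<le> s m" by linarith+
  have "\<lceil>s m\<rceil> \<le> index s m + 1" using * by (simp add: ceiling_le_iff)
  then show "of_int \<lceil>s m\<rceil> \<le> (of_int (index s m) + 1 :: real)" by linarith
qed

lemma coords_index:
  assumes "t \<in> ucube n" "m \<in> {1..n}"
  shows "0 \<le> index (coords t) m" "index (coords t) m < l m" "of_int (index (coords t) m) \<le> coords t m"
    "coords t m \<le> of_int (index (coords t) m) + 1"
    "of_int (index (coords t) m) \<le> (of_int \<lfloor>coords t m\<rfloor> :: real)"
    "of_int \<lceil>coords t m\<rceil> \<le> (of_int (index (coords t) m) + 1 :: real)"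
  using index_props[of m "coords t", OF assms(2) coords_in[OF assms]] by simp_all

text \<open>The grid cube \<open>i\<close> is arbitrary among those containing the point, so that
  two points can be expressed in one common cube of \<open>Q\<close>.\<close>

lemma f_local:
  assumes t: "t \<in> ucube n" and i: "\<And>m. m \<in> {1..n} \<Longrightarrow> 0 \<le> i m \<and> i m < l m \<and>
      of_int (i m) \<le> coords t m \<and> coords t m \<le> of_int (i m) + 1"
  shows "f (rpoint P (x, t)) = rpoint Q (c i, \<lambda>m\<in>{1..n}. coords t m - of_int (i m))"
    "c i \<in> cubes Q" "deg Q (c i) = n" "(\<lambda>m\<in>{1..n}. coords t m - of_int (i m)) \<in> ucube n"
proof -
  show "f (rpoint P (x, t)) = rpoint Q (c i, \<lambda>m\<in>{1..n}. coords t m - of_int (i m))"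
    using f_eq[OF t] i unfolding coords_def by simp
  show "c i \<in> cubes Q" "deg Q (c i) = n" using c[of i] i by auto
  show "(\<lambda>m\<in>{1..n}. coords t m - of_int (i m)) \<in> ucube n"
    using i by (intro PiE_I) (auto simp: algebra_simps)
qed

lemma f_index:
  assumes t: "t \<in> ucube n"
  shows "f (rpoint P (x, t)) = rpoint Q (c (index (coords t)), \<lambda>m\<in>{1..n}. coords t m - of_int (index (coords t) m))"
    "c (index (coords t)) \<in> cubes Q" "deg Q (c (index (coords t))) = n"
    "(\<lambda>m\<in>{1..n}. coords t m - of_int (index (coords t) m)) \<in> ucube n"
proof -
  have i: "0 \<le> index (coords t) m \<and> index (coords t) m < l m \<and>
      of_int (index (coords t) m) \<le> coords t m \<and> coords t m \<le> of_int (index (coords t) m) + 1"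
    if m: "m \<in> {1..n}" for m
    using coords_index[OF t m] by simp
  note f_local[OF t, of "index (coords t)", OF i]
  then show "f (rpoint P (x, t)) = rpoint Q (c (index (coords t)), \<lambda>m\<in>{1..n}. coords t m - of_int (index (coords t) m))"
    "c (index (coords t)) \<in> cubes Q" "deg Q (c (index (coords t))) = n"
    "(\<lambda>m\<in>{1..n}. coords t m - of_int (index (coords t) m)) \<in> ucube n"
    by simp_all
qed

text \<open>Relative to the selected grid cube the coordinates lie between \<open>0\<close> and
  \<open>1\<close>, where being an integer means being \<open>0\<close> or \<open>1\<close>.\<close>

lemma corner_iff:
  assumes t: "t \<in> ucube n" and q: "f (rpoint P (x, t)) = rpoint Q q"
  shows "corner Q q \<longleftrightarrow> (\<forall>m\<in>{1..n}. coords t m \<in> \<int>)"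
proof -
  have "corner Q q = corner Q (c (index (coords t)), \<lambda>m\<in>{1..n}. coords t m - of_int (index (coords t) m))"
    using corner_rpoint_eq[OF Q] q f_index(1)[OF t] by metis
  also have "\<dots> \<longleftrightarrow> (\<forall>m\<in>{1..n}. coords t m \<in> \<int>)"
    unfolding corner_def prod.case f_index(3)[OF t]
  proof (intro ball_cong refl)
    fix m assume m: "m \<in> {1..n}"
    let ?i = "index (coords t) m"
    have "0 \<le> coords t m - of_int ?i" "coords t m - of_int ?i \<le> 1"
      using coords_index[OF t m] by linarith+
    moreover have "r \<in> {0, 1} \<longleftrightarrow> r \<in> \<int>" if "0 \<le> r" "r \<le> 1" for r :: real
    proof
      assume "r \<in> \<int>"
      then obtain k where k: "r = of_int k" by (auto elim: Ints_cases)
      then have "0 \<le> k" "k \<le> 1" using that by linarith+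
      then have "k = 0 \<or> k = 1" by linarith
      then show "r \<in> {0, 1}" using k by auto
    qed auto
    moreover have "coords t m - of_int ?i \<in> \<int> \<longleftrightarrow> coords t m \<in> \<int>"
      by (metis Ints_diff Ints_add Ints_of_int diff_add_cancel)
    ultimately have "coords t m - of_int ?i \<in> {0, 1} \<longleftrightarrow> coords t m \<in> \<int>"
      by blast
    then show "(\<lambda>m\<in>{1..n}. coords t m - of_int (index (coords t) m)) m \<in> {0, 1} \<longleftrightarrow> coords t m \<in> \<int>"
      using m by (simp only: restrict_apply')
  qed
  finally show ?thesis .
qed

text \<open>Rounded coordinates stay in the grid cube of \<open>t\<close>, so that rounding in the
  grid is rounding in a single cube of \<open>Q\<close>.\<close>

lemma floor_ceiling_eq:
  assumes t: "t \<in> ucube n" and q: "f (rpoint P (x, t)) = rpoint Q q" and t': "t' \<in> ucube n"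
  shows "\<forall>m\<in>{1..n}. coords t' m = of_int \<lfloor>coords t m\<rfloor> \<Longrightarrow> floor_point Q q = f (rpoint P (x, t'))"
    "\<forall>m\<in>{1..n}. coords t' m = of_int \<lceil>coords t m\<rceil> \<Longrightarrow> ceiling_point Q q = f (rpoint P (x, t'))"
proof -
  let ?i = "index (coords t)"
  note ip = coords_index[OF t]
  have eq: "floor_point Q q = floor_point Q (c ?i, \<lambda>m\<in>{1..n}. coords t m - of_int (?i m))"
    "ceiling_point Q q = ceiling_point Q (c ?i, \<lambda>m\<in>{1..n}. coords t m - of_int (?i m))"
    using floor_point_rpoint_eq[OF Q] q f_index(1)[OF t] by metis+
  {
    assume t'c: "\<forall>m\<in>{1..n}. coords t' m = of_int \<lfloor>coords t m\<rfloor>"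
    have "f (rpoint P (x, t')) = rpoint Q (c ?i, \<lambda>m\<in>{1..n}. coords t' m - of_int (?i m))"
    proof (rule f_local(1)[OF t'])
      fix m assume m: "m \<in> {1..n}"
      have "coords t' m \<le> coords t m" using t'c m by simp
      then show "0 \<le> ?i m \<and> ?i m < l m \<and> of_int (?i m) \<le> coords t' m \<and> coords t' m \<le> of_int (?i m) + 1"
        using ip[OF m] t'c[rule_format, OF m] by linarith
    qed
    also have "(\<lambda>m\<in>{1..n}. coords t' m - of_int (?i m)) =
        (\<lambda>j\<in>{1..n}. of_int \<lfloor>(\<lambda>m\<in>{1..n}. coords t m - of_int (?i m)) j\<rfloor>)"
      using t'c by (intro restrict_ext) simp
    finally show "floor_point Q q = f (rpoint P (x, t'))"
      unfolding eq(1) unfolding floor_point_def prod.case f_index(3)[OF t] by (rule sym)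
  }
  {
    assume t'c: "\<forall>m\<in>{1..n}. coords t' m = of_int \<lceil>coords t m\<rceil>"
    have "f (rpoint P (x, t')) = rpoint Q (c ?i, \<lambda>m\<in>{1..n}. coords t' m - of_int (?i m))"
    proof (rule f_local(1)[OF t'])
      fix m assume m: "m \<in> {1..n}"
      have "coords t m \<le> coords t' m" using t'c m by simp
      then show "0 \<le> ?i m \<and> ?i m < l m \<and> of_int (?i m) \<le> coords t' m \<and> coords t' m \<le> of_int (?i m) + 1"
        using ip[OF m] t'c[rule_format, OF m] by linarith
    qed
    also have "(\<lambda>m\<in>{1..n}. coords t' m - of_int (?i m)) =
        (\<lambda>j\<in>{1..n}. of_int \<lceil>(\<lambda>m\<in>{1..n}. coords t m - of_int (?i m)) j\<rceil>)"
      using t'c by (intro restrict_ext) simp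
    finally show "ceiling_point Q q = f (rpoint P (x, t'))"
      unfolding eq(2) unfolding ceiling_point_def prod.case f_index(3)[OF t] by (rule sym)
  }
qed

text \<open>A coordinate is frozen exactly when its grid value is an integer, and then floor and
  ceiling agree with it. Otherwise they are the two ends of the grid cube in that direction.\<close>

lemma closed_carrier_eq:
  assumes t: "t \<in> ucube n" and q: "f (rpoint P (x, t)) = rpoint Q q"
  shows "closed_carrier Q q = {f (rpoint P (x, t')) |t'. t' \<in> ucube n \<and>
    (\<forall>m\<in>{1..n}. of_int \<lfloor>coords t m\<rfloor> \<le> coords t' m \<and> coords t' m \<le> of_int \<lceil>coords t m\<rceil>)}"
proof -
  let ?i = "index (coords t)"
  let ?u = "\<lambda>m\<in>{1..n}. coords t m - of_int (?i m)"
  note ip = coords_index[OF t]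
  have eq: "closed_carrier Q q = closed_carrier Q (c ?i, ?u)"
    using closed_carrier_rpoint_eq[OF Q] q f_index(1)[OF t] by metis
  have loc: "f (rpoint P (x, t')) = rpoint Q (c ?i, \<lambda>m\<in>{1..n}. coords t' m - of_int (?i m)) \<and>
      (\<lambda>m\<in>{1..n}. coords t' m - of_int (?i m)) \<in> ucube n"
    if t': "t' \<in> ucube n"
      "\<forall>m\<in>{1..n}. of_int \<lfloor>coords t m\<rfloor> \<le> coords t' m \<and> coords t' m \<le> of_int \<lceil>coords t m\<rceil>" for t'
  proof -
    have "0 \<le> ?i m \<and> ?i m < l m \<and> of_int (?i m) \<le> coords t' m \<and> coords t' m \<le> of_int (?i m) + 1"
      if m: "m \<in> {1..n}" for m
      using ip[OF m] t'(2)[rule_format, OF m] by linarith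
    then show ?thesis using f_local(1,4)[OF t'(1), of ?i] by blast
  qed
  show ?thesis
    unfolding eq
  proof (intro subset_antisym subsetI)
    fix z assume "z \<in> closed_carrier Q (c ?i, ?u)"
    then obtain v where v: "z = rpoint Q (c ?i, v)" "v \<in> ucube n" "\<forall>j\<in>{1..n}. ?u j \<in> {0, 1} \<longrightarrow> v j = ?u j"
      unfolding closed_carrier_def prod.case f_index(3)[OF t] by blast
    let ?s = "\<lambda>m. of_int (?i m) + v m"
    have s: "of_int \<lfloor>coords t m\<rfloor> \<le> ?s m \<and> ?s m \<le> of_int \<lceil>coords t m\<rceil>" if m: "m \<in> {1..n}" for m
    proof (cases "coords t m - of_int (?i m) \<in> {0, 1}")
      case True
      then have "?s m = coords t m" using v(3) m by auto
      then show ?thesis by simp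
    next
      case False
      have v01: "0 \<le> v m" "v m \<le> 1" using v(2) m by (auto simp: PiE_iff)
      have "of_int (?i m) < coords t m" "coords t m < of_int (?i m) + 1"
        using False ip[OF m] by auto
      then have "\<lfloor>coords t m\<rfloor> = ?i m" "\<lceil>coords t m\<rceil> = ?i m + 1" by linarith+
      then show ?thesis using v01 by simp
    qed
    have "?s m \<in> {0..of_int (l m)}" if m: "m \<in> {1..n}" for m
    proof -
      have "0 \<le> \<lfloor>coords t m\<rfloor>" "\<lceil>coords t m\<rceil> \<le> l m"
        using coords_in[OF t m] by (simp_all add: ceiling_le_iff)
      then have "(0::real) \<le> of_int \<lfloor>coords t m\<rfloor>" "(of_int \<lceil>coords t m\<rceil> :: real) \<le> of_int (l m)" by linarith+
      then show ?thesis using s[OF m] unfolding atLeastAtMost_iff by linarith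
    qed
    then obtain t' where t': "t' \<in> ucube n" "\<forall>m\<in>{1..n}. coords t' m = ?s m"
      using coords_surj[of ?s] by blast
    have *: "\<forall>m\<in>{1..n}. of_int \<lfloor>coords t m\<rfloor> \<le> coords t' m \<and> coords t' m \<le> of_int \<lceil>coords t m\<rceil>"
      using s t'(2) by simp
    have "(\<lambda>m\<in>{1..n}. coords t' m - of_int (?i m)) = v"
      using t'(2) v(2) by (auto simp: fun_eq_iff PiE_iff extensional_def)
    then have "z = f (rpoint P (x, t'))" using loc[OF t'(1) *] v(1) by simp
    then show "z \<in> {f (rpoint P (x, t')) |t'. t' \<in> ucube n \<and>
      (\<forall>m\<in>{1..n}. of_int \<lfloor>coords t m\<rfloor> \<le> coords t' m \<and> coords t' m \<le> of_int \<lceil>coords t m\<rceil>)}"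
      using t'(1) * by blast
  next
    fix z assume "z \<in> {f (rpoint P (x, t')) |t'. t' \<in> ucube n \<and>
      (\<forall>m\<in>{1..n}. of_int \<lfloor>coords t m\<rfloor> \<le> coords t' m \<and> coords t' m \<le> of_int \<lceil>coords t m\<rceil>)}"
    then obtain t' where t': "z = f (rpoint P (x, t'))" "t' \<in> ucube n"
      "\<forall>m\<in>{1..n}. of_int \<lfloor>coords t m\<rfloor> \<le> coords t' m \<and> coords t' m \<le> of_int \<lceil>coords t m\<rceil>" by blast
    let ?v = "\<lambda>m\<in>{1..n}. coords t' m - of_int (?i m)"
    have "?v m = ?u m" if m: "m \<in> {1..n}" and u: "?u m \<in> {0, 1}" for m
    proof -
      have "coords t m = of_int (?i m) \<or> coords t m = of_int (?i m + 1)" using u m by auto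
      then have "coords t' m = coords t m"
        using t'(3)[rule_format, OF m] by (elim disjE) simp_all
      then show ?thesis using m by simp
    qed
    then have "\<forall>j\<in>{1..n}. ?u j \<in> {0, 1} \<longrightarrow> ?v j = ?u j" by blast
    then show "z \<in> closed_carrier Q (c ?i, ?u)"
      unfolding closed_carrier_def prod.case f_index(3)[OF t] mem_Collect_eq
      using loc[OF t'(2,3)] t'(1) by (intro exI[of _ ?v] conjI) blast+
  qed
qed

text \<open>By induction on the total distance. One coordinate is raised by one, after which the old
  and the new point are corners of the same cube of \<open>Q\<close>.\<close>

lemma reach_grid:
  assumes "t \<in> ucube n" "t' \<in> ucube n"
    and "\<And>m. m \<in> {1..n} \<Longrightarrow> coords t m = of_int (a m)" "\<And>m. m \<in> {1..n} \<Longrightarrow> coords t' m = of_int (a' m)"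
    and "\<And>m. m \<in> {1..n} \<Longrightarrow> a m \<le> a' m"
  shows "reach Q (f (rpoint P (x, t))) (f (rpoint P (x, t')))"
  using assms
proof (induction "nat (\<Sum>m\<in>{1..n}. a' m - a m)" arbitrary: t a rule: less_induct)
  case less
  have bound: "0 \<le> a m" "a' m \<le> l m" if m: "m \<in> {1..n}" for m
    using coords_in[OF less.prems(1) m] coords_in[OF less.prems(2) m] less.prems(3,4)[OF m] by simp_all
  show ?case
  proof (cases "\<exists>m\<in>{1..n}. a m < a' m")
    case False
    have eq: "coords t m = coords t' m" if m: "m \<in> {1..n}" for m
    proof -
      have "a m = a' m" using False less.prems(5)[OF m] m by force
      then show ?thesis using less.prems(3,4)[OF m] by simp
    qed
    then have "f (rpoint P (x, t)) = f (rpoint P (x, t'))"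
      using f_local(1)[OF less.prems(1), of "index (coords t)"] f_local(1)[OF less.prems(2), of "index (coords t)"]
        coords_index[OF less.prems(1)]
      by (simp cong: restrict_cong)
    then show ?thesis by simp
  next
    case True
    then obtain m0 where m0: "m0 \<in> {1..n}" "a m0 < a' m0" by blast
    let ?b = "a(m0 := a m0 + 1)"
    have ba: "?b m \<le> a' m" "0 \<le> ?b m" if "m \<in> {1..n}" for m using less.prems(5)[OF that] m0(2) bound[OF that] by auto
    have "of_int (?b m) \<in> {0..real_of_int (l m)}" if m: "m \<in> {1..n}" for m
      using ba[OF m] bound[OF m] by (simp del: fun_upd_apply)
    then obtain t2 where t2: "t2 \<in> ucube n" "\<forall>m\<in>{1..n}. coords t2 m = of_int (?b m)"
      using coords_surj[of "\<lambda>m. of_int (?b m)"] by blast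
    \<comment> \<open>The lower corner of a grid cube having both \<open>a\<close> and
      \<open>?b\<close> among its corners. The cut-off serves coordinates at the far end; it leaves
      \<open>m0\<close> alone, where \<open>a m0 < l m0\<close>.\<close>
    define i where "i = (\<lambda>m. min (a m) (l m - 1))"
    have im0: "i m0 = a m0" using m0(2) bound[OF m0(1)] by (simp add: i_def)
    have i: "0 \<le> i m" "i m < l m" "i m \<le> a m" "a m \<le> i m + 1" if m: "m \<in> {1..n}" for m
      using bound[OF m] l[OF m] less.prems(5)[OF m] by (auto simp: i_def)
    have ib: "i m \<le> ?b m" "?b m \<le> i m + 1" if m: "m \<in> {1..n}" for m
      using i[OF m] im0 by auto
    let ?u = "\<lambda>m\<in>{1..n}. coords t m - of_int (i m)" and ?w = "\<lambda>m\<in>{1..n}. coords t2 m - of_int (i m)"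
    have "0 \<le> i m \<and> i m < l m \<and> of_int (i m) \<le> coords t m \<and> coords t m \<le> of_int (i m) + 1" if m: "m \<in> {1..n}" for m
      using i[OF m] less.prems(3)[OF m] by simp
    note ft = f_local[OF less.prems(1) this, simplified]
    have "0 \<le> i m \<and> i m < l m \<and> of_int (i m) \<le> coords t2 m \<and> coords t2 m \<le> of_int (i m) + 1" if m: "m \<in> {1..n}" for m
    proof -
      have "coords t2 m = of_int (?b m)" using t2(2) m by blast
      then show ?thesis using i[OF m] ib[OF m] by linarith
    qed
    note ft2 = f_local[OF t2(1) this, simplified]
    have z01: "of_int z \<in> {0, 1::real}" if "0 \<le> z" "z \<le> 1" for z :: int
      using that by (cases "z = 0") auto
    have "reach Q (rpoint Q (c i, ?u)) (rpoint Q (c i, ?w))"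
    proof (rule reach_corners[OF Q])
      show "c i \<in> cubes Q" "?u \<in> ucube (deg Q (c i))" "?w \<in> ucube (deg Q (c i))" using ft ft2 by simp_all
      have "?u m \<in> {0, 1}" if m: "m \<in> {1..n}" for m
        using z01[of "a m - i m"] i[OF m] m less.prems(3)[OF m] by simp
      then show "corner Q (c i, ?u)" unfolding corner_def prod.case using ft by blast
      have "?w m \<in> {0, 1}" if m: "m \<in> {1..n}" for m
        using z01[of "?b m - i m"] ib[OF m] m t2(2) by (simp del: fun_upd_apply)
      then show "corner Q (c i, ?w)" unfolding corner_def prod.case using ft by blast
      have "?u m \<le> ?w m" if m: "m \<in> {1..n}" for m
        using m t2(2) less.prems(3)[OF m] by simp
      then show "\<forall>j\<in>{1..deg Q (c i)}. ?u j \<le> ?w j" using ft by simp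
    qed
    then have "reach Q (f (rpoint P (x, t))) (f (rpoint P (x, t2)))"
      using ft(1) ft2(1) by simp
    also have "reach Q (f (rpoint P (x, t2))) (f (rpoint P (x, t')))"
    proof (rule less.hyps[of ?b])
      have "(\<Sum>m\<in>{1..n}. a' m - ?b m) < (\<Sum>m\<in>{1..n}. a' m - a m)"
        using m0(1) by (intro sum_strict_mono_ex1) auto
      moreover have "0 \<le> (\<Sum>m\<in>{1..n}. a' m - ?b m)"
        using ba by (intro sum_nonneg) (simp del: fun_upd_apply)
      ultimately show "nat (\<Sum>m\<in>{1..n}. a' m - ?b m) < nat (\<Sum>m\<in>{1..n}. a' m - a m)" by linarith
      show "coords t2 m = of_int (?b m)" if "m \<in> {1..n}" for m using t2(2) that by blast
    qed (use t2 less.prems ba in blast)+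
    finally (rtranclp_trans) show ?thesis .
  qed
qed

end

section \<open>Squashing the subdivision\<close>

definition to_vertex :: "'b precubical \<Rightarrow> ('a point \<Rightarrow> 'b point) \<Rightarrow> 'a point \<Rightarrow> bool" where
  "to_vertex Q f z \<longleftrightarrow> (\<exists>q. f z = rpoint Q q \<and> corner Q q)"

text \<open>The first parameter on the \<open>j\<close>-th initial edge of \<open>x\<close> at which \<open>f\<close> arrives at a vertex. It is
  defined in terms of \<open>f\<close> rather than in terms of a chart, so that it agrees on parallel edges.\<close>

definition breakpoint :: "'a precubical \<Rightarrow> 'b precubical \<Rightarrow> ('a point \<Rightarrow> 'b point) \<Rightarrow> 'a \<Rightarrow> nat \<Rightarrow> real" where
  "breakpoint P Q f x j = Inf {r \<in> {0<..1}. to_vertex Q f (rpoint P (x, axis_point (deg P x) j r))}"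

definition squash :: "'a precubical \<Rightarrow> 'b precubical \<Rightarrow> ('a point \<Rightarrow> 'b point) \<Rightarrow> 'a \<Rightarrow> (nat \<Rightarrow> real) \<Rightarrow> nat \<Rightarrow> real" where
  "squash P Q f x u = (\<lambda>j\<in>{1..deg P x}. min 1 (u j / breakpoint P Q f x j))"

context cell_chart
begin

section \<open>Squashing in one chart\<close>

lemma to_vertex_iff:
  assumes "t \<in> ucube n"
  shows "to_vertex Q f (rpoint P (x, t)) \<longleftrightarrow> (\<forall>m\<in>{1..n}. coords t m \<in> \<int>)"
  unfolding to_vertex_def using corner_iff[OF assms] f_index(1)[OF assms] by metis

lemma A_corner: "m \<in> {1..n} \<Longrightarrow> r \<in> {0, 1} \<Longrightarrow> A m r \<in> \<int>"
  using A_0 A_1 by auto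

text \<open>The point runs along an edge of \<open>x\<close> parallel to the axis
  \<open>\<tau> m\<close>. All other coordinates are \<open>0\<close> or \<open>1\<close>, hence
  integers in the grid, so that \<open>A m\<close> alone decides.\<close>

lemma to_vertex_edge_iff:
  assumes m: "m \<in> {1..n}" and t: "t \<in> ucube n" "\<And>j. j \<in> {1..n} \<Longrightarrow> j \<noteq> \<tau> m \<Longrightarrow> t j \<in> {0, 1}" and r: "r \<in> {0..1}"
  shows "to_vertex Q f (rpoint P (x, t(\<tau> m := r))) \<longleftrightarrow> A m r \<in> \<int>"
proof -
  let ?t = "t(\<tau> m := r)"
  have "?t \<in> (\<Pi>\<^sub>E j\<in>insert (\<tau> m) {1..n}. {0..1})"
    by (rule PiE_fun_upd[OF r t(1)])
  then have "?t \<in> ucube n"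
    unfolding insert_absorb[OF perm_in[OF m]] .
  then have "to_vertex Q f (rpoint P (x, ?t)) \<longleftrightarrow> (\<forall>m'\<in>{1..n}. coords ?t m' \<in> \<int>)"
    by (rule to_vertex_iff)
  also have "\<dots> \<longleftrightarrow> A m r \<in> \<int>"
  proof
    assume "\<forall>m'\<in>{1..n}. coords ?t m' \<in> \<int>"
    then have "coords ?t m \<in> \<int>" using m by (rule bspec)
    then show "A m r \<in> \<int>" by (simp add: coords_def)
  next
    assume A: "A m r \<in> \<int>"
    show "\<forall>m'\<in>{1..n}. coords ?t m' \<in> \<int>"
    proof
      fix m' assume m': "m' \<in> {1..n}"
      show "coords ?t m' \<in> \<int>"
      proof (cases "m' = m")
        case True
        then show ?thesis using A by (simp add: coords_def)
      next
        case False
        then have "\<tau> m' \<noteq> \<tau> m" using perm m m' by (auto simp: bij_betw_def dest: inj_onD)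
        then show ?thesis
          using A_corner[OF m' t(2)[OF perm_in[OF m']]] by (simp add: coords_def)
      qed
    qed
  qed
  finally show ?thesis .
qed

text \<open>\<open>A m\<close> increases strictly from \<open>0\<close> and takes the value
  \<open>1\<close> because \<open>l m \<ge> 1\<close>; so the infimum is a minimum, attained where
  \<open>A m\<close> equals \<open>1\<close>.\<close>

lemma first_vertex:
  assumes m: "m \<in> {1..n}"
  obtains r where "r \<in> {0<..1}" "A m r = 1" "Inf {r \<in> {0<..1}. A m r \<in> \<int>} = r"
proof -
  have "(1::real) \<in> {0..of_int (l m)}" using l[OF m] by simp
  then obtain r where r: "r \<in> {0..1}" "A m r = 1"
    using image[OF m] by (metis imageE)
  have "A m 0 < A m r" using A_0[OF m] r(2) by simp
  then have r0: "0 < r" using A_less_iff[OF m _ r(1), of 0] by simp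
  have "Inf {r \<in> {0<..1}. A m r \<in> \<int>} = r"
  proof (rule cInf_eq_minimum)
    show "r \<in> {r \<in> {0<..1}. A m r \<in> \<int>}" using r r0 by simp
    fix s assume s: "s \<in> {r \<in> {0<..1}. A m r \<in> \<int>}"
    then have s1: "s \<in> {0..1}" by simp
    have "A m 0 < A m s" using A_less_iff[OF m _ s1, of 0] s by simp
    then have "0 < A m s" using A_0[OF m] by simp
    moreover obtain k where "A m s = of_int k" using s by (auto elim: Ints_cases)
    ultimately have "1 \<le> A m s" by simp
    then show "r \<le> s" using A_le_iff[OF m r(1) s1] r(2) by simp
  qed
  then show thesis using that r r0 by simp
qed

text \<open>Edges of \<open>x\<close> parallel to the same axis meet vertices at the same
  parameters. This is what makes breakpoints agree between a cube and its faces.\<close>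

lemma Inf_edge:
  assumes m: "m \<in> {1..n}" and t: "t \<in> ucube n" "\<And>j. j \<in> {1..n} \<Longrightarrow> j \<noteq> \<tau> m \<Longrightarrow> t j \<in> {0, 1}"
  shows "Inf {r \<in> {0<..1}. to_vertex Q f (rpoint P (x, t(\<tau> m := r)))} = breakpoint P Q f x (\<tau> m)"
proof -
  let ?z = "axis_point n (\<tau> m) 0"
  have z: "?z \<in> ucube n" using axis_point_in[where d = "\<lambda>_. 1", OF perm_in[OF m]] by simp
  have "{r \<in> {0<..1}. to_vertex Q f (rpoint P (x, t(\<tau> m := r)))} = {r \<in> {0<..1}. A m r \<in> \<int>}"
    if "t \<in> ucube n" "\<And>j. j \<in> {1..n} \<Longrightarrow> j \<noteq> \<tau> m \<Longrightarrow> t j \<in> {0, 1}" for t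
    using to_vertex_edge_iff[OF m that] by (intro Collect_cong) auto
  note eq = this
  have axis: "axis_point n (\<tau> m) r = ?z(\<tau> m := r)" for r
    using perm_in[OF m] by (auto simp: axis_point_def fun_eq_iff)
  have "breakpoint P Q f x (\<tau> m) = Inf {r \<in> {0<..1}. to_vertex Q f (rpoint P (x, ?z(\<tau> m := r)))}"
    unfolding breakpoint_def n[symmetric]
    by (rule arg_cong[where f = "\<lambda>g. Inf {r \<in> {0<..1}. to_vertex Q f (rpoint P (x, g r))}"], rule ext, rule axis)
  also have "\<dots> = Inf {r \<in> {0<..1}. A m r \<in> \<int>}"
    using eq[OF z] by (simp add: axis_point_apply)
  finally show ?thesis using eq[OF t] by simp
qed

lemma breakpoint_props:
  assumes m: "m \<in> {1..n}"
  shows "breakpoint P Q f x (\<tau> m) \<in> {0<..1}" "A m (breakpoint P Q f x (\<tau> m)) = 1"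
proof -
  let ?z = "axis_point n (\<tau> m) 0"
  have z: "?z \<in> ucube n" using axis_point_in[where d = "\<lambda>_. 1", OF perm_in[OF m]] by simp
  have "{r \<in> {0<..1}. to_vertex Q f (rpoint P (x, ?z(\<tau> m := r)))} = {r \<in> {0<..1}. A m r \<in> \<int>}"
    using to_vertex_edge_iff[OF m z] by (intro Collect_cong) (auto simp: axis_point_apply)
  then have "breakpoint P Q f x (\<tau> m) = Inf {r \<in> {0<..1}. A m r \<in> \<int>}"
    using Inf_edge[OF m z] by (simp add: axis_point_apply)
  then show "breakpoint P Q f x (\<tau> m) \<in> {0<..1}" "A m (breakpoint P Q f x (\<tau> m)) = 1"
    using first_vertex[OF m] by metis+
qed

lemma index_of: "j \<in> {1..n} \<Longrightarrow> \<exists>m\<in>{1..n}. \<tau> m = j"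
  using perm by (metis bij_betw_def imageE)

lemma breakpoint_in: "j \<in> {1..n} \<Longrightarrow> breakpoint P Q f x j \<in> {0<..1}"
  using index_of[of j] breakpoint_props(1) by blast

lemma squash_in: "u \<in> ucube n \<Longrightarrow> squash P Q f x u \<in> ucube n"
  unfolding squash_def n[symmetric] restrict_PiE_iff
  using breakpoint_in rbox_bounds(1)[of u n "\<lambda>_. 1"] by (auto intro!: divide_nonneg_pos)

text \<open>The breakpoint is the parameter at which the grid coordinate is \<open>1\<close>, and
  exactly the parameters from there on are squashed to \<open>1\<close>.\<close>

lemma squash_coords:
  assumes t: "t \<in> ucube n" and m: "m \<in> {1..n}"
  shows "squash P Q f x t (\<tau> m) = 1 \<longleftrightarrow> 1 \<le> coords t m" "squash P Q f x t (\<tau> m) = 0 \<longleftrightarrow> coords t m = 0"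
proof -
  let ?b = "breakpoint P Q f x (\<tau> m)" and ?s = "t (\<tau> m)"
  have b: "0 < ?b" "?b \<in> {0..1}" using breakpoint_props(1)[OF m] by auto
  have s: "?s \<in> {0..1}" using PiE_mem[OF t perm_in[OF m]] .
  have sq: "squash P Q f x t (\<tau> m) = min 1 (?s / ?b)"
    using perm_in[OF m] n by (simp add: squash_def)
  have "1 \<le> coords t m \<longleftrightarrow> ?b \<le> ?s"
    using A_le_iff[OF m b(2) s] breakpoint_props(2)[OF m] by (simp add: coords_def)
  then show "squash P Q f x t (\<tau> m) = 1 \<longleftrightarrow> 1 \<le> coords t m"
    unfolding sq using b(1) by (simp add: min_def le_divide_eq)
  have "coords t m = 0 \<longleftrightarrow> ?s = 0"
    using A_less_iff[OF m _ s, of 0] A_0[OF m] s coords_in[OF t m] unfolding coords_def by force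
  then show "squash P Q f x t (\<tau> m) = 0 \<longleftrightarrow> coords t m = 0"
    unfolding sq using b(1) by (simp add: min_def)
qed

lemma squash_mono:
  assumes t: "t \<in> ucube n" "t' \<in> ucube n" and j: "j \<in> {1..n}" and le: "t j \<le> t' j"
  shows "squash P Q f x t j \<le> squash P Q f x t' j"
  using breakpoint_in[OF j] j le n by (simp add: squash_def divide_right_mono min.coboundedI2)

lemma coords_le_iff:
  assumes "t \<in> ucube n" "t' \<in> ucube n" "m \<in> {1..n}"
  shows "coords t m \<le> coords t' m \<longleftrightarrow> t (\<tau> m) \<le> t' (\<tau> m)"
  unfolding coords_def
  by (rule A_le_iff[OF assms(3) PiE_mem[OF assms(1) perm_in[OF assms(3)]] PiE_mem[OF assms(2) perm_in[OF assms(3)]]])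

text \<open>An integral grid coordinate is either \<open>0\<close> or at least \<open>1\<close>, and
  is squashed to \<open>0\<close> or \<open>1\<close> accordingly.\<close>

lemma squash_corner:
  assumes t: "t \<in> ucube n" and int: "\<And>m. m \<in> {1..n} \<Longrightarrow> coords t m \<in> \<int>"
  shows "corner P (x, squash P Q f x t)"
  unfolding corner_def prod.case n[symmetric]
proof
  fix j assume "j \<in> {1..n}"
  then obtain m where m: "m \<in> {1..n}" "\<tau> m = j" using index_of by blast
  obtain k where k: "coords t m = of_int k" using int[OF m(1)] by (auto elim: Ints_cases)
  have "0 \<le> coords t m" using coords_in[OF t m(1)] by simp
  then have "k = 0 \<or> 1 \<le> k" using k by auto
  then have "coords t m = 0 \<or> 1 \<le> coords t m" using k by auto
  then show "squash P Q f x t j \<in> {0, 1}" using squash_coords[OF t m(1)] m(2) by auto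
qed

end

locale weak_homeomorphism =
  fixes P :: "'a precubical" and Q :: "'b precubical" and f :: "'a point \<Rightarrow> 'b point"
  assumes P: "precubical_set P" and Q: "precubical_set Q" and weak: "weak_morphism P Q f"
    and homeo: "homeomorphic_map (realisation P) (realisation Q) f"
begin

section \<open>The squash as a self-map of |P|\<close>

lemma chart:
  assumes "x \<in> cubes P"
  obtains l A \<tau> c where "cell_chart P Q f x (deg P x) l A \<tau> c"
  using weak_morphism_chart[OF P Q weak assms] by blast

abbreviation sq :: "'a \<Rightarrow> (nat \<Rightarrow> real) \<Rightarrow> nat \<Rightarrow> real" where
  "sq \<equiv> squash P Q f"

abbreviation squash_map :: "'a point \<Rightarrow> 'a point" where
  "squash_map \<equiv> cellwise_map P sq"

text \<open>The \<open>j\<close>-th initial edge of a face is an edge of \<open>x\<close> parallel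
  to an axis, whose index is shifted by one from \<open>i\<close> on. It need not be an initial edge
  of \<open>x\<close>, and \<open>Inf_edge\<close> bridges the difference.\<close>

lemma breakpoint_bd:
  assumes x: "x \<in> cubes P" and i: "i \<in> {1..deg P x}" and j: "j \<in> {1..deg P x - 1}"
  shows "breakpoint P Q f (bd P k i x) j = breakpoint P Q f x (if j < i then j else j + 1)"
proof -
  let ?n = "deg P x" and ?j = "if j < i then j else j + 1"
  have d: "deg P (bd P k i x) = ?n - 1" using precubical_set_bd(2)[OF P x i] .
  have j': "?j \<in> {1..?n}" using i j by auto
  obtain l A \<tau> c where "cell_chart P Q f x ?n l A \<tau> c" using chart[OF x] .
  then interpret cell_chart P Q f x ?n l A \<tau> c .
  obtain m where m: "m \<in> {1..?n}" "\<tau> m = ?j" using index_of[OF j'] by blast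
  let ?e = "axis_point (?n - 1) j" and ?f = "cube_face ?n k i"
  have e: "?e r \<in> ucube (?n - 1)" if "r \<in> {0..1}" for r
    using axis_point_in[where d = "\<lambda>_. 1", OF j] that by simp
  have e0: "?f (?e 0) \<in> ucube ?n" using cube_face_in[OF e i] by simp
  have corners: "?f (?e 0) a \<in> {0, 1}" if "a \<in> {1..?n}" for a
    using cube_face_ball[OF i, of "\<lambda>s _. s \<in> {0, 1}" k "?e 0" "?e 0"] that by (simp add: axis_point_apply)
  have fe: "?f (?e r) = (?f (?e 0))(?j := r)" for r
  proof
    fix a
    consider "a < i" "a \<in> {1..?n - 1}" | "a = i" | "i < a" "a - 1 \<in> {1..?n - 1}" | "a \<notin> {1..?n}"
      using i by fastforce
    then show "?f (?e r) a = ((?f (?e 0))(?j := r)) a"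
      using i j by cases (auto simp: cube_face_def axis_point_apply)
  qed
  have eq: "rpoint P (bd P k i x, ?e r) = rpoint P (x, (?f (?e 0))(?j := r))" if "r \<in> {0<..1}" for r
    using rpoint_face'[OF x i e, of r k] that unfolding fe[of r] by simp
  have "breakpoint P Q f (bd P k i x) j = Inf {r \<in> {0<..1}. to_vertex Q f (rpoint P (x, (?f (?e 0))(?j := r)))}"
    unfolding breakpoint_def d
    by (rule arg_cong[where f = Inf], rule Collect_cong, rule conj_cong[OF refl]) (simp only: eq)
  also have "\<dots> = breakpoint P Q f x ?j"
    using Inf_edge[OF m(1) e0] corners unfolding m(2) by blast
  finally show ?thesis .
qed

lemma coherent_squash: "coherent P sq"
  unfolding coherent_def
proof (intro ballI conjI allI)
  fix x u assume x: "x \<in> cubes P" and u: "u \<in> ucube (deg P x)"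
  obtain l A \<tau> c where "cell_chart P Q f x (deg P x) l A \<tau> c" using chart[OF x] .
  then show "sq x u \<in> ucube (deg P x)" using u by (rule cell_chart.squash_in)
next
  fix x k i u assume x: "x \<in> cubes P" and i: "i \<in> {1..deg P x}" and u: "u \<in> ucube (deg P x - 1)"
  let ?n = "deg P x"
  obtain l A \<tau> c where ch: "cell_chart P Q f x ?n l A \<tau> c" using chart[OF x] .
  have d: "deg P (bd P k i x) = ?n - 1" using precubical_set_bd(2)[OF P x i] .
  have b: "0 < breakpoint P Q f x i" "breakpoint P Q f x i \<le> 1"
    using cell_chart.breakpoint_in[OF ch i] by auto
  \<comment> \<open>To respect faces the squash has to fix \<open>0\<close> and \<open>1\<close>;
    for \<open>1\<close> this rests on a breakpoint of at most \<open>1\<close>.\<close>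
  have bi: "min 1 (of_bool k / breakpoint P Q f x i) = of_bool k"
    using b by (cases k) (auto simp: min_def le_divide_eq)
  show "sq x (cube_face ?n k i u) = cube_face ?n k i (sq (bd P k i x) u)"
  proof
    fix j
    consider "j < i" "j \<in> {1..?n - 1}" | "j = i" | "i < j" "j - 1 \<in> {1..?n - 1}" | "j \<notin> {1..?n}"
      using i by fastforce
    then show "sq x (cube_face ?n k i u) j = cube_face ?n k i (sq (bd P k i x) u) j"
    proof cases
      case 1
      then show ?thesis using breakpoint_bd[OF x i 1(2), of k] d i by (auto simp: squash_def cube_face_def)
    next
      case 2
      then show ?thesis using bi i by (simp add: squash_def cube_face_def)
    next
      case 3
      then show ?thesis using breakpoint_bd[OF x i 3(2), of k] d i by (auto simp: squash_def cube_face_def)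
    next
      case 4
      then show ?thesis by (auto simp: squash_def cube_face_def)
    qed
  qed
qed

lemma squash_map_rpoint: "squash_map (rpoint P (x, u)) = rpoint P (x, sq x u)"
  by (rule cellwise_map_rpoint[OF P coherent_squash])

lemma homotopic_squash_map: "homotopic_with (\<lambda>_. True) (realisation P) (realisation P) id squash_map"
proof (rule homotopic_cellwise_map[OF P coherent_squash])
  fix x j assume j: "j \<in> {1..deg P x}"
  have "continuous_map (unit_cube (deg P x)) euclideanreal (\<lambda>u. u j)"
    unfolding unit_cube_def
    using continuous_map_product_projection[OF j, of "\<lambda>_. top_of_set {0..1}"] continuous_map_in_subtopology by blast
  then have "continuous_map (unit_cube (deg P x)) euclideanreal (\<lambda>u. min 1 (u j * inverse (breakpoint P Q f x j)))"
    by (intro continuous_map_real_min continuous_map_real_mult) auto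
  then show "continuous_map (unit_cube (deg P x)) euclideanreal (\<lambda>u. sq x u j)"
    using j by (simp add: squash_def divide_inverse)
qed

lemma realisationE:
  assumes "z \<in> topspace (realisation P)"
  obtains x t where "x \<in> cubes P" "t \<in> ucube (deg P x)" "z = rpoint P (x, t)"
  using assms by (auto simp: topspace_realisation_cell_points)

lemma rpoint_in_topspace: "x \<in> cubes P \<Longrightarrow> t \<in> ucube (deg P x) \<Longrightarrow> rpoint P (x, t) \<in> topspace (realisation P)"
  by (auto simp: topspace_realisation_cell_points)

lemma f_inj: "z \<in> topspace (realisation P) \<Longrightarrow> z' \<in> topspace (realisation P) \<Longrightarrow> f z = f z' \<Longrightarrow> z = z'"
  using homeomorphic_imp_injective_map[OF homeo] by (auto dest: inj_onD)

lemma f_surj: "y \<in> topspace (realisation Q) \<Longrightarrow> \<exists>z\<in>topspace (realisation P). f z = y"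
  using homeomorphic_imp_surjective_map[OF homeo] by (metis imageE)

subsection \<open>From \<open>P\<close> to \<open>Q\<close>\<close>

text \<open>By \<open>closed_carrier_eq\<close>, the smallest cell of \<open>Q\<close> containing
  \<open>f z\<close> consists of images of points of one cube of \<open>X\<close>, so it lies in the
  image of |X|.\<close>

lemma image_in_cells_within:
  assumes X: "X \<subseteq> cubes P" and z: "z \<in> realisation_subset P X"
  shows "f z \<in> realisation_subset Q (cells_within Q (f ` realisation_subset P X))"
proof -
  obtain x t where xt: "x \<in> X" "t \<in> ucube (deg P x)" "z = rpoint P (x, t)"
    using z by (auto simp: realisation_subset_eq)
  have xc: "x \<in> cubes P" using X xt(1) by blast
  obtain l A \<tau> c where "cell_chart P Q f x (deg P x) l A \<tau> c" using chart[OF xc] .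
  then interpret cell_chart P Q f x "deg P x" l A \<tau> c .
  let ?i = "index (coords t)"
  let ?u = "\<lambda>m\<in>{1..deg P x}. coords t m - of_int (?i m)"
  note fi = f_index[OF xt(2)]
  have "closed_carrier Q (c ?i, ?u) \<subseteq> f ` realisation_subset P X"
    unfolding closed_carrier_eq[OF xt(2) fi(1)] realisation_subset_eq using xt(1) by blast
  then have "rpoint Q (c ?i, ?u) \<in> realisation_subset Q (cells_within Q (f ` realisation_subset P X))"
    using fi by (intro in_cells_within[OF Q]) simp_all
  then show ?thesis using fi(1) xt(3) by simp
qed

text \<open>The vertex has integral grid coordinates between \<open>0\<close> and
  \<open>l m\<close>, the values at the lowest and the highest corner of a cube of \<open>X\<close>;
  \<open>reach_grid\<close> gives both paths.\<close>

lemma vertices_of_image: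
  assumes X: "precubical_subset P X" and w: "w \<in> cells_within Q (f ` realisation_subset P X)" "deg Q w = 0"
  shows "\<exists>v\<in>X. deg P v = 0 \<and> reach Q (vertex_point Q w) (f (vertex_point P v))"
    "\<exists>v\<in>X. deg P v = 0 \<and> reach Q (f (vertex_point P v)) (vertex_point Q w)"
proof -
  have "vertex_point Q w \<in> f ` realisation_subset P X"
    using w by (simp add: cells_within_def vertex_point_def)
  then obtain x t where xt: "x \<in> X" "t \<in> ucube (deg P x)" "vertex_point Q w = f (rpoint P (x, t))"
    by (auto simp: realisation_subset_eq)
  have xc: "x \<in> cubes P" using X xt(1) by (auto simp: precubical_subset_def)
  obtain l A \<tau> c where "cell_chart P Q f x (deg P x) l A \<tau> c" using chart[OF xc] .
  then interpret cell_chart P Q f x "deg P x" l A \<tau> c .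
  let ?n = "deg P x"
  have "corner Q (w, \<lambda>_. undefined)" using w(2) by (simp add: corner_def)
  then have "coords t m \<in> \<int>" if "m \<in> {1..?n}" for m
    using corner_iff[OF xt(2), of "(w, \<lambda>_. undefined)"] xt(3) that unfolding vertex_point_def by simp
  then have "\<exists>a. coords t m = of_int a" if "m \<in> {1..?n}" for m
    using that by (meson Ints_cases)
  then obtain a where a: "\<And>m. m \<in> {1..?n} \<Longrightarrow> coords t m = of_int (a m)" by metis
  have al: "0 \<le> a m \<and> a m \<le> l m" if "m \<in> {1..?n}" for m
    using coords_in[OF xt(2) that] a[OF that] by simp
  \<comment> \<open>The lowest corner for \<open>r = 0\<close> and the highest one for
    \<open>r = 1\<close>.\<close>
  define s where "s = (\<lambda>r::real. \<lambda>j\<in>{1..?n}. r)"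
  have s: "s r \<in> ucube ?n" "corner P (x, s r)" if "r \<in> {0, 1}" for r
    using that unfolding s_def restrict_PiE_iff corner_def by auto
  have cs: "coords (s 1) m = of_int (l m)" "coords (s 0) m = of_int 0" if "m \<in> {1..?n}" for m
    using A_0[OF that] A_1[OF that] perm_in[OF that] by (simp_all add: coords_def s_def)
  have "reach Q (f (rpoint P (x, t))) (f (rpoint P (x, s 1)))"
    by (rule reach_grid[OF xt(2) s(1) a cs(1)]) (use al in auto)
  moreover obtain v where "v \<in> X" "deg P v = 0" "rpoint P (x, s 1) = vertex_point P v"
    using corner_vertex[OF P X xt(1) s(1) s(2), of 1] by auto
  ultimately show "\<exists>v\<in>X. deg P v = 0 \<and> reach Q (vertex_point Q w) (f (vertex_point P v))"
    using xt(3) by auto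
  have "reach Q (f (rpoint P (x, s 0))) (f (rpoint P (x, t)))"
    by (rule reach_grid[OF s(1) xt(2) cs(2) a]) (use al in auto)
  moreover obtain v where "v \<in> X" "deg P v = 0" "rpoint P (x, s 0) = vertex_point P v"
    using corner_vertex[OF P X xt(1) s(1) s(2), of 0] by auto
  ultimately show "\<exists>v\<in>X. deg P v = 0 \<and> reach Q (f (vertex_point P v)) (vertex_point Q w)"
    using xt(3) by auto
qed

text \<open>The chart of an edge subdivides it into \<open>l m\<close> edges of \<open>Q\<close>,
  traversed in the same direction.\<close>

lemma reach_image:
  assumes "reach P z z'"
  shows "reach Q (f z) (f z')"
  using assms
proof induction
  case (step y z')
  obtain e where e: "e \<in> cubes P" "deg P e = 1" "y = vertex_point P (bd P False 1 e)"
      "z' = vertex_point P (bd P True 1 e)"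
    using step.hyps(2) by (auto simp: edge_step_def)
  obtain l A \<tau> c where "cell_chart P Q f e (deg P e) l A \<tau> c" using chart[OF e(1)] .
  then interpret cell_chart P Q f e "deg P e" l A \<tau> c .
  define s where "s = (\<lambda>k. cube_face 1 k 1 (\<lambda>_. undefined))"
  have s: "s k \<in> ucube (deg P e)" "vertex_point P (bd P k 1 e) = rpoint P (e, s k)" for k
    using cube_face_in[of "\<lambda>_. undefined" 1 1 k] rpoint_face'[OF e(1), of 1 "\<lambda>_. undefined" k] e(2)
    by (simp_all add: s_def vertex_point_def)
  have "coords (s True) m = of_int (l m)" "coords (s False) m = of_int 0" if m: "m \<in> {1..deg P e}" for m
  proof -
    have "\<tau> m = 1" using perm_in[OF m] e(2) by simp
    then show "coords (s True) m = of_int (l m)" "coords (s False) m = of_int 0"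
      using A_0[OF m] A_1[OF m] by (simp_all add: coords_def s_def cube_face_def)
  qed
  note cs = this
  have "reach Q (f (rpoint P (e, s False))) (f (rpoint P (e, s True)))"
    by (rule reach_grid[OF s(1) s(1) cs(2) cs(1)]) (use l in force)+
  then show ?case
    using step.IH e(3,4) s(2) by simp
qed simp

lemma edge_forward:
  assumes X: "precubical_subset P X" and Y: "precubical_subset P Y"
    and path: "\<forall>x\<in>X. \<forall>y\<in>Y. deg P x = 0 \<and> deg P y = 0 \<longrightarrow> (\<exists>k \<omega>. precubical_path P x y k \<omega>)"
  shows "\<forall>x\<in>cells_within Q (f ` realisation_subset P X). \<forall>y\<in>cells_within Q (f ` realisation_subset P Y).
    deg Q x = 0 \<and> deg Q y = 0 \<longrightarrow> (\<exists>k \<omega>. precubical_path Q x y k \<omega>)"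
proof (intro ballI impI)
  fix x y assume x: "x \<in> cells_within Q (f ` realisation_subset P X)"
    and y: "y \<in> cells_within Q (f ` realisation_subset P Y)" and "deg Q x = 0 \<and> deg Q y = 0"
  then have d: "deg Q x = 0" "deg Q y = 0" by simp_all
  obtain v where v: "v \<in> X" "deg P v = 0" "reach Q (vertex_point Q x) (f (vertex_point P v))"
    using vertices_of_image(1)[OF X x d(1)] by blast
  obtain w where w: "w \<in> Y" "deg P w = 0" "reach Q (f (vertex_point P w)) (vertex_point Q y)"
    using vertices_of_image(2)[OF Y y d(2)] by blast
  have "\<exists>k \<omega>. precubical_path P v w k \<omega>"
    using path v(1,2) w(1,2) by simp
  then have "reach P (vertex_point P v) (vertex_point P w)"
    by (elim exE precubical_path_imp_reach)
  \<comment> \<open>Concatenation: from \<open>x\<close> to the image of \<open>v\<close>, along the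
    image of a path in \<open>P\<close> to the image of \<open>w\<close>, and on to
    \<open>y\<close>.\<close>
  then have "reach Q (vertex_point Q x) (vertex_point Q y)"
    using reach_image v(3) w(3) by (meson rtranclp_trans)
  then show "\<exists>k \<omega>. precubical_path Q x y k \<omega>"
    using precubical_path_iff_reach[OF Q] x d by (simp add: cells_within_def)
qed

subsection \<open>From \<open>Q\<close> to \<open>P\<close>\<close>

text \<open>This set of points is turned into a set of cubes by \<open>cells_within\<close>; by
  \<open>squash_map_in_cells_within\<close> no point is lost.\<close>

definition squashed :: "'b set \<Rightarrow> 'a point set" where
  "squashed X = squash_map ` {z \<in> topspace (realisation P). f z \<in> realisation_subset Q X}"

text \<open>Every point of the carrier of the squashed point must itself come from a point over |X|.
  It is lifted to a point of the same cube \<open>x\<close> whose image stays in the carrier of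
  \<open>f z\<close>, and this carrier lies in |X|.\<close>

lemma squash_map_in_cells_within:
  assumes z: "z \<in> topspace (realisation P)" and fz: "f z \<in> realisation_subset Q X"
  shows "squash_map z \<in> realisation_subset P (cells_within P (squashed X))"
proof -
  obtain x t where xt: "x \<in> cubes P" "t \<in> ucube (deg P x)" "z = rpoint P (x, t)"
    using z by (rule realisationE)
  obtain l A \<tau> c where "cell_chart P Q f x (deg P x) l A \<tau> c" using chart[OF xt(1)] .
  then interpret cell_chart P Q f x "deg P x" l A \<tau> c .
  let ?n = "deg P x"
  let ?q = "(c (index (coords t)), \<lambda>m\<in>{1..?n}. coords t m - of_int (index (coords t) m))"
  have car: "closed_carrier Q ?q \<subseteq> realisation_subset Q X"
    using fz unfolding xt(3) f_index(1)[OF xt(2)] by (rule closed_carrier_subset[OF Q])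
  have "closed_carrier P (x, sq x t) \<subseteq> squashed X"
  proof
    fix y assume "y \<in> closed_carrier P (x, sq x t)"
    then obtain v where v: "y = rpoint P (x, v)" "v \<in> ucube ?n" "\<forall>j\<in>{1..?n}. sq x t j \<in> {0, 1} \<longrightarrow> v j = sq x t j"
      unfolding closed_carrier_def by blast
    let ?b = "breakpoint P Q f x"
    \<comment> \<open>The lift: coordinates squashed to \<open>1\<close> are kept, and the others
      are put on the first piece by the inverse of the stretching.\<close>
    let ?t = "\<lambda>j\<in>{1..?n}. if sq x t j = 1 then t j else ?b j * v j"
    have b: "0 < ?b j" "?b j \<le> 1" if "j \<in> {1..?n}" for j using breakpoint_in[OF that] by auto
    have v01: "0 \<le> v j" "v j \<le> 1" if "j \<in> {1..?n}" for j
      using rbox_bounds[where d = "\<lambda>_. 1", OF v(2) that] by auto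
    have bv: "?b j * v j \<in> {0..1}" if "j \<in> {1..?n}" for j
      using mult_nonneg_nonneg[OF less_imp_le[OF b(1)[OF that]] v01(1)[OF that]]
        mult_le_one[OF b(2)[OF that] v01(1)[OF that] v01(2)[OF that]] by simp
    have t': "?t \<in> ucube ?n"
      unfolding restrict_PiE_iff using bv PiE_mem[OF xt(2)] by simp
    have "sq x ?t j = v j" if j: "j \<in> {1..?n}" for j
    proof (cases "sq x t j = 1")
      case True
      then show ?thesis using v(3) j by (simp add: squash_def)
    next
      case False
      then show ?thesis using b[OF j] v01[OF j] j by (simp add: squash_def)
    qed
    then have "sq x ?t = v"
      using squash_in[OF t'] v(2) by (intro PiE_ext[where k = "{1..?n}" and s = "\<lambda>_. {0..1}"]) auto
    then have y: "y = squash_map (rpoint P (x, ?t))" using v(1) by (simp add: squash_map_rpoint)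
    have "of_int \<lfloor>coords t m\<rfloor> \<le> coords ?t m \<and> coords ?t m \<le> of_int \<lceil>coords t m\<rceil>" if m: "m \<in> {1..?n}" for m
    proof -
      let ?j = "\<tau> m"
      have j: "?j \<in> {1..?n}" using perm_in[OF m] .
      show ?thesis
      proof (cases "sq x t ?j \<in> {0, 1}")
        case True
        have "coords ?t m = coords t m"
        proof (cases "sq x t ?j = 1")
          case True
          then show ?thesis using j by (simp add: coords_def)
        next
          case False
          then have s0: "sq x t ?j = 0" using True by simp
          then have "v ?j = 0" using v(3) j by simp
          then have "coords ?t m = 0" using j False A_0[OF m] by (simp add: coords_def)
          moreover have "coords t m = 0" using squash_coords(2)[OF xt(2) m] s0 by simp
          ultimately show ?thesis by simp
        qed
        then show ?thesis by simp
      next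
        case False
        then have "\<not> 1 \<le> coords t m" "coords t m \<noteq> 0"
          using squash_coords[OF xt(2) m] by auto
        then have "0 < coords t m" "coords t m < 1" using coords_in[OF xt(2) m] by auto
        \<comment> \<open>A coordinate still free after squashing lies in the interior of the first
          piece. The carrier of \<open>f z\<close> then spans that whole piece, which contains the
          lifted coordinate.\<close>
        then have fc: "\<lfloor>coords t m\<rfloor> = 0" "\<lceil>coords t m\<rceil> = 1" by linarith+
        have "?t ?j = ?b ?j * v ?j" using j False by simp
        moreover have "?b ?j * v ?j \<le> ?b ?j" using b[OF j] v01[OF j] by (simp add: mult_left_le)
        ultimately have "A m (?t ?j) \<le> A m (?b ?j)"
          using A_le_iff[OF m PiE_mem[OF t' j], of "?b ?j"] b[OF j] by simp
        then have "coords ?t m \<le> 1" using breakpoint_props(2)[OF m] by (simp only: coords_def)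
        then show ?thesis using coords_in[OF t' m] fc by simp
      qed
    qed
    then have "f (rpoint P (x, ?t)) \<in> closed_carrier Q ?q"
      unfolding closed_carrier_eq[OF xt(2) f_index(1)[OF xt(2)]] using t' by blast
    then have "f (rpoint P (x, ?t)) \<in> realisation_subset Q X" using car by blast
    then show "y \<in> squashed X"
      unfolding squashed_def y using rpoint_in_topspace[OF xt(1) t'] by blast
  qed
  then show ?thesis
    unfolding xt(3) squash_map_rpoint using xt(1) squash_in[OF xt(2)] by (intro in_cells_within[OF P])
qed

text \<open>A point squashed to a vertex need not be sent to a vertex by \<open>f\<close>, so its
  grid coordinates are rounded down. Each of them is \<open>0\<close> or at least \<open>1\<close>,
  which rounding preserves; hence the squashed point does not change. The rounded point stays in the
  carrier, so its image is a vertex in |X|.\<close>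

lemma vertices_of_squashed:
  assumes X: "precubical_subset Q X" and v: "v \<in> cells_within P (squashed X)" "deg P v = 0"
  shows "\<exists>w\<in>X. deg Q w = 0 \<and> (\<exists>z\<in>topspace (realisation P). f z = vertex_point Q w \<and> squash_map z = vertex_point P v)"
proof -
  have "vertex_point P v \<in> squashed X"
    using v by (simp add: cells_within_def vertex_point_def)
  then obtain z where z: "z \<in> topspace (realisation P)" "f z \<in> realisation_subset Q X" "vertex_point P v = squash_map z"
    by (auto simp: squashed_def)
  obtain x t where xt: "x \<in> cubes P" "t \<in> ucube (deg P x)" "z = rpoint P (x, t)"
    using z(1) by (rule realisationE)
  obtain l A \<tau> c where "cell_chart P Q f x (deg P x) l A \<tau> c" using chart[OF xt(1)] .
  then interpret cell_chart P Q f x "deg P x" l A \<tau> c .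
  let ?n = "deg P x"
  let ?q = "(c (index (coords t)), \<lambda>m\<in>{1..?n}. coords t m - of_int (index (coords t) m))"
  have car: "closed_carrier Q ?q \<subseteq> realisation_subset Q X"
    using z(2) unfolding xt(3) f_index(1)[OF xt(2)] by (rule closed_carrier_subset[OF Q])
  have "corner P (v, \<lambda>_. undefined)" using v(2) by (simp add: corner_def)
  moreover have "rpoint P (v, \<lambda>_. undefined) = rpoint P (x, sq x t)"
    using z(3) by (simp add: vertex_point_def xt(3) squash_map_rpoint)
  ultimately have "corner P (x, sq x t)" using corner_rpoint_eq[OF P] by blast
  then have c01: "sq x t j \<in> {0, 1}" if "j \<in> {1..?n}" for j using that by (simp add: corner_def)
  have fl: "of_int \<lfloor>coords t m\<rfloor> \<in> {0..real_of_int (l m)}" if "m \<in> {1..?n}" for m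
  proof -
    have "0 \<le> \<lfloor>coords t m\<rfloor>" "\<lfloor>coords t m\<rfloor> \<le> l m"
      using coords_in[OF xt(2) that] by (auto simp: floor_le_iff)
    then show ?thesis by simp
  qed
  then obtain t' where t': "t' \<in> ucube ?n" "\<forall>m\<in>{1..?n}. coords t' m = of_int \<lfloor>coords t m\<rfloor>"
    using coords_surj[of "\<lambda>m. of_int \<lfloor>coords t m\<rfloor>"] by blast
  have "sq x t' j = sq x t j" if j: "j \<in> {1..?n}" for j
  proof -
    obtain m where m: "m \<in> {1..?n}" "\<tau> m = j" using index_of[OF j] by blast
    have "1 \<le> coords t m \<longleftrightarrow> 1 \<le> coords t' m" using t'(2) m(1) by simp
    moreover have "coords t m = 0 \<Longrightarrow> coords t' m = 0" using t'(2) m(1) by simp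
    ultimately show ?thesis
      using squash_coords[OF xt(2) m(1)] squash_coords[OF t'(1) m(1)] c01[OF j] m(2) by auto
  qed
  then have sqt: "sq x t' = sq x t"
    using squash_in[OF t'(1)] squash_in[OF xt(2)] by (intro PiE_ext[where k = "{1..?n}" and s = "\<lambda>_. {0..1}"]) auto
  have "of_int \<lfloor>coords t m\<rfloor> \<le> coords t' m \<and> coords t' m \<le> of_int \<lceil>coords t m\<rceil>" if m: "m \<in> {1..?n}" for m
  proof -
    have "coords t' m = of_int \<lfloor>coords t m\<rfloor>" using t'(2) m by blast
    then show ?thesis by linarith
  qed
  then have "f (rpoint P (x, t')) \<in> closed_carrier Q ?q"
    unfolding closed_carrier_eq[OF xt(2) f_index(1)[OF xt(2)]] using t'(1) by blast
  then have "f (rpoint P (x, t')) \<in> realisation_subset Q X" using car by blast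
  then obtain y u where y: "y \<in> X" "u \<in> ucube (deg Q y)" "f (rpoint P (x, t')) = rpoint Q (y, u)"
    by (auto simp: realisation_subset_eq)
  have "corner Q (y, u)" using corner_iff[OF t'(1) y(3)] t'(2) by simp
  then obtain w where w: "w \<in> X" "deg Q w = 0" "rpoint Q (y, u) = vertex_point Q w"
    using corner_vertex[OF Q X y(1,2)] by blast
  have "squash_map (rpoint P (x, t')) = vertex_point P v"
    unfolding z(3) xt(3) squash_map_rpoint sqt by (rule refl)
  then show ?thesis using w y(3) rpoint_in_topspace[OF xt(1) t'(1)] by auto
qed

text \<open>In the chart of a cube \<open>x\<close> containing the preimage of the midpoint,
  rounding down and up gives the two ends of the edge, and injectivity of \<open>f\<close>
  identifies these with \<open>z\<close> and \<open>z'\<close>. They are squashed to comparable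
  corners of \<open>x\<close>.\<close>

lemma squash_edge:
  assumes e: "edge_step Q (f z) (f z')" and z: "z \<in> topspace (realisation P)" "z' \<in> topspace (realisation P)"
  shows "reach P (squash_map z) (squash_map z')"
proof -
  obtain e where e: "e \<in> cubes Q" "deg Q e = 1" "f z = vertex_point Q (bd Q False 1 e)"
      "f z' = vertex_point Q (bd Q True 1 e)"
    using e by (auto simp: edge_step_def)
  let ?h = "\<lambda>j\<in>{1..1}. 1 / 2 :: real"
  have h: "?h \<in> ucube (deg Q e)" using e(2) unfolding restrict_PiE_iff by simp
  have "rpoint Q (e, ?h) \<in> topspace (realisation Q)"
    using e(1) h by (auto simp: topspace_realisation_cell_points)
  then obtain zm where zm: "zm \<in> topspace (realisation P)" "f zm = rpoint Q (e, ?h)"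
    using f_surj by blast
  obtain x t where xt: "x \<in> cubes P" "t \<in> ucube (deg P x)" "zm = rpoint P (x, t)"
    using zm(1) by (rule realisationE)
  obtain l A \<tau> c where "cell_chart P Q f x (deg P x) l A \<tau> c" using chart[OF xt(1)] .
  then interpret cell_chart P Q f x "deg P x" l A \<tau> c .
  let ?n = "deg P x"
  have q: "f (rpoint P (x, t)) = rpoint Q (e, ?h)" using zm(2) xt(3) by simp
  have face: "vertex_point Q (bd Q k 1 e) = rpoint Q (e, \<lambda>j\<in>{1..1}. of_bool k)" for k
  proof -
    have "cube_face 1 k 1 (\<lambda>_. undefined) = (\<lambda>j\<in>{1..1}. of_bool k)" by (auto simp: cube_face_def)
    then show ?thesis
      using rpoint_face'[OF e(1), of 1 "\<lambda>_. undefined" k] e(2) by (simp add: vertex_point_def)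
  qed
  have "\<lceil>1 / 2 :: real\<rceil> = 1" by (rule ceiling_unique) simp_all
  then have flo: "floor_point Q (e, ?h) = f z" "ceiling_point Q (e, ?h) = f z'"
    unfolding e(3,4) face floor_point_def ceiling_point_def prod.case e(2)
    by (auto intro!: arg_cong[where f = "\<lambda>u. rpoint Q (e, u)"] restrict_ext)
  have bounds: "0 \<le> \<lfloor>coords t m\<rfloor>" "\<lceil>coords t m\<rceil> \<le> l m" "\<lfloor>coords t m\<rfloor> \<le> \<lceil>coords t m\<rceil>" if "m \<in> {1..?n}" for m
    using coords_in[OF xt(2) that] by (simp_all add: ceiling_le_iff floor_le_ceiling)
  have "of_int \<lfloor>coords t m\<rfloor> \<in> {0..real_of_int (l m)}" "of_int \<lceil>coords t m\<rceil> \<in> {0..real_of_int (l m)}"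
    if "m \<in> {1..?n}" for m
    unfolding atLeastAtMost_iff of_int_0_le_iff of_int_le_iff using bounds[OF that] by linarith+
  then obtain t0 t1 where t0: "t0 \<in> ucube ?n" "\<forall>m\<in>{1..?n}. coords t0 m = of_int \<lfloor>coords t m\<rfloor>"
    and t1: "t1 \<in> ucube ?n" "\<forall>m\<in>{1..?n}. coords t1 m = of_int \<lceil>coords t m\<rceil>"
    using coords_surj[of "\<lambda>m. of_int \<lfloor>coords t m\<rfloor>"] coords_surj[of "\<lambda>m. of_int \<lceil>coords t m\<rceil>"] by blast
  have "f z = f (rpoint P (x, t0))" "f z' = f (rpoint P (x, t1))"
    using floor_ceiling_eq(1)[OF xt(2) q t0] floor_ceiling_eq(2)[OF xt(2) q t1] flo by simp_all
  then have zz: "z = rpoint P (x, t0)" "z' = rpoint P (x, t1)"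
    using f_inj z rpoint_in_topspace[OF xt(1)] t0(1) t1(1) by blast+
  have "sq x t0 j \<le> sq x t1 j" if j: "j \<in> {1..?n}" for j
  proof (rule squash_mono[OF t0(1) t1(1) j])
    obtain m where m: "m \<in> {1..?n}" "\<tau> m = j" using index_of[OF j] by blast
    have "coords t0 m \<le> coords t1 m" using t0(2) t1(2) bounds(3)[OF m(1)] m(1) by simp
    then show "t0 j \<le> t1 j" using coords_le_iff[OF t0(1) t1(1) m(1)] m(2) by simp
  qed
  moreover have "corner P (x, sq x t0)" "corner P (x, sq x t1)"
    using squash_corner[OF t0(1)] squash_corner[OF t1(1)] t0(2) t1(2) by simp_all
  ultimately show ?thesis
    unfolding zz squash_map_rpoint using squash_in[OF t0(1)] squash_in[OF t1(1)]
    by (intro reach_corners[OF P xt(1)]) auto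
qed

text \<open>The path is lifted vertex by vertex through the surjection \<open>f\<close>, and each of
  its edges is squashed separately.\<close>

lemma reach_squash:
  assumes "reach Q y y'" "z \<in> topspace (realisation P)" "f z = y"
  shows "\<exists>z'\<in>topspace (realisation P). f z' = y' \<and> reach P (squash_map z) (squash_map z')"
  using assms
proof induction
  case base
  then show ?case by blast
next
  case (step y y')
  then obtain z1 where z1: "z1 \<in> topspace (realisation P)" "f z1 = y" "reach P (squash_map z) (squash_map z1)" by blast
  obtain e where e: "e \<in> cubes Q" "deg Q e = 1" "y' = vertex_point Q (bd Q True 1 e)"
    using step.hyps(2) by (auto simp: edge_step_def)
  have "bd Q True 1 e \<in> cubes Q" "deg Q (bd Q True 1 e) = 0"
    using precubical_set_bd[OF Q e(1), of 1 True] e(2) by auto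
  then have "y' \<in> topspace (realisation Q)"
    unfolding e(3) vertex_point_def topspace_realisation_cell_points by auto
  then obtain z2 where z2: "z2 \<in> topspace (realisation P)" "f z2 = y'" using f_surj by blast
  have "reach P (squash_map z1) (squash_map z2)"
    using squash_edge[of z1 z2] step.hyps(2) z1 z2 by simp
  with z1(3) have "reach P (squash_map z) (squash_map z2)" by (rule rtranclp_trans)
  then show ?case using z2 by blast
qed

lemma edge_backward:
  assumes X: "precubical_subset Q X" and Y: "precubical_subset Q Y"
    and path: "\<forall>x\<in>X. \<forall>y\<in>Y. deg Q x = 0 \<and> deg Q y = 0 \<longrightarrow> (\<exists>k \<omega>. precubical_path Q x y k \<omega>)"
  shows "\<forall>x\<in>cells_within P (squashed X). \<forall>y\<in>cells_within P (squashed Y).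
    deg P x = 0 \<and> deg P y = 0 \<longrightarrow> (\<exists>k \<omega>. precubical_path P x y k \<omega>)"
proof (intro ballI impI)
  fix x y assume x: "x \<in> cells_within P (squashed X)"
    and y: "y \<in> cells_within P (squashed Y)" and "deg P x = 0 \<and> deg P y = 0"
  then have d: "deg P x = 0" "deg P y = 0" by simp_all
  obtain v z where v: "v \<in> X" "deg Q v = 0" "z \<in> topspace (realisation P)" "f z = vertex_point Q v"
      "squash_map z = vertex_point P x"
    using vertices_of_squashed[OF X x d(1)] by blast
  obtain w z' where w: "w \<in> Y" "deg Q w = 0" "z' \<in> topspace (realisation P)" "f z' = vertex_point Q w"
      "squash_map z' = vertex_point P y"
    using vertices_of_squashed[OF Y y d(2)] by blast
  have "\<exists>k \<omega>. precubical_path Q v w k \<omega>"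
    using path v(1,2) w(1,2) by simp
  then have "reach Q (vertex_point Q v) (vertex_point Q w)"
    by (elim exE precubical_path_imp_reach)
  then obtain z2 where z2: "z2 \<in> topspace (realisation P)" "f z2 = vertex_point Q w"
      "reach P (squash_map z) (squash_map z2)"
    using reach_squash v(3,4) by blast
  \<comment> \<open>The lifted path ends at some preimage of \<open>w\<close>; by injectivity it is
    the one that is squashed to \<open>y\<close>.\<close>
  then have "z2 = z'" using f_inj w(3,4) by simp
  then have "reach P (vertex_point P x) (vertex_point P y)"
    using z2(3) v(5) w(5) by simp
  then show "\<exists>k \<omega>. precubical_path P x y k \<omega>"
    using precubical_path_iff_reach[OF P] x d by (simp add: cells_within_def)
qed

section \<open>Transfer of homology classes between |P| and |Q|\<close>

lemma in_image_forward:
  assumes X: "precubical_subset P X" and a: "in_image p (realisation P) (realisation_subset P X) a"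
  shows "in_image p (realisation Q) (realisation_subset Q (cells_within Q (f ` realisation_subset P X))) (rchain_map p f a)"
  using image_in_cells_within[of X] X
  by (intro in_image_map[OF homeomorphic_imp_continuous_map[OF homeo] _ a]) (auto simp: precubical_subset_def)

text \<open>With \<open>g\<close> inverse to \<open>f\<close>, the map
  \<open>squash_map \<circ> g\<close> sends the image of \<open>a\<close> to the squashed
  \<open>a\<close>, which is homologous to \<open>a\<close> by the homotopy from the identity. The
  same map carries |X| into the realisation of a precubical subset of \<open>P\<close>.\<close>

lemma in_image_backward:
  assumes cyc: "rsingular_cycle p (realisation P) a"
    and a: "in_image p (realisation Q) (realisation_subset Q X) (rchain_map p f a)"
  shows "in_image p (realisation P) (realisation_subset P (cells_within P (squashed X))) a"
proof -
  obtain g where g: "homeomorphic_maps (realisation P) (realisation Q) f g"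
    using homeo homeomorphic_map_maps by blast
  have chain: "rsingular_chain p (realisation P) a" using cyc by (simp add: rsingular_cycle_def)
  have g': "continuous_map (realisation Q) (realisation P) g" and gf: "\<And>z. z \<in> topspace (realisation P) \<Longrightarrow> g (f z) = z"
    and fg: "\<And>y. y \<in> topspace (realisation Q) \<Longrightarrow> f (g y) = y"
    using g by (auto simp: homeomorphic_maps_def)
  have sq: "continuous_map (realisation P) (realisation P) squash_map"
    using homotopic_with_imp_continuous_maps[OF homotopic_squash_map] by blast
  have "in_image p (realisation P) (realisation_subset P (cells_within P (squashed X)))
      (rchain_map p (squash_map \<circ> g) (rchain_map p f a))"
  proof (rule in_image_map[OF continuous_map_compose[OF g' sq] _ a])
    fix y assume y: "y \<in> topspace (realisation Q)" "y \<in> realisation_subset Q X"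
    have "g y \<in> topspace (realisation P)" using g' y(1) by (auto simp: continuous_map_def)
    then show "(squash_map \<circ> g) y \<in> realisation_subset P (cells_within P (squashed X))"
      using squash_map_in_cells_within[of "g y" X] fg[OF y(1)] y(2) by simp
  qed
  also have "rchain_map p (squash_map \<circ> g) (rchain_map p f a) = rchain_map p squash_map a"
    unfolding rchain_map_compose[symmetric]
    by (rule rchain_map_cong[OF chain]) (simp add: gf)
  finally have im: "in_image p (realisation P) (realisation_subset P (cells_within P (squashed X)))
      (rchain_map p squash_map a)" .
  have "rhomologous p (realisation P) (rchain_map p squash_map a) (rchain_map p id a)"
    by (rule homotopic_imp_rhomologous[OF homotopic_squash_map cyc])
  then have "rhomologous p (realisation P) (rchain_map p squash_map a) a"
    using rchain_map_ident[OF chain, of id] by simp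
  then show ?thesis using im in_image_rhomologous by blast
qed

end

lemma homology_edge_classes:
  "homology_edge P (p, {b. rhomologous p (realisation P) a b}) (q, {b. rhomologous q (realisation P) a' b}) \<longleftrightarrow>
    (\<exists>X Y. precubical_subset P X \<and> precubical_subset P Y \<and>
      in_image p (realisation P) (realisation_subset P X) a \<and>
      in_image q (realisation P) (realisation_subset P Y) a' \<and>
      (\<forall>x\<in>X. \<forall>y\<in>Y. deg P x = 0 \<and> deg P y = 0 \<longrightarrow> (\<exists>k \<omega>. precubical_path P x y k \<omega>)))"
  unfolding homology_edge_def class_in_image_iff by (rule refl)

theorem theorem4p7p3:
  fixes P :: "'a precubical" and Q :: "'b precubical"
    and f :: "'a point \<Rightarrow> 'b point"
    and \<alpha> \<beta> :: "('a point, 'r::{comm_ring,monoid_mult}) hclass"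
  assumes "precubical_set P" and "precubical_set Q"
    and "weak_morphism P Q f"
    and "homeomorphic_map (realisation P) (realisation Q) f"
    and "\<alpha> \<in> rhomology (realisation P)" and "\<beta> \<in> rhomology (realisation P)"
  shows "homology_edge P \<alpha> \<beta> \<longleftrightarrow>
         homology_edge Q (rhom_induced (realisation Q) f \<alpha>) (rhom_induced (realisation Q) f \<beta>)"
proof -
  interpret weak_homeomorphism P Q f
    using assms(1-4) by unfold_locales
  obtain p a where \<alpha>: "\<alpha> = (p, {b. rhomologous p (realisation P) a b})" and a: "rsingular_cycle p (realisation P) a"
    using assms(5) by (auto simp: rhomology_def)
  obtain q a' where \<beta>: "\<beta> = (q, {b. rhomologous q (realisation P) a' b})" and a': "rsingular_cycle q (realisation P) a'"
    using assms(6) by (auto simp: rhomology_def)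
  have cont: "continuous_map (realisation P) (realisation Q) f"
    using homeomorphic_imp_continuous_map[OF homeo] .
  show ?thesis
    unfolding \<alpha> \<beta> rhom_induced_class[OF cont] homology_edge_classes
  proof (intro iffI; elim exE conjE)
    fix X Y assume "precubical_subset P X" "precubical_subset P Y"
      "in_image p (realisation P) (realisation_subset P X) a"
      "in_image q (realisation P) (realisation_subset P Y) a'"
      "\<forall>x\<in>X. \<forall>y\<in>Y. deg P x = 0 \<and> deg P y = 0 \<longrightarrow> (\<exists>k \<omega>. precubical_path P x y k \<omega>)"
    then show "\<exists>X Y. precubical_subset Q X \<and> precubical_subset Q Y \<and>
      in_image p (realisation Q) (realisation_subset Q X) (rchain_map p f a) \<and>
      in_image q (realisation Q) (realisation_subset Q Y) (rchain_map q f a') \<and>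
      (\<forall>x\<in>X. \<forall>y\<in>Y. deg Q x = 0 \<and> deg Q y = 0 \<longrightarrow> (\<exists>k \<omega>. precubical_path Q x y k \<omega>))"
      by (intro exI[of _ "cells_within Q (f ` realisation_subset P X)"]
          exI[of _ "cells_within Q (f ` realisation_subset P Y)"] conjI
          precubical_subset_cells_within[OF Q] in_image_forward edge_forward)
  next
    fix X Y assume "precubical_subset Q X" "precubical_subset Q Y"
      "in_image p (realisation Q) (realisation_subset Q X) (rchain_map p f a)"
      "in_image q (realisation Q) (realisation_subset Q Y) (rchain_map q f a')"
      "\<forall>x\<in>X. \<forall>y\<in>Y. deg Q x = 0 \<and> deg Q y = 0 \<longrightarrow> (\<exists>k \<omega>. precubical_path Q x y k \<omega>)"
    then show "\<exists>X Y. precubical_subset P X \<and> precubical_subset P Y \<and>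
      in_image p (realisation P) (realisation_subset P X) a \<and>
      in_image q (realisation P) (realisation_subset P Y) a' \<and>
      (\<forall>x\<in>X. \<forall>y\<in>Y. deg P x = 0 \<and> deg P y = 0 \<longrightarrow> (\<exists>k \<omega>. precubical_path P x y k \<omega>))"
      by (intro exI[of _ "cells_within P (squashed X)"] exI[of _ "cells_within P (squashed Y)"] conjI
          precubical_subset_cells_within[OF P] in_image_backward a a' edge_backward)
  qed
qed

end
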